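(* Consider the uniform permutation model for the free group $\Gamma$, and let $\mu\in\mathrm{Prob}^\Gamma(\mathtt{A}^\Gamma)$ with $\mathtt A$ a finite alphabet. If the product self-joining $\mu\times\mu$ has maximal $\mathrm f$ invariant among all self-joinings of $\mu$ (i.e. $\mathrm f(\lambda)\le\mathrm f(\mu\times\mu)$ for every self-joining $\lambda$ of $\mu$), then $\mathrm f(\mu)=h^\flat(\mu)=h^\sharp(\mu)$.
   Context: $\Gamma$ is the free group of rank $r$ with free generators $s_1,\dots,s_r$ and identity $e$; $d(\gamma,e)$ is word length. For any finite alphabet $\mathtt A$, $\Gamma$ acts on $\mathtt{A}^\Gamma$ by $(g\cdot x)(h)=x(hg)$; $\mathrm{Prob}^\Gamma(\mathtt{A}^\Gamma)$ is the set of shift-invariant Borel probability measures. A self-joining of $\mu$ is a shift-invariant coupling of $\mu$ with itself, viewed as an element of $\mathrm{Prob}^\Gamma((\mathtt{A}\times\mathtt{A})^\Gamma)$; its $\mathrm f$ invariant is defined using the alphabet $\mathtt A\times\mathtt A$. For a finite set $V$, $\sigma\in\mathrm{Hom}(\Gamma,\mathrm{Sym}(V))$ and $x\in\mathtt{A}^V$, let $(\Pi_v^\sigma x)(h)=x(\sigma^h v)$ and $P_x^\sigma=\frac1{|V|}\sum_{v\in V}\delta_{\Pi_v^\sigma x}$. Give $\mathtt{A}^\Gamma$ the metric $d(x,y)=\sum_{\gamma}\mathbf 1_{\{x(\gamma)\ne y(\gamma)\}}(5r^2)^{-d(\gamma,e)}$ and $\mathrm{Prob}^\Gamma(\mathtt{A}^\Gamma)$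 the transportation metric $\overline d(\mu,\nu)=\sup\{|\int f\,d\mu-\int f\,d\nu| : f\text{ real-valued 1-Lipschitz}\}$. Let $\Omega(\sigma,\mu,\varepsilon)=\{x\in\mathtt{A}^V:\overline d(P_x^\sigma,\mu)<\varepsilon\}$. Uniform permutation model: $\sigma_n$ is uniformly distributed on $\mathrm{Hom}(\Gamma,\mathrm{Sym}(n))$, i.e. the permutations $\sigma_n^{s_1},\dots,\sigma_n^{s_r}$ are independent and uniform. The $\mathrm f$ invariant is $\mathrm f(\mu)=\inf_{\varepsilon>0}\limsup_{n\to\infty}\frac1n\log\mathbb{E}|\Omega(\sigma_n,\mu,\varepsilon)|$ (it is known that replacing $\limsup$ by $\liminf$ gives the same value). For $h\in[0,\log|\mathtt{A}|]$ let $\rho_\mu(\sigma,h)=\inf\{\varepsilon>0:\frac1{|V|}\log|\Omega(\sigma,\mu,\varepsilon)|\ge h\}$, $\overline\rho_\mu(h)=\limsup_n\mathbb{E}\rho_\mu(\sigma_n,h)$, $\underline\rho_\mu(h)=\liminf_n\mathbb{E}\rho_\mu(\sigma_n,h)$. Then $h^\flat(\mu)=\sup\{h\in[0,\log|\mathtt A|]:\overline\rho_\mu(h)=0\}$, $h^\sharp(\mu)=\sup\{h\in[0,\log|\mathtt A|]:\underline\rho_\mu(h)=0\}$, with $\sup\varnothing=-\infty$. *)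

theory Defs
  imports "HOL-Probability.Probability" "HOL-Algebra.Sym_Groups"
begin

text \<open>A letter \<open>(i, True)\<close> stands for the generator \<open>s\<^sub>i\<close>, \<open>(i, False)\<close> for its inverse.
  The free group is the type of reduced words over the index type \<open>'r\<close>; its rank is \<open>CARD('r)\<close>.\<close>

definition neg :: "'r \<times> bool \<Rightarrow> 'r \<times> bool" where
  "neg a = (fst a, \<not> snd a)"

definition reduced_word :: "('r \<times> bool) list \<Rightarrow> bool" where
  "reduced_word w \<longleftrightarrow> successively (\<lambda>a b. b \<noteq> neg a) w"

typedef 'r free_word = "{w :: ('r \<times> bool) list. reduced_word w}"
  by (rule exI[of _ "[]"]) (simp add: reduced_word_def)

fun push :: "'r \<times> bool \<Rightarrow> ('r \<times> bool) list \<Rightarrow> ('r \<times> bool) list" where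
  "push a [] = [a]"
| "push a (b # w) = (if b = neg a then w else a # b # w)"

definition free_group :: "'r free_word monoid" where
  "free_group = \<lparr>carrier = UNIV,
     mult = (\<lambda>x y. Abs_free_word (foldr push (Rep_free_word x) (Rep_free_word y))),
     one = Abs_free_word []\<rparr>"

definition gen :: "'r \<Rightarrow> 'r free_word" where
  "gen i = Abs_free_word [(i, True)]"

definition word_length :: "'r free_word \<Rightarrow> nat" where
  "word_length x = length (Rep_free_word x)"

lemma neg_neg [simp]: "neg (neg a) = a"
  by (simp add: neg_def)

lemma neg_neq [simp]: "neg a \<noteq> a" "a \<noteq> neg a"
  by (auto simp: neg_def prod_eq_iff)

lemma reduced_Nil [simp]: "reduced_word []"
  and reduced_single [simp]: "reduced_word [a]"
  by (simp_all add: reduced_word_def)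

lemma reduced_Cons2: "reduced_word (a # b # w) \<longleftrightarrow> b \<noteq> neg a \<and> reduced_word (b # w)"
  by (simp add: reduced_word_def)

lemma reduced_ConsD: "reduced_word (a # w) \<Longrightarrow> reduced_word w"
  by (cases w) (auto simp: reduced_word_def)

lemma reduced_push: "reduced_word w \<Longrightarrow> reduced_word (push a w)"
  by (cases w) (auto simp: reduced_Cons2 dest: reduced_ConsD)

lemma push_reduced: "reduced_word (a # w) \<Longrightarrow> push a w = a # w"
  by (cases w) (auto simp: reduced_Cons2)

lemma push_neg_push:
  assumes "reduced_word w" shows "push (neg a) (push a w) = w"
proof (cases w)
  case (Cons b v)
  then show ?thesis
    using assms by (cases "b = neg a") (auto simp: push_reduced)
qed simp

lemma push_push_neg: "reduced_word w \<Longrightarrow> push a (push (neg a) w) = w"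
  using push_neg_push[of w "neg a"] by simp

lemma reduced_foldr_push: "reduced_word w \<Longrightarrow> reduced_word (foldr push u w)"
  by (induction u) (auto intro: reduced_push)

lemma foldr_push_Nil: "reduced_word w \<Longrightarrow> foldr push w [] = w"
  by (induction w) (simp_all add: push_reduced reduced_ConsD)

lemma foldr_push_push:
  assumes "reduced_word w" shows "foldr push (push a u) w = push a (foldr push u w)"
  using assms by (cases u) (auto simp: push_push_neg reduced_foldr_push)

lemma foldr_push_assoc:
  "reduced_word w \<Longrightarrow> foldr push (foldr push u v) w = foldr push u (foldr push v w)"
  by (induction u) (auto simp: foldr_push_push)

lemma foldr_push_inverse: "\<exists>u. foldr push u w = []"
proof (induction w)
  case (Cons a w)
  then obtain u where "foldr push u w = []" by blast
  then have "foldr push (u @ [neg a]) (a # w) = []" by simp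
  then show ?case by blast
qed (auto intro: exI[of _ "[]"])

lemma reduced_Rep [simp]: "reduced_word (Rep_free_word x)"
  using Rep_free_word by blast

lemma Rep_Abs: "reduced_word w \<Longrightarrow> Rep_free_word (Abs_free_word w) = w"
  by (simp add: Abs_free_word_inverse)

lemma Rep_mult: "Rep_free_word (x \<otimes>\<^bsub>free_group\<^esub> y) = foldr push (Rep_free_word x) (Rep_free_word y)"
  by (simp add: free_group_def Rep_Abs reduced_foldr_push)

lemma Rep_one: "Rep_free_word \<one>\<^bsub>free_group\<^esub> = []"
  by (simp add: free_group_def Rep_Abs)

lemma carrier_free_group [simp]: "carrier free_group = UNIV"
  by (simp add: free_group_def)

lemma group_free_group: "group (free_group :: 'r free_word monoid)"
proof (rule groupI)
  fix x y z :: "'r free_word"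
  show "x \<otimes>\<^bsub>free_group\<^esub> y \<otimes>\<^bsub>free_group\<^esub> z = x \<otimes>\<^bsub>free_group\<^esub> (y \<otimes>\<^bsub>free_group\<^esub> z)"
    by (simp add: Rep_free_word_inject[symmetric] Rep_mult foldr_push_assoc)
  show "\<one>\<^bsub>free_group\<^esub> \<otimes>\<^bsub>free_group\<^esub> x = x"
    by (simp add: Rep_free_word_inject[symmetric] Rep_mult Rep_one)
  obtain u where u: "foldr push u (Rep_free_word x) = []"
    using foldr_push_inverse by blast
  have "Abs_free_word (foldr push u []) \<otimes>\<^bsub>free_group\<^esub> x = \<one>\<^bsub>free_group\<^esub>"
    by (simp add: Rep_free_word_inject[symmetric] Rep_mult Rep_one Rep_Abs reduced_foldr_push
        foldr_push_assoc u)
  then show "\<exists>y\<in>carrier free_group. y \<otimes>\<^bsub>free_group\<^esub> x = \<one>\<^bsub>free_group\<^esub>"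
    by auto
qed simp_all

lemma free_group_universal:
  fixes H (structure)
  assumes "group H"
  shows "bij_betw (\<lambda>\<sigma> i. \<sigma> (gen i)) (hom (free_group :: 'r free_word monoid) H) (UNIV \<rightarrow> carrier H)"
proof -
  interpret H: group H by fact
  let ?F = "free_group :: 'r free_word monoid"
  interpret F: group ?F by (rule group_free_group)
  let ?l = "\<lambda>a. Abs_free_word [a] :: 'r free_word"
  have cons: "Abs_free_word (a # w) = ?l a \<otimes>\<^bsub>?F\<^esub> Abs_free_word w" if "reduced_word (a # w)" for a w
    using that reduced_ConsD[OF that]
    by (simp add: Rep_free_word_inject[symmetric] Rep_mult Rep_Abs push_reduced)
  have linv: "?l (i, False) = inv\<^bsub>?F\<^esub> gen i" for i
  proof (rule F.inv_equality[symmetric])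
    show "?l (i, False) \<otimes>\<^bsub>?F\<^esub> gen i = \<one>\<^bsub>?F\<^esub>"
      by (simp add: Rep_free_word_inject[symmetric] Rep_mult Rep_one Rep_Abs gen_def neg_def)
  qed simp_all
  show ?thesis
    unfolding bij_betw_def
  proof (intro conjI inj_onI subset_antisym subsetI)
    fix \<sigma> \<tau> assume \<sigma>: "\<sigma> \<in> hom ?F H" and \<tau>: "\<tau> \<in> hom ?F H"
      and eq: "(\<lambda>i. \<sigma> (gen i)) = (\<lambda>i. \<tau> (gen i))"
    interpret S: group_hom ?F H \<sigma> using \<sigma> by unfold_locales
    interpret T: group_hom ?F H \<tau> using \<tau> by unfold_locales
    have eq': "\<sigma> (gen i) = \<tau> (gen i)" for i using eq by meson
    have letter: "\<sigma> (?l a) = \<tau> (?l a)" for a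
    proof (cases a)
      case (Pair i b)
      then show ?thesis
        by (cases b) (simp_all add: linv eq', simp add: gen_def[symmetric] eq')
    qed
    have "\<sigma> (Abs_free_word w) = \<tau> (Abs_free_word w)" if "reduced_word w" for w
      using that
    proof (induction w)
      case Nil
      then show ?case using S.hom_one T.hom_one by (simp add: free_group_def)
    next
      case (Cons a w)
      then have "\<sigma> (Abs_free_word w) = \<tau> (Abs_free_word w)"
        by (blast dest: reduced_ConsD)
      then show ?case
        unfolding cons[OF Cons.prems] by (simp only: S.hom_mult T.hom_mult carrier_free_group UNIV_I letter)
    qed
    then show "\<sigma> = \<tau>"
      by (metis Rep_free_word_inverse reduced_Rep ext)
  next
    fix f assume "f \<in> (\<lambda>\<sigma> i. \<sigma> (gen i)) ` hom ?F H"
    then show "f \<in> UNIV \<rightarrow> carrier H" by (auto simp: hom_def)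
  next
    fix f :: "'r \<Rightarrow> _" assume f: "f \<in> UNIV \<rightarrow> carrier H"
    have fc [simp]: "f i \<in> carrier H" for i using f by auto
    define l where "l a = (if snd a then f (fst a) else inv f (fst a))" for a
    define ev where "ev w = foldr (\<lambda>a y. l a \<otimes> y) w \<one>" for w
    have l [simp]: "l a \<in> carrier H" for a by (simp add: l_def)
    have l_neg: "l a \<otimes> l (neg a) = \<one>" for a by (simp add: l_def neg_def)
    have ev [simp]: "ev w \<in> carrier H" for w by (induction w) (simp_all add: ev_def)
    have ev_Cons: "ev (a # w) = l a \<otimes> ev w" for a w by (simp add: ev_def)
    have ev_push: "ev (push a w) = l a \<otimes> ev w" for a w
    proof (cases w)
      case (Cons b v)
      then show ?thesis
        by (auto simp: ev_Cons H.m_assoc[symmetric] l_neg)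
    qed (simp add: ev_Cons)
    have ev_foldr: "ev (foldr push u w) = ev u \<otimes> ev w" for u w
      by (induction u) (simp_all add: ev_push ev_Cons H.m_assoc, simp add: ev_def)
    show "f \<in> (\<lambda>\<sigma> i. \<sigma> (gen i)) ` hom ?F H"
    proof (rule image_eqI)
      show "(\<lambda>x. ev (Rep_free_word x)) \<in> hom ?F H"
        by (auto simp: hom_def Rep_mult ev_foldr)
      show "f = (\<lambda>i. ev (Rep_free_word (gen i)))"
        by (simp add: fun_eq_iff gen_def Rep_Abs ev_def l_def)
    qed
  qed
qed

lemma finite_hom_sym_group:
  "finite (hom (free_group :: 'r::finite free_word monoid) (sym_group n))"
proof -
  have "finite {p. p permutes {1..n}}" by (rule finite_permutations) simp
  then have "finite (UNIV \<rightarrow> carrier (sym_group n) :: ('r \<Rightarrow> nat \<Rightarrow> nat) set)"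
    using finite_PiE[of "UNIV :: 'r set" "\<lambda>_. carrier (sym_group n)"]
    by (simp add: sym_group_def PiE_UNIV_domain)
  then show ?thesis
    using bij_betw_finite[OF free_group_universal[OF sym_group_is_group]] by blast
qed

lemma hom_sym_group_nonempty:
  "hom (free_group :: 'r::finite free_word monoid) (sym_group n) \<noteq> {}"
proof -
  have "(\<lambda>_. id) \<in> hom (free_group :: 'r free_word monoid) (sym_group n)"
    by (auto simp: hom_def sym_group_def permutes_id)
  then show ?thesis by blast
qed

type_synonym ('r, 'a) config = "'r free_word \<Rightarrow> 'a"

definition config_space :: "('r, 'a) config measure" where
  "config_space = PiM UNIV (\<lambda>_. count_space UNIV)"

lemma space_config [simp]: "space config_space = UNIV"
  by (simp add: config_space_def space_PiM)

instance free_word :: (countable) countable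
  by standard (rule exI[of _ "to_nat \<circ> Rep_free_word"],
      simp add: inj_def Rep_free_word_inject)

lemma sets_config_space_borel:
  "sets (config_space :: ('r::finite, 'a::finite) config measure) =
   sigma_sets UNIV {U. openin (product_topology (\<lambda>_. discrete_topology UNIV) UNIV) U}"
  (is "_ = sigma_sets UNIV ?O")
proof
  let ?C = "config_space :: ('r, 'a) config measure"
  let ?T = "product_topology (\<lambda>_. discrete_topology UNIV) UNIV :: ('r, 'a) config topology"
  have "sets ?C \<subseteq> sets (sigma UNIV ?O)"
    unfolding config_space_def
  proof (rule sets_PiM_in_sets)
    fix i :: "'r free_word" and A :: "'a set"
    have "openin ?T {x \<in> topspace ?T. x i \<in> A}"
      by (rule openin_continuous_map_preimage[where Y = "discrete_topology UNIV"])
         (auto intro: continuous_map_product_projection)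
    then show "{x \<in> space (sigma UNIV ?O). x i \<in> A} \<in> sets (sigma UNIV ?O)"
      by (auto simp: space_measure_of_conv)
  qed (simp add: space_measure_of_conv)
  then show "sets ?C \<subseteq> sigma_sets UNIV ?O" by simp
  define cyl :: "'r free_word set \<times> ('r, 'a) config \<Rightarrow> ('r, 'a) config set"
    where "cyl = (\<lambda>(J, x). {y. \<forall>j\<in>J. y j = x j})"
  define B where "B = {cyl (J, x) | J x. finite J}"
  have cyl_sets: "b \<in> sets ?C" if "b \<in> B" for b
  proof -
    obtain J x where Jx: "b = cyl (J, x)" "finite J" using \<open>b \<in> B\<close> by (auto simp: B_def)
    have "{y \<in> space ?C. \<forall>j\<in>J. y j \<in> {x j}} \<in> sets ?C"
      unfolding config_space_def
      by (rule sets.sets_Collect_finite_All) (auto simp: Jx)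
    then show ?thesis by (simp add: Jx cyl_def)
  qed
  have "countable B"
  proof -
    have "B = (\<Union>J\<in>{J. finite J}. (\<lambda>x. cyl (J, x)) ` (J \<rightarrow>\<^sub>E UNIV))"
    proof (intro subset_antisym subsetI)
      fix b assume "b \<in> B"
      then obtain J x where "b = cyl (J, x)" "finite J" by (auto simp: B_def)
      then have "b = cyl (J, restrict x J)" by (auto simp: cyl_def)
      then show "b \<in> (\<Union>J\<in>{J. finite J}. (\<lambda>x. cyl (J, x)) ` (J \<rightarrow>\<^sub>E UNIV))"
        using \<open>finite J\<close> by (intro UN_I[of J] image_eqI[of _ _ "restrict x J"]) auto
    qed (auto simp: B_def)
    moreover have cJ: "countable {J :: 'r free_word set. finite J}"
      using countable_Collect_finite_subset[of "UNIV :: 'r free_word set"] by simp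
    moreover have "countable (\<Union>J\<in>{J. finite J}. (\<lambda>x. cyl (J, x)) ` (J \<rightarrow>\<^sub>E UNIV))"
    proof (rule Countable_Set.countable_UN[OF cJ])
      fix J :: "'r free_word set" assume "J \<in> {J. finite J}"
      then show "countable ((\<lambda>x. cyl (J, x)) ` (J \<rightarrow>\<^sub>E UNIV))"
        by (intro countable_image countable_finite finite_PiE) auto
    qed
    ultimately show ?thesis by simp
  qed
  show "sigma_sets UNIV ?O \<subseteq> sets ?C"
  proof -
    have "U \<in> sets ?C" if U: "openin ?T U" for U
    proof -
      have "\<exists>b\<in>B. x \<in> b \<and> b \<subseteq> U" if "x \<in> U" for x
      proof -
        obtain W where W: "finite {i. W i \<noteq> (UNIV :: 'a set)}" "x \<in> PiE UNIV W" "PiE UNIV W \<subseteq> U"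
          using U[unfolded openin_product_topology_alt] \<open>x \<in> U\<close> by simp blast
        then have "cyl ({i. W i \<noteq> UNIV}, x) \<subseteq> U"
          by (fastforce simp: cyl_def PiE_UNIV_domain)
        moreover have "cyl ({i. W i \<noteq> UNIV}, x) \<in> B"
          using W(1) unfolding B_def by blast
        moreover have "x \<in> cyl ({i. W i \<noteq> UNIV}, x)" by (simp add: cyl_def)
        ultimately show ?thesis by blast
      qed
      then have "U = \<Union>{b\<in>B. b \<subseteq> U}" by blast
      moreover have "\<Union>{b\<in>B. b \<subseteq> U} \<in> sets ?C"
        using \<open>countable B\<close> by (intro sets.countable_Union) (auto intro: cyl_sets countable_subset)
      ultimately show ?thesis by simp
    qed
    then show ?thesis
      using sets.sigma_sets_subset[of ?O ?C] by auto
  qed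
qed

definition shift :: "'r free_word \<Rightarrow> ('r, 'a) config \<Rightarrow> ('r, 'a) config" where
  "shift g x = (\<lambda>h. x (h \<otimes>\<^bsub>free_group\<^esub> g))"

definition invariant_probs :: "('r, 'a) config measure set" where
  "invariant_probs = {\<mu>. prob_space \<mu> \<and> sets \<mu> = sets config_space \<and>
     (\<forall>g. distr \<mu> config_space (shift g) = \<mu>)}"

definition self_joinings :: "('r, 'a) config measure \<Rightarrow> ('r, 'a \<times> 'a) config measure set" where
  "self_joinings \<mu> = {\<xi> \<in> invariant_probs.
     distr \<xi> config_space (\<lambda>z g. fst (z g)) = \<mu> \<and>
     distr \<xi> config_space (\<lambda>z g. snd (z g)) = \<mu>}"

definition product_self_joining :: "('r, 'a) config measure \<Rightarrow> ('r, 'a \<times> 'a) config measure" where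
  "product_self_joining \<mu> = distr (\<mu> \<Otimes>\<^sub>M \<mu>) config_space (\<lambda>(x, y) g. (x g, y g))"

definition config_dist :: "('r::finite, 'a) config \<Rightarrow> ('r, 'a) config \<Rightarrow> real" where
  "config_dist x y = (\<Sum>\<^sub>\<infinity>g. if x g \<noteq> y g then 1 / (5 * real CARD('r) ^ 2) ^ word_length g else 0)"

lemma config_dist_summable:
  fixes x y :: "('r::finite, 'a) config"
  shows "(\<lambda>g. if x g \<noteq> y g then 1 / (5 * real CARD('r) ^ 2) ^ word_length g else 0) summable_on UNIV"
proof -
  let ?r = "real CARD('r)"
  let ?w = "\<lambda>n. 1 / (5 * ?r ^ 2) ^ n"
  let ?L = "\<lambda>n. {w :: ('r \<times> bool) list. length w = n}"
  have r: "?r \<ge> 1" by (simp add: Suc_leI)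
  have "sum (\<lambda>g. ?w (word_length g)) F \<le> 2" if F: "finite F" for F :: "'r free_word set"
  proof -
    obtain N where N: "word_length ` F \<subseteq> {..<N}"
      using finite_nat_set_iff_bounded[of "word_length ` F"] F by auto
    have "sum (\<lambda>g. ?w (word_length g)) F = sum (\<lambda>w. ?w (length w)) (Rep_free_word ` F)"
      by (subst sum.reindex) (auto simp: word_length_def inj_on_def Rep_free_word_inject)
    also have "\<dots> \<le> sum (\<lambda>w. ?w (length w)) (\<Union>n<N. ?L n)"
      using N finite_lists_length_eq[of "UNIV :: ('r \<times> bool) set"]
      by (intro sum_mono2) (auto simp: word_length_def)
    also have "\<dots> = (\<Sum>n<N. sum (\<lambda>w. ?w (length w)) (?L n))"
      using finite_lists_length_eq[of "UNIV :: ('r \<times> bool) set"]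
      by (intro sum.UNION_disjoint) auto
    also have "\<dots> = (\<Sum>n<N. (2 * ?r) ^ n * ?w n)"
    proof (intro sum.cong refl)
      fix n
      have "card (?L n) = (CARD('r) * 2) ^ n"
        using card_lists_length_eq[of "UNIV :: ('r \<times> bool) set" n] by simp
      then show "sum (\<lambda>w. ?w (length w)) (?L n) = (2 * ?r) ^ n * ?w n"
        by (simp add: mult.commute)
    qed
    also have "\<dots> \<le> (\<Sum>n<N. (1/2) ^ n)"
    proof (intro sum_mono)
      fix n
      have "2 * t / (5 * t ^ 2) \<le> 1 / 2" if "t \<ge> 1" for t :: real
        using that by (simp add: divide_simps power2_eq_square)
      from this[OF r] have "(2 * ?r / (5 * ?r ^ 2)) ^ n \<le> (1 / 2) ^ n"
        by (intro power_mono) auto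
      then show "(2 * ?r) ^ n * ?w n \<le> (1/2) ^ n"
        by (simp add: power_divide)
    qed
    also have "\<dots> \<le> 2"
      by (simp add: sum_gp_strict)
    finally show ?thesis .
  qed
  then have "(\<lambda>g :: 'r free_word. ?w (word_length g)) summable_on UNIV"
    by (intro nonneg_bounded_partial_sums_imp_summable_on[where C = 2])
       (auto intro: eventually_finite_subsets_at_top_weakI)
  then show ?thesis
    by (rule summable_on_comparison_test) auto
qed

definition transport_dist :: "('r::finite, 'a) config measure \<Rightarrow> ('r, 'a) config measure \<Rightarrow> real" where
  "transport_dist \<mu> \<nu> =
     (SUP f \<in> {f :: ('r, 'a) config \<Rightarrow> real. \<forall>x y. \<bar>f x - f y\<bar> \<le> config_dist x y}.
        \<bar>(\<integral>x. f x \<partial>\<mu>) - (\<integral>x. f x \<partial>\<nu>)\<bar>)"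

definition pullback :: "('r free_word \<Rightarrow> 'v \<Rightarrow> 'v) \<Rightarrow> ('v \<Rightarrow> 'a) \<Rightarrow> 'v \<Rightarrow> ('r, 'a) config" where
  "pullback \<sigma> x v = (\<lambda>h. x (\<sigma> h v))"

text \<open>The push-forward of the uniform measure on \<open>V\<close> is the average of Dirac masses in the
  definition of the empirical distribution, see \<open>emeasure_empirical\<close>.\<close>

definition empirical ::
    "'v set \<Rightarrow> ('r free_word \<Rightarrow> 'v \<Rightarrow> 'v) \<Rightarrow> ('v \<Rightarrow> 'a) \<Rightarrow> ('r, 'a) config measure" where
  "empirical V \<sigma> x = distr (uniform_count_measure V) config_space (pullback \<sigma> x)"

lemma emeasure_empirical:
  assumes "finite V" "V \<noteq> {}" "B \<in> sets config_space"
  shows "emeasure (empirical V \<sigma> x) B =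
    (\<Sum>v\<in>V. emeasure (return config_space (pullback \<sigma> x v)) B) / of_nat (card V)"
proof -
  have "emeasure (empirical V \<sigma> x) B
      = emeasure (uniform_count_measure V) (pullback \<sigma> x -` B \<inter> V)"
    unfolding empirical_def
    by (subst emeasure_distr)
       (auto simp: assms space_uniform_count_measure measurable_def sets_uniform_count_measure)
  also have "\<dots> = ennreal (real (card (pullback \<sigma> x -` B \<inter> V)) / real (card V))"
    by (rule emeasure_uniform_count_measure) (auto simp: assms)
  also have "\<dots> = of_nat (card (pullback \<sigma> x -` B \<inter> V)) / of_nat (card V)"
    using assms by (simp add: divide_ennreal[symmetric] card_gt_0_iff ennreal_of_nat_eq_real_of_nat)
  also have "of_nat (card (pullback \<sigma> x -` B \<inter> V)) = (\<Sum>v\<in>V. indicator B (pullback \<sigma> x v) :: ennreal)"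
    using assms(1) by (simp add: indicator_def sum.If_cases Int_def vimage_def conj_commute)
  finally show ?thesis using assms(3) by simp
qed

text \<open>Elements of \<open>A\<^sup>V\<close> are represented by the functions that are \<open>undefined\<close> outside \<open>V\<close>.\<close>

definition microstates ::
    "'v set \<Rightarrow> ('r::finite free_word \<Rightarrow> 'v \<Rightarrow> 'v) \<Rightarrow> ('r, 'a) config measure \<Rightarrow> real \<Rightarrow> ('v \<Rightarrow> 'a) set" where
  "microstates V \<sigma> \<mu> \<epsilon> = {x \<in> V \<rightarrow>\<^sub>E UNIV. transport_dist (empirical V \<sigma> x) \<mu> < \<epsilon>}"

text \<open>The logarithm with \<open>log 0 = -\<infinity>\<close>; note that \<open>ln 0 = 0\<close> in HOL.\<close>

definition elog :: "real \<Rightarrow> ereal" where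
  "elog t = (if t = 0 then -\<infinity> else ereal (ln t))"

text \<open>By \<open>free_group_universal\<close>, a uniform homomorphism amounts to an independent uniform
  permutation for each generator.\<close>

definition uniform_hom :: "nat \<Rightarrow> ('r::finite free_word \<Rightarrow> nat \<Rightarrow> nat) pmf" where
  "uniform_hom n = pmf_of_set (hom free_group (sym_group n))"

definition f_invariant :: "('r::finite, 'a::finite) config measure \<Rightarrow> ereal" where
  "f_invariant \<mu> = (INF \<epsilon>\<in>{0<..}. limsup (\<lambda>n.
     elog (measure_pmf.expectation (uniform_hom n) (\<lambda>\<sigma>. real (card (microstates {1..n} \<sigma> \<mu> \<epsilon>))))
       / ereal (real n)))"

definition rho ::
    "'v set \<Rightarrow> ('r::finite, 'a::finite) config measure \<Rightarrow> ('r free_word \<Rightarrow> 'v \<Rightarrow> 'v) \<Rightarrow> real \<Rightarrow> real" where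
  "rho V \<mu> \<sigma> h =
     Inf {\<epsilon>. \<epsilon> > 0 \<and> elog (real (card (microstates V \<sigma> \<mu> \<epsilon>))) / ereal (real (card V)) \<ge> ereal h}"

definition rho_upper :: "('r::finite, 'a::finite) config measure \<Rightarrow> real \<Rightarrow> ereal" where
  "rho_upper \<mu> h = limsup (\<lambda>n.
     ereal (measure_pmf.expectation (uniform_hom n) (\<lambda>\<sigma>. rho {1..n} \<mu> \<sigma> h)))"

definition rho_lower :: "('r::finite, 'a::finite) config measure \<Rightarrow> real \<Rightarrow> ereal" where
  "rho_lower \<mu> h = liminf (\<lambda>n.
     ereal (measure_pmf.expectation (uniform_hom n) (\<lambda>\<sigma>. rho {1..n} \<mu> \<sigma> h)))"

text \<open>The suprema are taken in \<open>ereal\<close>, so that the supremum of the empty set is \<open>-\<infinity>\<close>.\<close>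

definition h_flat :: "('r::finite, 'a::finite) config measure \<Rightarrow> ereal" where
  "h_flat \<mu> = (SUP h \<in> {h. 0 \<le> h \<and> h \<le> ln (real CARD('a)) \<and> rho_upper \<mu> h = 0}. ereal h)"

definition h_sharp :: "('r::finite, 'a::finite) config measure \<Rightarrow> ereal" where
  "h_sharp \<mu> = (SUP h \<in> {h. 0 \<le> h \<and> h \<le> ln (real CARD('a)) \<and> rho_lower \<mu> h = 0}. ereal h)"

end

theory Submission
  imports Defs "HOL-Complex_Analysis.Great_Picard" "HOL-Combinatorics.Multiset_Permutations"
    "HOL-Real_Asymp.Real_Asymp" "HOL-Analysis.Kronecker_Approximation_Theorem"
begin

text \<open>The inequalities \<open>h_flat \<mu> \<le> h_sharp \<mu> \<le> f_invariant \<mu>\<close> hold for every \<open>\<mu>\<close>, the second by Markov's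
  inequality.  For the converse, counting permutations with prescribed edge statistics exactly
  gives Bowen's formula: \<open>f_invariant \<mu>\<close> is the infimum over \<open>k\<close> of an entropy \<open>block_entropy k \<mu>\<close>
  of the radius-\<open>k\<close> patterns, and the expected number of microstates already grows at this rate along
  all \<open>n\<close>.  This entropy is additive, so the product self-joining has f invariant at most
  \<open>2 f_invariant \<mu>\<close>.  A pair of microstates for \<open>\<mu>\<close> is a microstate for something close to a self-joining,
  so by compactness the hypothesis bounds the second moment of the number of microstates by the
  square of the first, up to a subexponential factor; the Paley-Zygmund inequality then shows that
  there are about \<open>exp (n f_invariant \<mu>)\<close> microstates with probability at least \<open>exp (- o(n))\<close>.
  Finally \<open>rho\<close> changes by \<open>O(1/n)\<close> under a transposition, so it deviates from its mean by a fixed amount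
  only with exponentially small probability, and hence its mean must tend to \<open>0\<close>.\<close>

section \<open>Cylinder sets and the transportation metric\<close>


definition wt :: "'r::finite free_word \<Rightarrow> real" where
  "wt g = 1 / (5 * real CARD('r) ^ 2) ^ word_length g"

lemma card_real_ge_1: "real CARD('r::finite) \<ge> 1"
  by (simp add: Suc_leI)

lemma wt_pos: "wt g > 0"
  by (simp add: wt_def)

lemma wt_base: "5 * real CARD('r::finite) ^ 2 \<ge> 1"
proof -
  have "1 * 1 \<le> real CARD('r) * real CARD('r)"
    using card_real_ge_1 by (intro mult_mono) auto
  then show ?thesis by (simp add: power2_eq_square)
qed

lemma wt_antimono:
  fixes g :: "'r::finite free_word"
  assumes "word_length g \<le> k"
  shows "1 / (5 * real CARD('r) ^ 2) ^ k \<le> wt g"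
  unfolding wt_def
  using power_increasing[OF assms wt_base] by (intro divide_left_mono) auto

lemma finite_ball: "finite {g :: 'r::finite free_word. word_length g \<le> k}"
proof -
  have "finite {w :: ('r \<times> bool) list. set w \<subseteq> UNIV \<and> length w \<le> k}"
    by (rule finite_lists_length_le) simp
  then have "finite (Rep_free_word ` {g :: 'r free_word. word_length g \<le> k})"
    by (rule finite_subset[rotated]) (auto simp: word_length_def)
  then show ?thesis
    by (rule finite_imageD) (simp add: inj_on_def Rep_free_word_inject)
qed

lemma weighted_length_summable:
  "(\<lambda>g :: 'r::finite free_word. (1 + real (word_length g)) * wt g) summable_on UNIV"
proof -
  let ?r = "real CARD('r)"
  let ?w = "\<lambda>n. (1 + real n) * (1 / (5 * ?r ^ 2) ^ n)"
  let ?L = "\<lambda>n. {w :: ('r \<times> bool) list. length w = n}"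
  have r: "?r \<ge> 1" by (rule card_real_ge_1)
  have "sum (\<lambda>g. (1 + real (word_length g)) * wt g) F \<le> 8" if F: "finite F" for F :: "'r free_word set"
  proof -
    obtain N where N: "word_length ` F \<subseteq> {..<N}"
      using finite_nat_set_iff_bounded[of "word_length ` F"] F by auto
    have fL: "finite (?L n)" for n
      using finite_lists_length_eq[of "UNIV :: ('r \<times> bool) set"] by simp
    have "sum (\<lambda>g. (1 + real (word_length g)) * wt g) F = sum (\<lambda>w. ?w (length w)) (Rep_free_word ` F)"
      by (subst sum.reindex) (auto simp: word_length_def wt_def inj_on_def Rep_free_word_inject)
    also have "\<dots> \<le> sum (\<lambda>w. ?w (length w)) (\<Union>n<N. ?L n)"
      using N fL by (intro sum_mono2) (auto simp: word_length_def)
    also have "\<dots> = (\<Sum>n<N. sum (\<lambda>w. ?w (length w)) (?L n))"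
      using fL by (intro sum.UNION_disjoint) auto
    also have "\<dots> = (\<Sum>n<N. (2 * ?r) ^ n * ?w n)"
    proof (intro sum.cong refl)
      fix n
      have "card (?L n) = (CARD('r) * 2) ^ n"
        using card_lists_length_eq[of "UNIV :: ('r \<times> bool) set" n] by simp
      then show "sum (\<lambda>w. ?w (length w)) (?L n) = (2 * ?r) ^ n * ?w n"
        by (simp add: mult.commute)
    qed
    also have "\<dots> \<le> (\<Sum>n<N. 4 * (1/2) ^ n)"
    proof (intro sum_mono)
      fix n
      have "2 * t / (5 * t ^ 2) \<le> 2 / 5" if "t \<ge> 1" for t :: real
        using that by (simp add: divide_simps power2_eq_square)
      from this[OF r] have 1: "(2 * ?r / (5 * ?r ^ 2)) ^ n \<le> (2 / 5) ^ n"
        by (intro power_mono) auto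
      have "1 + real n * (1/4) \<le> (1 + 1/4) ^ n" by (rule Bernoulli_inequality) simp
      then have 2: "1 + real n \<le> 4 * (5/4) ^ n" by simp
      have "(2 * ?r) ^ n * ?w n = (2 * ?r / (5 * ?r ^ 2)) ^ n * (1 + real n)"
        by (simp add: power_divide)
      also have "\<dots> \<le> (2/5) ^ n * (4 * (5/4) ^ n)"
        using 1 2 by (intro mult_mono) auto
      also have "\<dots> = 4 * (1/2) ^ n"
        by (simp add: power_mult_distrib[symmetric])
      finally show "(2 * ?r) ^ n * ?w n \<le> 4 * (1/2) ^ n" .
    qed
    also have "\<dots> \<le> 8"
      by (simp add: sum_distrib_left[symmetric] sum_gp_strict)
    finally show ?thesis .
  qed
  then show ?thesis
    by (intro nonneg_bounded_partial_sums_imp_summable_on[where C = 8])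
       (auto intro!: eventually_finite_subsets_at_top_weakI simp: wt_def)
qed

lemma wt_summable: "wt summable_on A"
proof -
  have "wt summable_on (UNIV :: 'a free_word set)"
    by (rule summable_on_comparison_test[OF weighted_length_summable])
       (auto simp: wt_def divide_right_mono)
  then show ?thesis by (rule summable_on_subset_banach) simp
qed

definition diam :: "'r::finite itself \<Rightarrow> real" where
  "diam _ = (\<Sum>\<^sub>\<infinity>g :: 'r free_word. wt g)"

definition tail :: "'r::finite itself \<Rightarrow> nat \<Rightarrow> real" where
  "tail _ k = (\<Sum>\<^sub>\<infinity>g \<in> {g :: 'r free_word. k < word_length g}. wt g)"

lemma config_dist_eq: "config_dist x y = (\<Sum>\<^sub>\<infinity>g. if x g \<noteq> y g then wt g else 0)"
  unfolding config_dist_def wt_def ..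

lemma config_dist_eq_set: "config_dist x y = (\<Sum>\<^sub>\<infinity>g\<in>{g. x g \<noteq> y g}. wt g)"
  unfolding config_dist_eq by (rule infsum_cong_neutral) auto

lemma config_dist_nonneg: "config_dist x y \<ge> 0"
  unfolding config_dist_eq by (rule infsum_nonneg) (simp add: wt_pos less_imp_le)

lemma config_dist_le_diam: "config_dist x y \<le> diam TYPE('r)" for x :: "('r::finite, 'a) config"
  unfolding config_dist_eq_set diam_def
  by (rule infsum_mono2) (auto simp: wt_summable wt_pos less_imp_le)

lemma diam_nonneg: "diam TYPE('r::finite) \<ge> 0"
  unfolding diam_def by (rule infsum_nonneg) (simp add: wt_pos less_imp_le)

lemma config_dist_le_tail:
  fixes x :: "('r::finite, 'a) config"
  assumes "\<And>g. word_length g \<le> k \<Longrightarrow> x g = y g"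
  shows "config_dist x y \<le> tail TYPE('r) k"
  unfolding config_dist_eq_set tail_def using assms not_le
  by (intro infsum_mono2) (auto simp: wt_summable wt_pos less_imp_le)

lemma config_dist_ge:
  fixes x :: "('r::finite, 'a) config"
  assumes "x g \<noteq> y g"
  shows "wt g \<le> config_dist x y"
proof -
  have "infsum wt {g} \<le> infsum wt {g. x g \<noteq> y g}"
    using assms by (intro infsum_mono2) (auto simp: wt_summable wt_pos less_imp_le)
  then show ?thesis by (simp add: config_dist_eq_set)
qed

lemma tail_nonneg: "tail TYPE('r::finite) k \<ge> 0"
  unfolding tail_def by (rule infsum_nonneg) (simp add: wt_pos less_imp_le)

lemma tail_tendsto_0: "tail TYPE('r::finite) \<longlonglongrightarrow> 0"
proof (rule LIMSEQ_I)
  fix e :: real assume e: "e > 0"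
  let ?w = "wt :: 'r free_word \<Rightarrow> real"
  have "(sum ?w \<longlongrightarrow> infsum ?w UNIV) (finite_subsets_at_top UNIV)"
    using has_sum_infsum[OF wt_summable[of UNIV]] by (simp add: has_sum_def)
  then have "\<forall>\<^sub>F F in finite_subsets_at_top UNIV. dist (sum ?w F) (infsum ?w UNIV) < e"
    using e by (rule tendstoD)
  then obtain F where F: "finite F" "dist (sum ?w F) (infsum ?w UNIV) < e"
    unfolding eventually_finite_subsets_at_top by blast
  obtain k where k: "\<forall>n\<in>word_length ` F. n \<le> k"
    using finite_nat_set_iff_bounded_le[of "word_length ` F"] F(1) by auto
  have "norm (tail TYPE('r) m - 0) < e" if "m \<ge> k" for m
  proof -
    let ?B = "{g :: 'r free_word. word_length g \<le> m}"
    have "infsum ?w UNIV = infsum ?w (?B \<union> {g. m < word_length g})"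
      by (rule arg_cong[where f = "infsum ?w"]) auto
    also have "\<dots> = infsum ?w ?B + tail TYPE('r) m"
      unfolding tail_def by (rule infsum_Un_disjoint) (auto simp: wt_summable)
    also have "infsum ?w ?B = sum ?w ?B"
      by (simp add: finite_ball)
    also have "sum ?w F \<le> sum ?w ?B"
      using k that by (intro sum_mono2 finite_ball) (auto simp: wt_pos less_imp_le)
    then have "tail TYPE('r) m \<le> infsum ?w UNIV - sum ?w F"
      using calculation by simp
    with F(2) tail_nonneg[of m, where 'r='r] show ?thesis
      by (simp add: dist_real_def)
  qed
  then show "\<exists>k. \<forall>m\<ge>k. norm (tail TYPE('r) m - 0) < e" by blast
qed

definition trunc :: "nat \<Rightarrow> ('r, 'a) config \<Rightarrow> ('r, 'a) config" where
  "trunc k x = (\<lambda>g. if word_length g \<le> k then x g else undefined)"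

definition cyl_set :: "nat \<Rightarrow> ('r, 'a) config set \<Rightarrow> bool" where
  "cyl_set k S \<longleftrightarrow> (\<forall>x y. trunc k x = trunc k y \<longrightarrow> x \<in> S \<longrightarrow> y \<in> S)"

lemma trunc_eq_iff: "trunc k x = trunc k y \<longleftrightarrow> (\<forall>g. word_length g \<le> k \<longrightarrow> x g = y g)"
  by (auto simp: trunc_def fun_eq_iff)

lemma trunc_eq_mono: "trunc l x = trunc l y \<Longrightarrow> k \<le> l \<Longrightarrow> trunc k x = trunc k y"
  by (auto simp: trunc_eq_iff)

lemma trunc_trunc [simp]: "trunc k (trunc k x) = trunc k x"
  by (auto simp: trunc_def fun_eq_iff)

lemma finite_pats: "finite (range (trunc k) :: ('r::finite, 'a::finite) config set)"
proof (rule finite_subset)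
  show "range (trunc k) \<subseteq> ({g :: 'r free_word. word_length g \<le> k} \<rightarrow>\<^sub>E (UNIV :: 'a set))"
    by (auto simp: trunc_def PiE_def extensional_def)
  show "finite ({g :: 'r free_word. word_length g \<le> k} \<rightarrow>\<^sub>E (UNIV :: 'a set))"
    by (intro finite_PiE finite_ball) simp
qed

lemma cyl_set_fibre: "cyl_set k {x. trunc k x = p}"
  by (auto simp: cyl_set_def)

lemma cyl_set_mono: "cyl_set k S \<Longrightarrow> k \<le> l \<Longrightarrow> cyl_set l S"
  unfolding cyl_set_def using trunc_eq_mono by blast

lemma cyl_set_UN:
  assumes "cyl_set k S"
  shows "S = (\<Union>p\<in>trunc k ` S. {x. trunc k x = p})"
proof (intro subset_antisym subsetI)
  fix x assume "x \<in> (\<Union>p\<in>trunc k ` S. {x. trunc k x = p})"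
  then obtain y where "y \<in> S" "trunc k y = trunc k x" by auto
  then show "x \<in> S" using assms unfolding cyl_set_def by blast
qed blast

lemma cyl_set_sets:
  fixes S :: "('r::finite, 'a::finite) config set"
  assumes "cyl_set k S"
  shows "S \<in> sets config_space"
proof -
  have fib: "{x. trunc k x = trunc k p} \<in> sets config_space" for p :: "('r, 'a) config"
  proof -
    have "{y \<in> space config_space. y j \<in> {p j}} \<in> sets config_space" for j
    proof -
      have "(\<lambda>y. y j) \<in> (config_space :: ('r, 'a) config measure) \<rightarrow>\<^sub>M count_space UNIV"
        unfolding config_space_def by (rule measurable_component_singleton) simp
      from measurable_sets[OF this, of "{p j}"] show ?thesis
        by (simp add: vimage_def Int_def conj_commute)
    qed
    then have "{y \<in> space config_space. \<forall>j\<in>{g. word_length g \<le> k}. y j \<in> {p j}} \<in> sets config_space"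
      by (rule sets.sets_Collect_finite_All[OF _ finite_ball])
    also have "{y \<in> space config_space. \<forall>j\<in>{g. word_length g \<le> k}. y j \<in> {p j}} = {x. trunc k x = trunc k p}"
      by (auto simp: trunc_eq_iff)
    finally show ?thesis .
  qed
  have "S = (\<Union>p\<in>trunc k ` S. {x. trunc k x = p})"
    by (rule cyl_set_UN[OF assms])
  moreover have "(\<Union>p\<in>trunc k ` S. {x. trunc k x = p}) \<in> sets config_space"
    using fib by (intro sets.finite_UN finite_subset[OF _ finite_pats[of k]]) auto
  ultimately show ?thesis by simp
qed

definition config_probs :: "('r, 'a) config measure set" where
  "config_probs = {\<nu>. prob_space \<nu> \<and> sets \<nu> = sets config_space}"

lemma config_probsD:
  assumes "\<nu> \<in> config_probs"
  shows "prob_space \<nu>" "sets \<nu> = sets config_space" "space \<nu> = UNIV"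
  using assms sets_eq_imp_space_eq[of \<nu> config_space] by (auto simp: config_probs_def)

lemma invariant_probsD: "\<nu> \<in> invariant_probs \<Longrightarrow> \<nu> \<in> config_probs"
  by (auto simp: invariant_probs_def config_probs_def)

lemma measure_cyl_set_sum:
  fixes \<nu> :: "('r::finite, 'a::finite) config measure"
  assumes \<nu>: "\<nu> \<in> config_probs" and S: "cyl_set k S"
  shows "measure \<nu> S = (\<Sum>p\<in>trunc k ` S. measure \<nu> {x. trunc k x = p})"
proof -
  interpret prob_space \<nu> using config_probsD[OF \<nu>] by simp
  have "S = (\<Union>p\<in>trunc k ` S. {x. trunc k x = p})"
    by (rule cyl_set_UN[OF S])
  then have "measure \<nu> S = measure \<nu> (\<Union>p\<in>trunc k ` S. {x. trunc k x = p})" by simp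
  also have "\<dots> = (\<Sum>p\<in>trunc k ` S. measure \<nu> {x. trunc k x = p})"
    using cyl_set_sets[OF cyl_set_fibre]
    by (intro finite_measure_finite_Union finite_subset[OF _ finite_pats[of k]])
       (auto simp: config_probsD[OF \<nu>] disjoint_family_on_def)
  finally show ?thesis .
qed

abbreviation lip :: "(('r::finite, 'a) config \<Rightarrow> real) \<Rightarrow> bool" where
  "lip f \<equiv> \<forall>x y. \<bar>f x - f y\<bar> \<le> config_dist x y"

lemma lip_trunc: "lip f \<Longrightarrow> \<bar>f x - f (trunc k x)\<bar> \<le> tail TYPE('r) k" for f :: "('r::finite, 'a) config \<Rightarrow> real"
  by (rule order_trans[OF _ config_dist_le_tail[of k x "trunc k x"]]) (auto simp: trunc_def)

lemma measurable_trunc_comp: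
  fixes f :: "('r::finite, 'a::finite) config \<Rightarrow> real"
  shows "(\<lambda>x. f (trunc k x)) \<in> borel_measurable config_space"
proof (rule measurableI)
  fix A :: "real set"
  have "cyl_set k ((\<lambda>x. f (trunc k x)) -` A)"
    by (auto simp: cyl_set_def)
  then show "(\<lambda>x. f (trunc k x)) -` A \<inter> space config_space \<in> sets config_space"
    by (auto dest: cyl_set_sets)
qed simp

lemma lip_measurable:
  fixes f :: "('r::finite, 'a::finite) config \<Rightarrow> real"
  assumes "lip f"
  shows "f \<in> borel_measurable config_space"
proof (rule borel_measurable_LIMSEQ_real)
  fix x
  show "(\<lambda>k. f (trunc k x)) \<longlonglongrightarrow> f x"
  proof (rule metric_LIMSEQ_I)
    fix e :: real assume "e > 0"
    then obtain K where "\<forall>k\<ge>K. norm (tail TYPE('r) k - 0) < e"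
      using LIMSEQ_D[OF tail_tendsto_0] by blast
    then have "\<forall>k\<ge>K. dist (f (trunc k x)) (f x) < e"
      using lip_trunc[OF assms, of x] tail_nonneg[where 'r = 'r]
      by (auto simp: dist_real_def abs_minus_commute intro: le_less_trans)
    then show "\<exists>K. \<forall>k\<ge>K. dist (f (trunc k x)) (f x) < e" by blast
  qed
qed (rule measurable_trunc_comp)

lemma lip_integrable:
  fixes f :: "('r::finite, 'a::finite) config \<Rightarrow> real"
  assumes "lip f" and \<nu>: "\<nu> \<in> config_probs"
  shows "integrable \<nu> f"
proof -
  interpret prob_space \<nu> using config_probsD[OF \<nu>] by simp
  have "\<bar>f x\<bar> \<le> \<bar>f undefined\<bar> + diam TYPE('r)" for x
    using assms(1)[rule_format, of x undefined] config_dist_le_diam[of x undefined] by linarith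
  then show ?thesis
    using lip_measurable[OF assms(1)] config_probsD[OF \<nu>]
    by (intro integrable_const_bound[where B = "\<bar>f undefined\<bar> + diam TYPE('r)"])
       (auto cong: measurable_cong_sets)
qed

lemma integral_trunc:
  fixes f :: "('r::finite, 'a::finite) config \<Rightarrow> real"
  assumes \<nu>: "\<nu> \<in> config_probs"
  shows "integrable \<nu> (\<lambda>x. f (trunc k x))"
    and "(\<integral>x. f (trunc k x) \<partial>\<nu>) = (\<Sum>p\<in>range (trunc k). f p * measure \<nu> {x. trunc k x = p})"
proof -
  interpret prob_space \<nu> using config_probsD[OF \<nu>] by simp
  let ?S = "\<lambda>p. {x. trunc k x = p}"
  have eq: "f (trunc k x) = (\<Sum>p\<in>range (trunc k). f p * indicat_real (?S p) x)" for x
  proof -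
    have "(\<Sum>p\<in>range (trunc k). f p * indicat_real (?S p) x) = (\<Sum>p\<in>range (trunc k). if trunc k x = p then f p else 0)"
      by (intro sum.cong) auto
    also have "\<dots> = f (trunc k x)"
      using finite_pats[of k] by (subst sum.delta') auto
    finally show ?thesis by simp
  qed
  have m: "?S p \<in> sets \<nu>" for p using cyl_set_sets[OF cyl_set_fibre] by (simp add: config_probsD[OF \<nu>])
  have i: "integrable \<nu> (\<lambda>x. f p * indicat_real (?S p) x)" for p
    using m by (intro integrable_mult_right) (simp add: emeasure_eq_measure)
  show "integrable \<nu> (\<lambda>x. f (trunc k x))"
    unfolding eq using i by (intro Bochner_Integration.integrable_sum)
  show "(\<integral>x. f (trunc k x) \<partial>\<nu>) = (\<Sum>p\<in>range (trunc k). f p * measure \<nu> {x. trunc k x = p})"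
    unfolding eq using i m by (subst Bochner_Integration.integral_sum) (auto simp: config_probsD[OF \<nu>])
qed

lemma lip_integral_diff_le:
  fixes f :: "('r::finite, 'a::finite) config \<Rightarrow> real"
  assumes f: "lip f" and \<nu>: "\<nu> \<in> config_probs" and \<nu>': "\<nu>' \<in> config_probs"
  shows "\<bar>(\<integral>x. f x \<partial>\<nu>) - (\<integral>x. f x \<partial>\<nu>')\<bar> \<le> 2 * tail TYPE('r) k +
    diam TYPE('r) * (\<Sum>p\<in>range (trunc k). \<bar>measure \<nu> {x. trunc k x = p} - measure \<nu>' {x. trunc k x = p}\<bar>)"
proof -
  let ?m = "\<lambda>\<nu> p. measure \<nu> {x. trunc k x = p}"
  have near: "\<bar>(\<integral>x. f x \<partial>\<nu>) - (\<integral>x. f (trunc k x) \<partial>\<nu>)\<bar> \<le> tail TYPE('r) k"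
    if \<nu>: "\<nu> \<in> config_probs" for \<nu>
  proof -
    interpret prob_space \<nu> using config_probsD[OF \<nu>] by simp
    note i = lip_integrable[OF f \<nu>] integral_trunc(1)[OF \<nu>, of f k]
    have "(\<integral>x. f x \<partial>\<nu>) - (\<integral>x. f (trunc k x) \<partial>\<nu>) = (\<integral>x. f x - f (trunc k x) \<partial>\<nu>)"
      using i by simp
    also have "\<bar>\<dots>\<bar> \<le> (\<integral>x. \<bar>f x - f (trunc k x)\<bar> \<partial>\<nu>)"
      by (rule integral_abs_bound)
    also have "\<dots> \<le> (\<integral>x. tail TYPE('r) k \<partial>\<nu>)"
      using i lip_trunc[OF f] by (intro integral_mono integrable_abs Bochner_Integration.integrable_diff) auto
    also have "\<dots> = tail TYPE('r) k" using prob_space by simp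
    finally show ?thesis .
  qed
  have one: "(\<Sum>p\<in>range (trunc k). ?m \<nu> p) = 1" if \<nu>: "\<nu> \<in> config_probs" for \<nu> :: "('r, 'a) config measure"
  proof -
    interpret prob_space \<nu> using config_probsD[OF \<nu>] by simp
    have "(\<Sum>p\<in>range (trunc k). ?m \<nu> p) = measure \<nu> UNIV"
      by (rule measure_cyl_set_sum[OF \<nu>, symmetric]) (simp add: cyl_set_def)
    then show ?thesis using prob_space by (simp add: config_probsD[OF \<nu>])
  qed
  have "(\<integral>x. f (trunc k x) \<partial>\<nu>) - (\<integral>x. f (trunc k x) \<partial>\<nu>') = (\<Sum>p\<in>range (trunc k). f p * (?m \<nu> p - ?m \<nu>' p))"
    by (simp add: integral_trunc(2)[OF \<nu>] integral_trunc(2)[OF \<nu>'] sum_subtractf algebra_simps)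
  also have "\<dots> = (\<Sum>p\<in>range (trunc k). (f p - f undefined) * (?m \<nu> p - ?m \<nu>' p))
     + f undefined * ((\<Sum>p\<in>range (trunc k). ?m \<nu> p) - (\<Sum>p\<in>range (trunc k). ?m \<nu>' p))"
    unfolding sum_subtractf[symmetric] sum_distrib_left sum.distrib[symmetric]
    by (intro sum.cong refl) (simp add: algebra_simps)
  also have "\<dots> = (\<Sum>p\<in>range (trunc k). (f p - f undefined) * (?m \<nu> p - ?m \<nu>' p))"
    using one[OF \<nu>] one[OF \<nu>'] by simp
  also have "\<bar>\<dots>\<bar> \<le> (\<Sum>p\<in>range (trunc k). \<bar>(f p - f undefined) * (?m \<nu> p - ?m \<nu>' p)\<bar>)"
    by (rule sum_abs)
  also have "\<dots> \<le> (\<Sum>p\<in>range (trunc k). diam TYPE('r) * \<bar>?m \<nu> p - ?m \<nu>' p\<bar>)"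
    unfolding abs_mult using f order_trans[OF _ config_dist_le_diam]
    by (intro sum_mono mult_right_mono) (blast, simp)
  finally have "\<bar>(\<integral>x. f (trunc k x) \<partial>\<nu>) - (\<integral>x. f (trunc k x) \<partial>\<nu>')\<bar> \<le>
     diam TYPE('r) * (\<Sum>p\<in>range (trunc k). \<bar>?m \<nu> p - ?m \<nu>' p\<bar>)"
    by (simp add: sum_distrib_left)
  with near[OF \<nu>] near[OF \<nu>'] show ?thesis by linarith
qed

lemma transport_bdd:
  fixes \<nu> \<nu>' :: "('r::finite, 'a::finite) config measure"
  assumes "\<nu> \<in> config_probs" "\<nu>' \<in> config_probs"
  shows "bdd_above ((\<lambda>f. \<bar>(\<integral>x. f x \<partial>\<nu>) - (\<integral>x. f x \<partial>\<nu>')\<bar>) ` {f. lip f})"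
  using lip_integral_diff_le[OF _ assms, of _ 0] by (intro bdd_aboveI2) auto

lemma transport_upper:
  fixes \<nu> \<nu>' :: "('r::finite, 'a::finite) config measure"
  assumes "\<nu> \<in> config_probs" "\<nu>' \<in> config_probs" "lip f"
  shows "\<bar>(\<integral>x. f x \<partial>\<nu>) - (\<integral>x. f x \<partial>\<nu>')\<bar> \<le> transport_dist \<nu> \<nu>'"
  unfolding transport_dist_def using assms transport_bdd[OF assms(1,2)]
  by (intro cSUP_upper2[where x = f]) auto

lemma transport_least:
  fixes \<nu> \<nu>' :: "('r::finite, 'a::finite) config measure"
  assumes "\<And>f. lip f \<Longrightarrow> \<bar>(\<integral>x. f x \<partial>\<nu>) - (\<integral>x. f x \<partial>\<nu>')\<bar> \<le> c"
  shows "transport_dist \<nu> \<nu>' \<le> c"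
proof -
  have "(\<lambda>_. 0) \<in> {f :: ('r, 'a) config \<Rightarrow> real. lip f}" by (simp add: config_dist_nonneg)
  then have "{f :: ('r, 'a) config \<Rightarrow> real. lip f} \<noteq> {}" by (metis empty_iff)
  then show ?thesis unfolding transport_dist_def
    using assms by (intro cSUP_least) auto
qed

lemma transport_triangle:
  fixes \<nu> \<nu>' \<nu>'' :: "('r::finite, 'a::finite) config measure"
  assumes "\<nu> \<in> config_probs" "\<nu>' \<in> config_probs" "\<nu>'' \<in> config_probs"
  shows "transport_dist \<nu> \<nu>'' \<le> transport_dist \<nu> \<nu>' + transport_dist \<nu>' \<nu>''"
proof (rule transport_least)
  fix f :: "('r, 'a) config \<Rightarrow> real" assume f: "lip f"
  show "\<bar>(\<integral>x. f x \<partial>\<nu>) - (\<integral>x. f x \<partial>\<nu>'')\<bar> \<le> transport_dist \<nu> \<nu>' + transport_dist \<nu>' \<nu>''"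
    using transport_upper[OF assms(1,2) f] transport_upper[OF assms(2,3) f] by linarith
qed

lemma transport_le_trunc:
  fixes \<nu> \<nu>' :: "('r::finite, 'a::finite) config measure"
  assumes "\<nu> \<in> config_probs" "\<nu>' \<in> config_probs"
  shows "transport_dist \<nu> \<nu>' \<le> 2 * tail TYPE('r) k +
    diam TYPE('r) * (\<Sum>p\<in>range (trunc k). \<bar>measure \<nu> {x. trunc k x = p} - measure \<nu>' {x. trunc k x = p}\<bar>)"
  by (rule transport_least) (rule lip_integral_diff_le[OF _ assms])

lemma transport_ge_cyl:
  fixes \<nu> \<nu>' :: "('r::finite, 'a::finite) config measure"
  assumes \<nu>: "\<nu> \<in> config_probs" and \<nu>': "\<nu>' \<in> config_probs" and S: "cyl_set k S"
  shows "\<bar>measure \<nu> S - measure \<nu>' S\<bar> \<le> (5 * real CARD('r) ^ 2) ^ k * transport_dist \<nu> \<nu>'"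
proof -
  interpret N: prob_space \<nu> using config_probsD[OF \<nu>] by simp
  interpret N': prob_space \<nu>' using config_probsD[OF \<nu>'] by simp
  let ?c = "1 / (5 * real CARD('r) ^ 2) ^ k"
  let ?f = "\<lambda>x. ?c * indicat_real S x"
  have "lip ?f"
  proof (intro allI)
    fix x y
    show "\<bar>?f x - ?f y\<bar> \<le> config_dist x y"
    proof (cases "trunc k x = trunc k y")
      case True
      then have "x \<in> S \<longleftrightarrow> y \<in> S" using S unfolding cyl_set_def by metis
      then show ?thesis by (auto simp: indicator_def config_dist_nonneg)
    next
      case False
      then obtain g where g: "word_length g \<le> k" "x g \<noteq> y g" by (auto simp: trunc_eq_iff)
      have "?c \<le> config_dist x y"
        using wt_antimono[OF g(1)] config_dist_ge[of x g y] g(2) by linarith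
      moreover have "0 \<le> ?c" by simp
      ultimately show ?thesis by (auto simp: indicator_def config_dist_nonneg simp del: power_mult_distrib)
    qed
  qed
  from transport_upper[OF \<nu> \<nu>' this]
  have "\<bar>?c * measure \<nu> S - ?c * measure \<nu>' S\<bar> \<le> transport_dist \<nu> \<nu>'"
    using cyl_set_sets[OF S] by (simp add: config_probsD[OF \<nu>] config_probsD[OF \<nu>'])
  moreover have "\<bar>?c * measure \<nu> S - ?c * measure \<nu>' S\<bar> = ?c * \<bar>measure \<nu> S - measure \<nu>' S\<bar>"
    unfolding right_diff_distrib[symmetric] abs_mult by simp
  moreover have "0 < (5 * real CARD('r) ^ 2) ^ k" by simp
  ultimately show ?thesis by (simp add: pos_divide_le_eq mult.commute del: power_mult_distrib)
qed

section \<open>Counting permutations with prescribed edge statistics\<close>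


definition mfact :: "'c multiset \<Rightarrow> nat" where
  "mfact A = (\<Prod>x\<in>set_mset A. fact (count A x))"

definition labelings :: "'v set \<Rightarrow> 'c multiset \<Rightarrow> ('v \<Rightarrow> 'c) set" where
  "labelings V A = {X \<in> V \<rightarrow>\<^sub>E UNIV. image_mset X (mset_set V) = A}"

lemma mfact_pos: "mfact A > 0"
  by (simp add: mfact_def prod_pos)

lemma mfact_neq_0 [simp]: "mfact A \<noteq> 0"
  using mfact_pos[of A] by simp

lemma bij_betw_labelings:
  assumes vs: "distinct vs"
  shows "bij_betw (\<lambda>X. map X vs) (labelings (set vs) A) (permutations_of_multiset A \<inter> {xs. length xs = length vs})"
  unfolding bij_betw_def
proof (intro conjI inj_onI subset_antisym subsetI)
  fix X Y assume XY: "X \<in> labelings (set vs) A" "Y \<in> labelings (set vs) A" "map X vs = map Y vs"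
  then have "X v = Y v" for v
    by (cases "v \<in> set vs") (auto simp: labelings_def PiE_def extensional_def)
  then show "X = Y" by blast
next
  fix xs assume "xs \<in> (\<lambda>X. map X vs) ` labelings (set vs) A"
  then show "xs \<in> permutations_of_multiset A \<inter> {xs. length xs = length vs}"
    using vs by (auto simp: labelings_def permutations_of_multiset_def mset_set_set)
next
  fix xs assume xs: "xs \<in> permutations_of_multiset A \<inter> {xs. length xs = length vs}"
  define X where "X = restrict (\<lambda>v. the (map_of (zip vs xs) v)) (set vs)"
  have "map X vs = xs"
    using xs vs by (intro nth_equalityI) (auto simp: X_def map_of_zip_nth)
  moreover from this have "image_mset X (mset_set (set vs)) = A"
    using xs vs by (auto simp: mset_set_set permutations_of_multiset_def simp flip: mset_map)
  then have "X \<in> labelings (set vs) A"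
    by (auto simp: labelings_def X_def)
  ultimately show "xs \<in> (\<lambda>X. map X vs) ` labelings (set vs) A" by blast
qed

lemma labelings_size:
  assumes "finite V" "X \<in> labelings V A"
  shows "size A = card V"
  using assms by (auto simp: labelings_def)

lemma card_labelings:
  assumes "finite V" "size A = card V"
  shows "card (labelings V A) * mfact A = fact (card V)"
    and "finite (labelings V A)" and "labelings V A \<noteq> {}"
proof -
  obtain vs where vs: "set vs = V" "distinct vs" using finite_distinct_list[OF assms(1)] by blast
  then have "length vs = size A" using assms distinct_card by fastforce
  then have "permutations_of_multiset A \<inter> {xs. length xs = length vs} = permutations_of_multiset A"
    by (auto simp: length_finite_permutations_of_multiset)
  then have b: "bij_betw (\<lambda>X. map X vs) (labelings V A) (permutations_of_multiset A)"
    using bij_betw_labelings[OF vs(2), of A] vs by simp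
  show "card (labelings V A) * mfact A = fact (card V)"
    using bij_betw_same_card[OF b] card_permutations_of_multiset_aux[of A] assms(2)
    by (simp add: mfact_def)
  show "finite (labelings V A)" using bij_betw_finite[OF b] by simp
  then show "labelings V A \<noteq> {}" using bij_betw_same_card[OF b]
    by (metis b bij_betw_empty1 permutations_of_multiset_not_empty)
qed

lemma permutes_image_mset_comp:
  assumes "\<tau> permutes V"
  shows "image_mset (\<lambda>v. f (\<tau> v)) (mset_set V) = image_mset f (mset_set V)"
proof -
  have "image_mset \<tau> (mset_set V) = mset_set V"
    using assms by (simp add: image_mset_mset_set permutes_inj_on permutes_image)
  then show ?thesis by (metis (no_types) multiset.map_comp comp_def image_mset_cong)
qed

lemma image_mset_mset_set_cong:
  "(\<And>v. v \<in> V \<Longrightarrow> f v = g v) \<Longrightarrow> image_mset f (mset_set V) = image_mset g (mset_set V)"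
  by (cases "finite V") (auto intro: image_mset_cong)

definition intertwiners :: "'v set \<Rightarrow> ('v \<Rightarrow> 'c) \<Rightarrow> ('v \<Rightarrow> 'c) \<Rightarrow> ('v \<Rightarrow> 'v) set" where
  "intertwiners V X Y = {\<tau>. \<tau> permutes V \<and> (\<forall>v\<in>V. X (\<tau> v) = Y v)}"

lemma finite_intertwiners: "finite V \<Longrightarrow> finite (intertwiners V X Y)"
  by (rule finite_subset[OF _ finite_permutations]) (auto simp: intertwiners_def)

lemma labelings_intertwiner:
  assumes "finite V" "X \<in> labelings V A" "Y \<in> labelings V A"
  obtains \<tau> where "\<tau> permutes V" "\<And>v. v \<in> V \<Longrightarrow> X (\<tau> v) = Y v"
proof -
  have "image_mset Y (mset_set V) = image_mset X (mset_set V)"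
    using assms by (simp add: labelings_def)
  from image_mset_eq_implies_permutes[OF assms(1) this] show thesis
    using that by metis
qed

lemma card_intertwiners_eq_self:
  assumes "finite V" "X \<in> labelings V A" "Y \<in> labelings V A"
  shows "card (intertwiners V X Y) = card (intertwiners V X X)"
proof -
  obtain \<rho> where \<rho>: "\<rho> permutes V" "\<And>v. v \<in> V \<Longrightarrow> X (\<rho> v) = Y v"
    using labelings_intertwiner[OF assms] by blast
  have \<rho>': "inv_into UNIV \<rho> permutes V" using \<rho>(1) by (rule permutes_inv)
  have "bij_betw (\<lambda>\<tau>. \<tau> \<circ> \<rho>) (intertwiners V X X) (intertwiners V X Y)"
  proof (rule bij_betwI[where g = "\<lambda>\<tau>. \<tau> \<circ> inv_into UNIV \<rho>"])
    show "(\<lambda>\<tau>. \<tau> \<circ> \<rho>) \<in> intertwiners V X X \<rightarrow> intertwiners V X Y"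
      using \<rho> by (auto simp: intertwiners_def permutes_compose permutes_in_image)
    show "(\<lambda>\<tau>. \<tau> \<circ> inv_into UNIV \<rho>) \<in> intertwiners V X Y \<rightarrow> intertwiners V X X"
    proof
      fix \<tau> assume \<tau>: "\<tau> \<in> intertwiners V X Y"
      have "X (\<tau> (inv_into UNIV \<rho> v)) = X v" if "v \<in> V" for v
      proof -
        have "inv_into UNIV \<rho> v \<in> V" using \<rho>' that by (simp add: permutes_in_image)
        then show ?thesis using \<tau> \<rho>(2)[of "inv_into UNIV \<rho> v"] permutes_inverses[OF \<rho>(1)]
          by (simp add: intertwiners_def)
      qed
      then show "\<tau> \<circ> inv_into UNIV \<rho> \<in> intertwiners V X X"
        using \<tau> \<rho>' by (auto simp: intertwiners_def permutes_compose)
    qed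
  qed (simp_all add: comp_assoc permutes_inv_o[OF \<rho>(1)])
  then show ?thesis by (simp add: bij_betw_same_card)
qed

lemma card_intertwiners:
  assumes V: "finite V" and X: "X \<in> labelings V A" and Y: "Y \<in> labelings V A"
  shows "card (intertwiners V X Y) = mfact A"
proof -
  note L = card_labelings[OF V labelings_size[OF V X]]
  have "{\<tau>. \<tau> permutes V} = (\<Union>Y\<in>labelings V A. intertwiners V X Y)"
  proof (intro subset_antisym subsetI)
    fix \<tau> assume "\<tau> \<in> {\<tau>. \<tau> permutes V}"
    then have \<tau>: "\<tau> permutes V" by simp
    have "restrict (\<lambda>v. X (\<tau> v)) V \<in> labelings V A"
      using X permutes_image_mset_comp[OF \<tau>, of X] image_mset_mset_set_cong[of V "restrict (\<lambda>v. X (\<tau> v)) V"]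
      by (simp add: labelings_def)
    moreover have "\<tau> \<in> intertwiners V X (restrict (\<lambda>v. X (\<tau> v)) V)"
      using \<tau> by (simp add: intertwiners_def)
    ultimately show "\<tau> \<in> (\<Union>Y\<in>labelings V A. intertwiners V X Y)" by blast
  qed (auto simp: intertwiners_def)
  then have "card {\<tau>. \<tau> permutes V} = card (\<Union>Y\<in>labelings V A. intertwiners V X Y)" by simp
  also have "\<dots> = (\<Sum>Y\<in>labelings V A. card (intertwiners V X Y))"
  proof (rule card_UN_disjoint[OF L(2)])
    show "\<forall>i\<in>labelings V A. \<forall>j\<in>labelings V A. i \<noteq> j \<longrightarrow> intertwiners V X i \<inter> intertwiners V X j = {}"
    proof (intro ballI impI)
      fix i j assume ij: "i \<in> labelings V A" "j \<in> labelings V A" "i \<noteq> j"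
      show "intertwiners V X i \<inter> intertwiners V X j = {}"
      proof (rule ccontr)
        assume "intertwiners V X i \<inter> intertwiners V X j \<noteq> {}"
        then obtain t where "t \<in> intertwiners V X i" "t \<in> intertwiners V X j" by blast
        then have "i v = j v" if "v \<in> V" for v using that by (auto simp: intertwiners_def)
        then have "i = j" using ij(1,2) by (intro PiE_ext[of i V _ j]) (auto simp: labelings_def)
        with ij(3) show False by simp
      qed
    qed
  qed (simp add: finite_intertwiners[OF V])
  also have "\<dots> = card (labelings V A) * card (intertwiners V X X)"
    using card_intertwiners_eq_self[OF V X] by simp
  finally have "card (labelings V A) * card (intertwiners V X X) = card (labelings V A) * mfact A"
    using L(1) card_permutations[OF refl V] by metis
  moreover have "card (labelings V A) > 0" using L(2,3) by (simp add: card_gt_0_iff)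
  ultimately show ?thesis
    using card_intertwiners_eq_self[OF V X Y] by simp
qed

definition edge_mset :: "'v set \<Rightarrow> ('v \<Rightarrow> 'c) \<Rightarrow> ('v \<Rightarrow> 'v) \<Rightarrow> ('c \<times> 'c) multiset" where
  "edge_mset V X \<tau> = image_mset (\<lambda>v. (X v, X (\<tau> v))) (mset_set V)"

definition edge_perms :: "'v set \<Rightarrow> ('v \<Rightarrow> 'c) \<Rightarrow> ('c \<times> 'c) multiset \<Rightarrow> ('v \<Rightarrow> 'v) set" where
  "edge_perms V X M = {\<tau>. \<tau> permutes V \<and> edge_mset V X \<tau> = M}"

lemma finite_edge_perms: "finite V \<Longrightarrow> finite (edge_perms V X M)"
  by (rule finite_subset[OF _ finite_permutations]) (auto simp: edge_perms_def)

lemma edge_mset_marginals: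
  assumes "\<tau> permutes V"
  shows "image_mset fst (edge_mset V X \<tau>) = image_mset X (mset_set V)"
    and "image_mset snd (edge_mset V X \<tau>) = image_mset X (mset_set V)"
  using permutes_image_mset_comp[OF assms, of X]
  by (simp_all add: edge_mset_def multiset.map_comp comp_def)

lemma card_edge_perms_le:
  assumes V: "finite V" and X: "X \<in> labelings V A" and Y: "Y \<in> labelings V A"
  shows "card (edge_perms V X M) \<le> card (edge_perms V Y M)"
proof -
  obtain \<rho> where \<rho>: "\<rho> permutes V" "\<And>v. v \<in> V \<Longrightarrow> X (\<rho> v) = Y v"
    using labelings_intertwiner[OF assms] by blast
  have \<rho>': "inv_into UNIV \<rho> permutes V" using \<rho>(1) by (rule permutes_inv)
  show ?thesis
  proof (rule card_inj_on_le)
    show "inj_on (\<lambda>\<tau>. inv_into UNIV \<rho> \<circ> \<tau> \<circ> \<rho>) (edge_perms V X M)"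
    proof (rule inj_onI)
      fix s t assume "inv_into UNIV \<rho> \<circ> s \<circ> \<rho> = inv_into UNIV \<rho> \<circ> t \<circ> \<rho>"
      then have "\<rho> \<circ> (inv_into UNIV \<rho> \<circ> s \<circ> \<rho>) \<circ> inv_into UNIV \<rho> = \<rho> \<circ> (inv_into UNIV \<rho> \<circ> t \<circ> \<rho>) \<circ> inv_into UNIV \<rho>" by simp
      then show "s = t"
        by (simp add: fun_eq_iff permutes_inverses[OF \<rho>(1)])
    qed
    show "(\<lambda>\<tau>. inv_into UNIV \<rho> \<circ> \<tau> \<circ> \<rho>) ` edge_perms V X M \<subseteq> edge_perms V Y M"
    proof safe
      fix \<tau> assume \<tau>: "\<tau> \<in> edge_perms V X M"
      then have t: "\<tau> permutes V" by (simp add: edge_perms_def)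
      have p: "inv_into UNIV \<rho> \<circ> \<tau> \<circ> \<rho> permutes V"
        using \<rho> \<rho>' t by (intro permutes_compose)
      have "edge_mset V Y (inv_into UNIV \<rho> \<circ> \<tau> \<circ> \<rho>) = image_mset (\<lambda>v. (X (\<rho> v), X (\<tau> (\<rho> v)))) (mset_set V)"
        unfolding edge_mset_def
      proof (rule image_mset_mset_set_cong)
        fix v assume v: "v \<in> V"
        then have "inv_into UNIV \<rho> (\<tau> (\<rho> v)) \<in> V" using \<rho>(1) \<rho>' t by (simp add: permutes_in_image)
        from \<rho>(2)[OF this] \<rho>(2)[OF v]
        show "(Y v, Y ((inv_into UNIV \<rho> \<circ> \<tau> \<circ> \<rho>) v)) = (X (\<rho> v), X (\<tau> (\<rho> v)))"
          by (simp add: permutes_inverses[OF \<rho>(1)])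
      qed
      also have "\<dots> = edge_mset V X \<tau>"
        using permutes_image_mset_comp[OF \<rho>(1), of "\<lambda>v. (X v, X (\<tau> v))"] by (simp add: edge_mset_def)
      finally show "inv_into UNIV \<rho> \<circ> \<tau> \<circ> \<rho> \<in> edge_perms V Y M"
        using p \<tau> by (simp add: edge_perms_def)
    qed
  qed (rule finite_edge_perms[OF V])
qed

lemma card_edge_perms:
  assumes V: "finite V" and X: "X \<in> labelings V A"
    and M: "image_mset fst M = A" "image_mset snd M = A"
  shows "card (edge_perms V X M) * mfact M = mfact A ^ 2"
proof -
  have sA: "size A = card V" by (rule labelings_size[OF V X])
  then have sM: "size M = card V" using M(1) by auto
  note LA = card_labelings[OF V sA] and LM = card_labelings[OF V sM]
  let ?S = "SIGMA Y:labelings V A. edge_perms V Y M"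
  let ?T = "SIGMA Z:labelings V M. intertwiners V (restrict (\<lambda>v. fst (Z v)) V) (restrict (\<lambda>v. snd (Z v)) V)"
  let ?f = "\<lambda>(Y, \<tau>). (restrict (\<lambda>v. (Y v, Y (\<tau> v))) V, \<tau>)"
  let ?g = "\<lambda>(Z, \<tau>). (restrict (\<lambda>v. fst (Z v)) V, \<tau> :: 'a \<Rightarrow> 'a)"
  have marg: "restrict (\<lambda>v. fst (Z v)) V \<in> labelings V A" "restrict (\<lambda>v. snd (Z v)) V \<in> labelings V A"
    if "Z \<in> labelings V M" for Z
    using that M image_mset_mset_set_cong[of V "restrict (\<lambda>v. fst (Z v)) V" "\<lambda>v. fst (Z v)"]
      image_mset_mset_set_cong[of V "restrict (\<lambda>v. snd (Z v)) V" "\<lambda>v. snd (Z v)"]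
    by (auto simp: labelings_def multiset.map_comp comp_def)
  have "bij_betw ?f ?S ?T"
  proof (rule bij_betwI[where g = ?g])
    show "?f \<in> ?S \<rightarrow> ?T"
    proof safe
      fix Y \<tau> assume Y: "Y \<in> labelings V A" and \<tau>: "\<tau> \<in> edge_perms V Y M"
      show "restrict (\<lambda>v. (Y v, Y (\<tau> v))) V \<in> labelings V M"
        using \<tau> image_mset_mset_set_cong[of V "restrict (\<lambda>v. (Y v, Y (\<tau> v))) V" "\<lambda>v. (Y v, Y (\<tau> v))"]
        by (simp add: labelings_def edge_perms_def edge_mset_def)
      show "\<tau> \<in> intertwiners V (restrict (\<lambda>v. fst (restrict (\<lambda>v. (Y v, Y (\<tau> v))) V v)) V)
          (restrict (\<lambda>v. snd (restrict (\<lambda>v. (Y v, Y (\<tau> v))) V v)) V)"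
        using \<tau> by (auto simp: intertwiners_def edge_perms_def permutes_in_image)
    qed
    show "?g \<in> ?T \<rightarrow> ?S"
    proof safe
      fix Z \<tau> assume Z: "Z \<in> labelings V M"
        and \<tau>: "\<tau> \<in> intertwiners V (restrict (\<lambda>v. fst (Z v)) V) (restrict (\<lambda>v. snd (Z v)) V)"
      show "restrict (\<lambda>v. fst (Z v)) V \<in> labelings V A" by (rule marg[OF Z])
      have t: "\<tau> permutes V" using \<tau> by (simp add: intertwiners_def)
      have "edge_mset V (restrict (\<lambda>v. fst (Z v)) V) \<tau> = image_mset Z (mset_set V)"
        unfolding edge_mset_def
      proof (rule image_mset_mset_set_cong)
        fix v assume "v \<in> V"
        then show "(restrict (\<lambda>v. fst (Z v)) V v, restrict (\<lambda>v. fst (Z v)) V (\<tau> v)) = Z v"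
          using \<tau> t by (auto simp: intertwiners_def permutes_in_image prod_eq_iff)
      qed
      then show "\<tau> \<in> edge_perms V (restrict (\<lambda>v. fst (Z v)) V) M"
        using Z t by (simp add: edge_perms_def labelings_def)
    qed
    show "?g (?f x) = x" if "x \<in> ?S" for x
    proof -
      obtain Y \<tau> where x: "x = (Y, \<tau>)" by (cases x)
      have "restrict Y V = Y" using that x by (auto simp: labelings_def)
      moreover have "restrict (\<lambda>v. fst (restrict (\<lambda>v. (Y v, Y (\<tau> v))) V v)) V = restrict Y V"
        by (auto simp: restrict_def fun_eq_iff)
      ultimately show ?thesis by (simp add: x)
    qed
    show "?f (?g y) = y" if "y \<in> ?T" for y
    proof -
      obtain Z \<tau> where y: "y = (Z, \<tau>)" by (cases y)
      have Z: "Z \<in> V \<rightarrow>\<^sub>E UNIV" using that y by (auto simp: labelings_def)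
      have \<tau>: "\<tau> permutes V" "\<forall>v\<in>V. restrict (\<lambda>v. fst (Z v)) V (\<tau> v) = restrict (\<lambda>v. snd (Z v)) V v"
        using that y by (auto simp: intertwiners_def)
      have "restrict (\<lambda>v. (restrict (\<lambda>v. fst (Z v)) V v, restrict (\<lambda>v. fst (Z v)) V (\<tau> v))) V = Z"
        by (rule PiE_ext[OF _ Z]) (use \<tau> in \<open>auto simp: prod_eq_iff\<close>)
      then show ?thesis by (simp add: y)
    qed
  qed
  then have "card ?S = card ?T" by (rule bij_betw_same_card)
  moreover have "card ?S = card (labelings V A) * card (edge_perms V X M)"
  proof -
    have "card (edge_perms V Y M) = card (edge_perms V X M)" if "Y \<in> labelings V A" for Y
      using card_edge_perms_le[OF V X that] card_edge_perms_le[OF V that X] by (metis le_antisym)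
    then show ?thesis using LA(2) by (subst card_SigmaI) (auto simp: finite_edge_perms[OF V])
  qed
  moreover have "card ?T = card (labelings V M) * mfact A"
  proof -
    have "card (intertwiners V (restrict (\<lambda>v. fst (Z v)) V) (restrict (\<lambda>v. snd (Z v)) V)) = mfact A"
      if "Z \<in> labelings V M" for Z
      by (rule card_intertwiners[OF V marg[OF that]])
    then show ?thesis using LM(2) by (subst card_SigmaI) (auto simp: finite_intertwiners[OF V])
  qed
  ultimately have eq: "card (labelings V A) * card (edge_perms V X M) = card (labelings V M) * mfact A" by simp
  have "fact (card V) * (card (edge_perms V X M) * mfact M)
      = mfact A * (card (labelings V A) * card (edge_perms V X M)) * mfact M"
    by (simp add: LA(1)[symmetric] mult_ac)
  also have "\<dots> = fact (card V) * mfact A ^ 2"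
    unfolding eq by (simp add: LM(1)[symmetric] power2_eq_square mult_ac)
  finally show ?thesis by simp
qed

definition edge_labelings :: "'v set \<Rightarrow> ('r \<Rightarrow> ('c \<times> 'c) multiset) \<Rightarrow> (('v \<Rightarrow> 'c) \<times> ('r \<Rightarrow> 'v \<Rightarrow> 'v)) set" where
  "edge_labelings V M = (SIGMA X:V \<rightarrow>\<^sub>E UNIV. {t. \<forall>i. t i \<in> edge_perms V X (M i)})"

lemma edge_labelings_marginals:
  assumes "(X, t) \<in> edge_labelings V M"
  shows "image_mset fst (M i) = image_mset X (mset_set V)" "image_mset snd (M i) = image_mset X (mset_set V)"
  using assms edge_mset_marginals[of "t i" V X] by (auto simp: edge_labelings_def edge_perms_def)

lemma card_edge_labelings:
  fixes M :: "'r::finite \<Rightarrow> ('c \<times> 'c) multiset"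
  assumes V: "finite V" and M: "\<And>i. image_mset fst (M i) = A" "\<And>i. image_mset snd (M i) = A"
    and sA: "size A = card V"
  shows "real (card (edge_labelings V M)) =
    fact (card V) / mfact A * (\<Prod>i\<in>UNIV. real (mfact A) ^ 2 / mfact (M i))"
    and "finite (edge_labelings V M)"
proof -
  note L = card_labelings[OF V sA]
  have eq: "edge_labelings V M = (SIGMA X:labelings V A. PiE UNIV (\<lambda>i. edge_perms V X (M i)))"
  proof (intro subset_antisym subsetI)
    fix z assume z: "z \<in> edge_labelings V M"
    obtain X t where [simp]: "z = (X, t)" by (cases z)
    have "image_mset X (mset_set V) = A"
      using edge_labelings_marginals(1)[of X t V M undefined] z M(1) by simp
    then show "z \<in> (SIGMA X:labelings V A. PiE UNIV (\<lambda>i. edge_perms V X (M i)))"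
      using z by (auto simp: edge_labelings_def labelings_def)
  qed (auto simp: edge_labelings_def labelings_def PiE_UNIV_domain)
  have fin: "finite (PiE UNIV (\<lambda>i. edge_perms V X (M i)))" for X
    by (intro finite_PiE finite_edge_perms[OF V]) simp
  have "real (card (PiE UNIV (\<lambda>i. edge_perms V X (M i)))) = (\<Prod>i\<in>UNIV. real (mfact A) ^ 2 / mfact (M i))"
    if "X \<in> labelings V A" for X
  proof -
    have "real (card (edge_perms V X (M i))) = real (mfact A) ^ 2 / mfact (M i)" for i
    proof -
      have "real (card (edge_perms V X (M i))) * real (mfact (M i)) = real (mfact A) ^ 2"
        using card_edge_perms[OF V that M, of i] by (metis of_nat_mult of_nat_power)
      then show ?thesis using mfact_pos[of "M i"] by (simp add: field_simps)
    qed
    then show ?thesis by (simp add: card_PiE)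
  qed
  moreover have "real (card (labelings V A)) = fact (card V) / mfact A"
  proof -
    have "real (card (labelings V A)) * real (mfact A) = fact (card V)"
      using L(1) by (metis of_nat_mult of_nat_fact)
    then show ?thesis using mfact_pos[of A] by (simp add: field_simps)
  qed
  ultimately show "real (card (edge_labelings V M)) =
    fact (card V) / mfact A * (\<Prod>i\<in>UNIV. real (mfact A) ^ 2 / mfact (M i))"
    unfolding eq using L(2) fin by (subst card_SigmaI) auto
  show "finite (edge_labelings V M)"
    unfolding eq using L(2) fin by (intro finite_SigmaI) auto
qed

definition xlnx :: "real \<Rightarrow> real" where "xlnx x = x * ln x"

lemma ln_fact_lower: "xlnx (real k) - real k \<le> ln (fact k)"
proof (induction k)
  case (Suc k)
  show ?case
  proof (cases "k = 0")
    case False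
    have "ln (1 + 1 / real k) \<le> 1 / real k" by (rule ln_add_one_self_le_self) simp
    moreover have "ln (real (Suc k)) - ln (real k) = ln (1 + 1 / real k)"
      using False ln_div[of "real (Suc k)" "real k"] by (simp add: field_simps)
    ultimately have "real k * (ln (real (Suc k)) - ln (real k)) \<le> real k * (1 / real k)"
      by (intro mult_left_mono) auto
    then have "real k * ln (real (Suc k)) - real k * ln (real k) \<le> 1"
      using False by (simp add: algebra_simps)
    moreover have "ln (fact (Suc k)) = ln (real (Suc k)) + ln (fact k)"
      by (simp add: ln_mult)
    ultimately show ?thesis using Suc unfolding xlnx_def by (simp add: algebra_simps)
  qed (simp add: xlnx_def)
qed (simp add: xlnx_def)

lemma ln_one_plus_lower: "x \<ge> 0 \<Longrightarrow> x / (1 + x) \<le> ln (1 + x)" for x :: real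
proof -
  assume x: "x \<ge> 0"
  have "ln (1 / (1 + x)) \<le> 1 / (1 + x) - 1"
    using x by (intro ln_le_minus_one) auto
  moreover have "ln (1 / (1 + x)) = - ln (1 + x)"
    using x by (simp add: ln_div)
  moreover have "1 / (1 + x) - 1 = - (x / (1 + x))" using x by (simp add: field_simps)
  ultimately show ?thesis by linarith
qed

lemma ln_fact_upper:
  assumes "k \<ge> 1"
  shows "ln (fact k) \<le> xlnx (real k) - real k + 1 + ln (real k)"
  using assms
proof (induction k rule: nat_induct_at_least)
  case (Suc k)
  have "1 / real k / (1 + 1 / real k) \<le> ln (1 + 1 / real k)"
    by (rule ln_one_plus_lower) simp
  moreover have "1 / real k / (1 + 1 / real k) = 1 / real (Suc k)"
    using Suc.hyps by (simp add: field_simps)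
  moreover have "ln (real (Suc k)) - ln (real k) = ln (1 + 1 / real k)"
    using Suc.hyps ln_div[of "real (Suc k)" "real k"] by (simp add: field_simps)
  ultimately have "1 / real (Suc k) \<le> ln (real (Suc k)) - ln (real k)" by simp
  then have "real (Suc k) * (1 / real (Suc k)) \<le> real (Suc k) * (ln (real (Suc k)) - ln (real k))"
    by (intro mult_left_mono) auto
  then have "1 \<le> real (Suc k) * ln (real (Suc k)) - real (Suc k) * ln (real k)"
    by (simp add: algebra_simps)
  moreover have "ln (fact (Suc k)) = ln (real (Suc k)) + ln (fact k)"
    by (simp add: ln_mult)
  ultimately show ?case using Suc.IH unfolding xlnx_def by (simp add: algebra_simps)
qed (simp add: xlnx_def)

lemma ln_fact_bounds:
  assumes "k \<le> n"
  shows "0 \<le> ln (fact k) - (xlnx (real k) - real k)"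
    and "ln (fact k) - (xlnx (real k) - real k) \<le> 1 + ln (1 + real n)"
proof -
  show "0 \<le> ln (fact k) - (xlnx (real k) - real k)" using ln_fact_lower[of k] by simp
  show "ln (fact k) - (xlnx (real k) - real k) \<le> 1 + ln (1 + real n)"
  proof (cases "k = 0")
    case False
    then have "ln (real k) \<le> ln (1 + real n)" using assms by (subst ln_le_cancel_iff) auto
    moreover have "k \<ge> 1" using False by simp
    ultimately show ?thesis using ln_fact_upper[of k] by linarith
  qed (simp add: xlnx_def)
qed

lemma xlnx_scale: "n > 0 \<Longrightarrow> a \<ge> 0 \<Longrightarrow> xlnx a = n * xlnx (a / n) + a * ln n" for n :: real
  by (cases "a = 0") (auto simp: xlnx_def ln_div field_simps)

lemma sum_count_superset:
  assumes "finite P" "set_mset A \<subseteq> P"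
  shows "(\<Sum>p\<in>P. count A p) = size A"
  unfolding size_multiset_overloaded_eq using assms
  by (intro sum.mono_neutral_right) (auto simp: not_in_iff)

lemma ln_mfact_bounds:
  assumes P: "finite P" "set_mset A \<subseteq> P" and n: "size A = n" "n > 0"
  defines "main \<equiv> real n * (\<Sum>p\<in>P. xlnx (count A p / n)) + n * ln n - n"
  shows "0 \<le> ln (mfact A) - main" "ln (mfact A) - main \<le> card P * (1 + ln (1 + real n))"
proof -
  have "mfact A = (\<Prod>p\<in>P. fact (count A p))"
    unfolding mfact_def using P by (intro prod.mono_neutral_left) (auto simp: not_in_iff)
  then have "real (mfact A) = (\<Prod>p\<in>P. fact (count A p))" by simp
  then have 1: "ln (mfact A) = (\<Sum>p\<in>P. ln (fact (count A p)))"
    using P(1) by (simp add: ln_prod)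
  have c: "(\<Sum>p\<in>P. real (count A p)) = n"
    using sum_count_superset[OF P] n by (metis of_nat_sum)
  have "(\<Sum>p\<in>P. xlnx (count A p) - count A p) = (\<Sum>p\<in>P. n * xlnx (count A p / n) + count A p * ln n) - n"
    using n c by (simp add: sum_subtractf xlnx_scale[of "real n"])
  also have "\<dots> = main"
    using c unfolding main_def by (simp add: sum.distrib sum_distrib_left sum_distrib_right[symmetric])
  finally have 2: "main = (\<Sum>p\<in>P. xlnx (count A p) - count A p)" by simp
  have le: "count A p \<le> n" for p using n count_le_size[of A p] by simp
  show "0 \<le> ln (mfact A) - main"
    unfolding 1 2 sum_subtractf[symmetric] using ln_fact_bounds(1)[OF le] by (intro sum_nonneg) auto
  have "(\<Sum>p\<in>P. ln (fact (count A p)) - (xlnx (count A p) - count A p)) \<le> (\<Sum>p\<in>P. 1 + ln (1 + real n))"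
    using ln_fact_bounds(2)[OF le] by (intro sum_mono) auto
  then show "ln (mfact A) - main \<le> card P * (1 + ln (1 + real n))"
    unfolding 1 2 sum_subtractf[symmetric] by simp
qed

text \<open>The growth rate of the number of pairs of a labelling and a tuple of permutations with vertex
  frequencies \<open>a\<close> and edge frequencies \<open>w\<close>, normalised by the number of tuples.\<close>

definition bethe :: "'c set \<Rightarrow> ('c \<Rightarrow> real) \<Rightarrow> ('r::finite \<Rightarrow> 'c \<times> 'c \<Rightarrow> real) \<Rightarrow> real" where
  "bethe P a w = (2 * real CARD('r) - 1) * (\<Sum>p\<in>P. xlnx (a p)) - (\<Sum>i\<in>UNIV. \<Sum>z\<in>P \<times> P. xlnx (w i z))"

lemma card_edge_labelings_bounds:
  fixes M :: "'r::finite \<Rightarrow> ('c \<times> 'c) multiset"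
  assumes V: "finite V" "card V = n" "n > 0"
    and M: "\<And>i. image_mset fst (M i) = A" "\<And>i. image_mset snd (M i) = A"
    and P: "finite P" "\<And>i. set_mset (M i) \<subseteq> P \<times> P" and sA: "size A = n"
  shows "real (card (edge_labelings V M)) > 0"
    "\<bar>ln (card (edge_labelings V M) / fact n ^ CARD('r)) -
       n * bethe P (\<lambda>p. count A p / n) (\<lambda>i z. count (M i) z / n)\<bar>
     \<le> real CARD('r) * (1 + real (card P)) ^ 2 * (1 + ln (1 + real n))"
proof -
  let ?r = "real CARD('r)" and ?L = "1 + ln (1 + real n)"
  let ?sA = "\<Sum>p\<in>P. xlnx (count A p / n)" and ?sM = "\<lambda>i. \<Sum>z\<in>P \<times> P. xlnx (count (M i) z / n)"
  have r1: "?r \<ge> 1" by (rule card_real_ge_1)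
  have L0: "?L \<ge> 0" by simp
  have PA: "set_mset A \<subseteq> P" using M(1)[of undefined, symmetric] P(2)[of undefined] by auto
  have sM: "size (M i) = n" for i using M(1)[of i] sA by auto
  have pos: "real (mfact B) > 0" for B :: "'z multiset" using mfact_pos[of B] by simp
  note C = card_edge_labelings[OF V(1) M, unfolded V(2), OF sA]
  show c0: "real (card (edge_labelings V M)) > 0"
    unfolding C(1) by (intro mult_pos_pos divide_pos_pos prod_pos) (auto simp: mfact_pos)
  have ppos: "(\<Prod>i\<in>UNIV. real (mfact A) ^ 2 / mfact (M i)) > 0"
    by (intro prod_pos) (auto simp: mfact_pos)
  define eA where "eA = ln (mfact A) - (real n * ?sA + n * ln n - n)"
  define eM where "eM i = ln (mfact (M i)) - (real n * ?sM i + n * ln n - n)" for i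
  define e0 where "e0 = ln (fact n) - (n * ln n - real n)"
  have eA: "0 \<le> eA" "eA \<le> card P * ?L"
    using ln_mfact_bounds[OF P(1) PA sA V(3)] by (simp_all add: eA_def)
  have eM: "0 \<le> eM i" "eM i \<le> (real (card P)) ^ 2 * ?L" for i
    using ln_mfact_bounds[OF _ P(2) sM V(3), of i] P(1) by (simp_all add: eM_def card_cartesian_product power2_eq_square)
  have e0: "0 \<le> e0" "e0 \<le> ?L" using ln_fact_bounds[of n n] by (simp_all add: e0_def xlnx_def)
  have "ln (card (edge_labelings V M) / fact n ^ CARD('r)) = ln (card (edge_labelings V M)) - ?r * ln (fact n)"
    using c0 by (subst ln_div) (auto simp: ln_realpow)
  also have "ln (card (edge_labelings V M)) = ln (fact n) - ln (mfact A) + (\<Sum>i\<in>UNIV. 2 * ln (mfact A) - ln (mfact (M i)))"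
    unfolding C(1) using pos ppos
    by (subst ln_mult) (auto simp: ln_div ln_prod ln_realpow)
  also have "\<dots> - ?r * ln (fact n) = (1 - ?r) * ln (fact n) + (2 * ?r - 1) * ln (mfact A) - (\<Sum>i\<in>UNIV. ln (mfact (M i)))"
    by (simp add: sum_subtractf algebra_simps)
  also have "\<dots> = n * bethe P (\<lambda>p. count A p / n) (\<lambda>i z. count (M i) z / n)
      + ((1 - ?r) * e0 + (2 * ?r - 1) * eA - (\<Sum>i\<in>UNIV. eM i))"
    by (simp add: e0_def eA_def eM_def bethe_def sum_subtractf sum.distrib sum_distrib_left algebra_simps)
  finally have eq: "ln (card (edge_labelings V M) / fact n ^ CARD('r)) -
       n * bethe P (\<lambda>p. count A p / n) (\<lambda>i z. count (M i) z / n) = (1 - ?r) * e0 + (2 * ?r - 1) * eA - (\<Sum>i\<in>UNIV. eM i)"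
    by simp
  have b1: "(1 - ?r) * e0 \<le> 0" "- (?r * ?L) \<le> (1 - ?r) * e0"
  proof -
    show "(1 - ?r) * e0 \<le> 0" using r1 e0 by (simp add: mult_nonpos_nonneg)
    have "(?r - 1) * e0 \<le> ?r * ?L" using r1 e0 by (intro mult_mono) auto
    then show "- (?r * ?L) \<le> (1 - ?r) * e0" by (simp add: algebra_simps)
  qed
  have b2: "0 \<le> (2 * ?r - 1) * eA" "(2 * ?r - 1) * eA \<le> 2 * ?r * (card P * ?L)"
  proof -
    have "0 \<le> 2 * ?r - 1" using r1 by linarith
    then show "0 \<le> (2 * ?r - 1) * eA" using eA(1) by (rule mult_nonneg_nonneg)
    show "(2 * ?r - 1) * eA \<le> 2 * ?r * (card P * ?L)" using eA by (intro mult_mono) auto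
  qed
  have b3: "0 \<le> (\<Sum>i\<in>UNIV. eM i)" "(\<Sum>i\<in>UNIV. eM i) \<le> ?r * (real (card P) ^ 2 * ?L)"
    using eM sum_bounded_above[of "UNIV :: 'r set" eM "real (card P) ^ 2 * ?L"] by (auto intro: sum_nonneg)
  have "?r * (1 + real (card P)) ^ 2 * ?L = ?r * ?L + 2 * ?r * (card P * ?L) + ?r * (real (card P) ^ 2 * ?L)"
    by (simp add: power2_eq_square algebra_simps)
  moreover have "0 \<le> ?r * ?L" "0 \<le> 2 * ?r * (card P * ?L)" "0 \<le> ?r * (real (card P) ^ 2 * ?L)"
    using r1 L0 by (auto intro!: mult_nonneg_nonneg)
  ultimately show "\<bar>ln (card (edge_labelings V M) / fact n ^ CARD('r)) -
       n * bethe P (\<lambda>p. count A p / n) (\<lambda>i z. count (M i) z / n)\<bar> \<le> ?r * (1 + real (card P)) ^ 2 * ?L"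
    unfolding eq using b1 b2 b3 by (simp only: abs_le_iff) linarith
qed

lemma card_multisets_of_size:
  assumes "finite Q"
  shows "finite {M. set_mset M \<subseteq> Q \<and> size M = n}" "card {M. set_mset M \<subseteq> Q \<and> size M = n} \<le> (n + 1) ^ card Q"
proof -
  let ?S = "{M. set_mset M \<subseteq> Q \<and> size M = n}"
  have inj: "inj_on (\<lambda>M. restrict (count M) Q) ?S"
  proof (rule inj_onI)
    fix M N assume MN: "M \<in> ?S" "N \<in> ?S" "restrict (count M) Q = restrict (count N) Q"
    show "M = N"
    proof (rule multiset_eqI)
      fix x show "count M x = count N x"
        using MN by (cases "x \<in> Q") (metis restrict_apply', metis (mono_tags, lifting) mem_Collect_eq not_in_iff subsetD)
    qed
  qed
  have im: "(\<lambda>M. restrict (count M) Q) ` ?S \<subseteq> Q \<rightarrow>\<^sub>E {..n}"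
    using count_le_size by auto
  have fin: "finite (Q \<rightarrow>\<^sub>E {..n})" using assms by (intro finite_PiE) auto
  show "finite ?S" using finite_imageD[OF finite_subset[OF im fin] inj] .
  have "card ?S \<le> card (Q \<rightarrow>\<^sub>E {..n})" by (rule card_inj_on_le[OF inj im fin])
  then show "card ?S \<le> (n + 1) ^ card Q" using assms by (simp add: card_PiE)
qed

lemma xlnx_uniform:
  assumes "d > 0"
  obtains e where "e > 0" "\<And>x y. x \<in> {0..1} \<Longrightarrow> y \<in> {0..1} \<Longrightarrow> \<bar>x - y\<bar> < e \<Longrightarrow> \<bar>xlnx x - xlnx y\<bar> < d"
proof -
  have "continuous_on {0..1} xlnx"
    unfolding continuous_on_def
  proof
    fix x :: real assume x: "x \<in> {0..1}"
    show "(xlnx \<longlongrightarrow> xlnx x) (at x within {0..1})"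
    proof (cases "x = 0")
      case True
      have "((\<lambda>x::real. x * ln x) \<longlongrightarrow> 0) (at_right 0)" by real_asymp
      then have "(xlnx \<longlongrightarrow> 0) (at 0 within {0<..1})"
        unfolding xlnx_def[abs_def] by (rule tendsto_within_subset) auto
      moreover have "at 0 within {0..1} = at (0 :: real) within {0<..1}"
        unfolding at_within_def by (rule arg_cong[where f = "\<lambda>S. inf (nhds 0) (principal S)"]) auto
      ultimately show ?thesis using True by (simp add: xlnx_def)
    next
      case False
      then have "isCont xlnx x" unfolding xlnx_def[abs_def] by (intro continuous_intros) auto
      then show ?thesis unfolding isCont_def by (rule tendsto_within_subset) auto
    qed
  qed
  then have "uniformly_continuous_on {0..1} xlnx"
    by (rule compact_uniformly_continuous) simp
  then show thesis
    using that assms unfolding uniformly_continuous_on_def dist_real_def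
    by (metis abs_minus_commute)
qed

lemma bethe_continuous:
  fixes w :: "'r::finite \<Rightarrow> 'c \<times> 'c \<Rightarrow> real"
  assumes P: "finite P" and d: "d > 0"
    and a: "\<And>p. p \<in> P \<Longrightarrow> a p \<in> {0..1}" and w: "\<And>i z. z \<in> P \<times> P \<Longrightarrow> w i z \<in> {0..1}"
  obtains e where "e > 0"
    "\<And>a' w'. (\<And>p. p \<in> P \<Longrightarrow> a' p \<in> {0..1} \<and> \<bar>a' p - a p\<bar> < e) \<Longrightarrow>
      (\<And>i z. z \<in> P \<times> P \<Longrightarrow> w' i z \<in> {0..1} \<and> \<bar>w' i z - w i z\<bar> < e) \<Longrightarrow>
      \<bar>bethe P a' w' - bethe P a w\<bar> \<le> d"
proof -
  let ?r = "real CARD('r)"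
  let ?K = "(2 * ?r - 1) * real (card P) + ?r * real (card (P \<times> P))"
  have r1: "?r \<ge> 1" by (rule card_real_ge_1)
  then have r2: "0 \<le> 2 * ?r - 1" by linarith
  then have K: "?K \<ge> 0" by (intro add_nonneg_nonneg mult_nonneg_nonneg) auto
  define d' where "d' = d / (?K + 1)"
  have d': "d' > 0" "?K * d' \<le> d" using d K by (auto simp: d'_def field_simps)
  obtain e where e: "e > 0" "\<And>x y. x \<in> {0..1} \<Longrightarrow> y \<in> {0..1} \<Longrightarrow> \<bar>x - y\<bar> < e \<Longrightarrow> \<bar>xlnx x - xlnx y\<bar> < d'"
    using xlnx_uniform[OF d'(1)] by blast
  show thesis
  proof (rule that[OF e(1)])
    fix a' w'
    assume a': "\<And>p. p \<in> P \<Longrightarrow> a' p \<in> {0..1} \<and> \<bar>a' p - a p\<bar> < e"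
      and w': "\<And>i z. z \<in> P \<times> P \<Longrightarrow> w' i z \<in> {0..1} \<and> \<bar>w' i z - w i z\<bar> < e"
    have 1: "\<bar>\<Sum>p\<in>P. xlnx (a' p) - xlnx (a p)\<bar> \<le> card P * d'"
      using e(2) a a' by (intro order_trans[OF sum_abs] sum_bounded_above) (simp add: less_imp_le)
    have 2: "\<bar>\<Sum>z\<in>P \<times> P. xlnx (w' i z) - xlnx (w i z)\<bar> \<le> card (P \<times> P) * d'" for i
      using e(2) w w' by (intro order_trans[OF sum_abs] sum_bounded_above) (simp add: less_imp_le)
    have 3: "\<bar>\<Sum>i\<in>UNIV. \<Sum>z\<in>P \<times> P. xlnx (w' i z) - xlnx (w i z)\<bar> \<le> ?r * (card (P \<times> P) * d')"
      by (rule order_trans[OF sum_abs sum_bounded_above]) (rule 2)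
    have "bethe P a' w' - bethe P a w = (2 * ?r - 1) * (\<Sum>p\<in>P. xlnx (a' p) - xlnx (a p))
        - (\<Sum>i\<in>UNIV. \<Sum>z\<in>P \<times> P. xlnx (w' i z) - xlnx (w i z))"
      by (simp add: bethe_def sum_subtractf algebra_simps)
    moreover have "\<bar>(2 * ?r - 1) * (\<Sum>p\<in>P. xlnx (a' p) - xlnx (a p))\<bar> \<le> (2 * ?r - 1) * (card P * d')"
      using mult_left_mono[OF 1 r2] unfolding abs_mult abs_of_nonneg[OF r2] .
    ultimately have "\<bar>bethe P a' w' - bethe P a w\<bar> \<le> ?K * d'"
      using 3 by (simp add: algebra_simps)
    then show "\<bar>bethe P a' w' - bethe P a w\<bar> \<le> d" using d'(2) by linarith
  qed
qed

lemma hom_tuples_bij: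
  "bij_betw (\<lambda>\<sigma> i. \<sigma> (gen i)) (hom (free_group :: 'r::finite free_word monoid) (sym_group n))
    {t. \<forall>i. t i permutes {1..n}}"
proof -
  have "(UNIV \<rightarrow> carrier (sym_group n)) = {t :: 'r \<Rightarrow> nat \<Rightarrow> nat. \<forall>i. t i permutes {1..n}}"
    by (auto simp: sym_group_def)
  then show ?thesis using free_group_universal[OF sym_group_is_group[of n], where 'r = 'r] by simp
qed

lemma card_hom_sym_group:
  "card (hom (free_group :: 'r::finite free_word monoid) (sym_group n)) = fact n ^ CARD('r)"
proof -
  have "{t :: 'r \<Rightarrow> nat \<Rightarrow> nat. \<forall>i. t i permutes {1..n}} = PiE UNIV (\<lambda>_. {p. p permutes {1..n}})"
    by (auto simp: PiE_UNIV_domain)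
  moreover have c: "card {p. p permutes {1..n}} = fact n" by (rule card_permutations) auto
  ultimately have "card {t :: 'r \<Rightarrow> nat \<Rightarrow> nat. \<forall>i. t i permutes {1..n}} = fact n ^ CARD('r)"
    by (simp add: card_PiE c del: One_nat_def)
  then show ?thesis using bij_betw_same_card[OF hom_tuples_bij[of n, where 'r = 'r]] by simp
qed

lemma expectation_uniform_hom:
  "measure_pmf.expectation (uniform_hom n :: ('r::finite free_word \<Rightarrow> nat \<Rightarrow> nat) pmf) \<phi> =
    (\<Sum>\<sigma>\<in>hom free_group (sym_group n). \<phi> \<sigma>) / fact n ^ CARD('r)" for \<phi> :: "_ \<Rightarrow> real"
  unfolding uniform_hom_def
  by (subst integral_pmf_of_set[OF hom_sym_group_nonempty finite_hom_sym_group])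
     (simp add: card_hom_sym_group)

section \<open>Concentration on tuples of permutations\<close>


definition avg :: "'b set \<Rightarrow> ('b \<Rightarrow> real) \<Rightarrow> real" where
  "avg S \<phi> = (\<Sum>x\<in>S. \<phi> x) / card S"

definition subgaussian :: "'b set \<Rightarrow> ('b \<Rightarrow> real) \<Rightarrow> real \<Rightarrow> bool" where
  "subgaussian S \<phi> K \<longleftrightarrow> (\<forall>s>0. avg S (\<lambda>x. exp (s * (\<phi> x - avg S \<phi>))) \<le> exp (s\<^sup>2 * K))"

lemma avg_reindex: "bij_betw g T S \<Longrightarrow> avg S \<phi> = avg T (\<lambda>t. \<phi> (g t))"
  unfolding avg_def by (simp add: sum.reindex_bij_betw bij_betw_same_card)

lemma avg_Times: "avg (B \<times> T) \<phi> = avg B (\<lambda>b. avg T (\<lambda>t. \<phi> (b, t)))"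
  unfolding avg_def by (simp add: card_cartesian_product sum.cartesian_product sum_divide_distrib[symmetric] mult.commute)

lemma avg_mono: "(\<And>x. x \<in> S \<Longrightarrow> \<phi> x \<le> \<psi> x) \<Longrightarrow> avg S \<phi> \<le> avg S \<psi>"
  unfolding avg_def by (intro divide_right_mono sum_mono) auto

lemma avg_cmult: "avg S (\<lambda>x. c * \<phi> x) = c * avg S \<phi>"
  unfolding avg_def by (simp add: sum_distrib_left)

lemma avg_diff: "avg S (\<lambda>x. \<phi> x - \<psi> x) = avg S \<phi> - avg S \<psi>"
  unfolding avg_def by (simp add: sum_subtractf diff_divide_distrib)

lemma avg_const: "finite S \<Longrightarrow> S \<noteq> {} \<Longrightarrow> avg S (\<lambda>_. c) = c"
  unfolding avg_def by simp

lemma avg_diff_abs_le: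
  assumes "finite S" "S \<noteq> {}" "\<And>x. x \<in> S \<Longrightarrow> \<bar>\<phi> x - \<psi> x\<bar> \<le> c"
  shows "\<bar>avg S \<phi> - avg S \<psi>\<bar> \<le> c"
proof -
  have "avg S (\<lambda>x. \<phi> x - \<psi> x) \<le> avg S (\<lambda>_. c)" "avg S (\<lambda>_. - c) \<le> avg S (\<lambda>x. \<phi> x - \<psi> x)"
    by (intro avg_mono; use assms(3) in force)+
  then show ?thesis using assms(1,2) by (simp add: avg_const avg_diff)
qed

lemma subgaussian_reindex:
  "bij_betw g T S \<Longrightarrow> subgaussian S \<phi> K \<longleftrightarrow> subgaussian T (\<lambda>t. \<phi> (g t)) K"
  unfolding subgaussian_def by (simp add: avg_reindex[of g T S])

lemma avg_pmf_of_set: "finite S \<Longrightarrow> S \<noteq> {} \<Longrightarrow> avg S \<phi> = measure_pmf.expectation (pmf_of_set S) \<phi>"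
  by (simp add: avg_def integral_pmf_of_set)

lemma subgaussian_bounded:
  assumes S: "finite S" "S \<noteq> {}" and d: "\<And>x y. x \<in> S \<Longrightarrow> y \<in> S \<Longrightarrow> \<bar>\<phi> x - \<phi> y\<bar> \<le> d"
  shows "subgaussian S \<phi> (d\<^sup>2 / 8)"
  unfolding subgaussian_def
proof (intro allI impI)
  fix s :: real assume s: "s > 0"
  define a where "a = Min (\<phi> ` S)"
  have a: "a \<le> \<phi> x" "\<phi> x \<le> a + d" if "x \<in> S" for x
  proof -
    show "a \<le> \<phi> x" unfolding a_def using S that by simp
    have "a \<in> \<phi> ` S" unfolding a_def using S by (intro Min_in) auto
    then show "\<phi> x \<le> a + d" using d that by fastforce
  qed
  define m where "m = avg S \<phi>"
  have "interval_bounded_random_variable (measure_pmf (pmf_of_set S)) (\<lambda>x. \<phi> x - m) (a - m) (a + d - m)"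
    by unfold_locales (use a S in \<open>auto simp: AE_measure_pmf_iff\<close>)
  moreover have "measure_pmf.expectation (pmf_of_set S) (\<lambda>x. \<phi> x - m) = 0"
    using S avg_pmf_of_set[OF S, of "\<lambda>x. \<phi> x - m"] by (simp add: avg_diff avg_const m_def)
  ultimately have "(\<integral>\<^sup>+x. ennreal (exp (s * (\<phi> x - m))) \<partial>pmf_of_set S) \<le> ennreal (exp (s\<^sup>2 * (a + d - m - (a - m))\<^sup>2 / 8))"
    by (intro interval_bounded_random_variable.Hoeffdings_lemma_nn_integral_0[OF _ s])
  also have "(\<integral>\<^sup>+x. ennreal (exp (s * (\<phi> x - m))) \<partial>pmf_of_set S) =
      ennreal (\<integral>x. exp (s * (\<phi> x - m)) \<partial>pmf_of_set S)"
    using S by (intro nn_integral_eq_integral integrable_measure_pmf_finite) auto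
  finally have "avg S (\<lambda>x. exp (s * (\<phi> x - m))) \<le> exp (s\<^sup>2 * (a + d - m - (a - m))\<^sup>2 / 8)"
    using S by (simp add: avg_pmf_of_set)
  then show "avg S (\<lambda>x. exp (s * (\<phi> x - avg S \<phi>))) \<le> exp (s\<^sup>2 * (d\<^sup>2 / 8))"
    by (simp add: m_def)
qed

lemma subgaussian_Times:
  assumes inner: "\<And>b. b \<in> B \<Longrightarrow> subgaussian T (\<lambda>t. \<phi> (b, t)) K2"
    and outer: "subgaussian B (\<lambda>b. avg T (\<lambda>t. \<phi> (b, t))) K1"
  shows "subgaussian (B \<times> T) \<phi> (K1 + K2)"
  unfolding subgaussian_def
proof (intro allI impI)
  fix s :: real assume s: "s > 0"
  define m where "m = avg (B \<times> T) \<phi>"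
  define mb where "mb b = avg T (\<lambda>t. \<phi> (b, t))" for b
  have m: "m = avg B mb" by (simp add: m_def mb_def[abs_def] avg_Times)
  have "avg (B \<times> T) (\<lambda>x. exp (s * (\<phi> x - m)))
      = avg B (\<lambda>b. exp (s * (mb b - m)) * avg T (\<lambda>t. exp (s * (\<phi> (b, t) - mb b))))"
    by (simp add: avg_Times avg_cmult[symmetric] exp_add[symmetric] algebra_simps)
  also have "\<dots> \<le> avg B (\<lambda>b. exp (s * (mb b - m)) * exp (s\<^sup>2 * K2))"
    using inner s unfolding subgaussian_def mb_def by (intro avg_mono mult_left_mono) auto
  also have "\<dots> = exp (s\<^sup>2 * K2) * avg B (\<lambda>b. exp (s * (mb b - m)))"
    unfolding avg_cmult[symmetric] by (simp add: mult.commute)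
  also have "\<dots> \<le> exp (s\<^sup>2 * K2) * exp (s\<^sup>2 * K1)"
    using outer s unfolding subgaussian_def m mb_def[abs_def] by (intro mult_left_mono) auto
  also have "\<dots> = exp (s\<^sup>2 * (K1 + K2))" by (simp add: exp_add[symmetric] algebra_simps)
  finally show "avg (B \<times> T) (\<lambda>x. exp (s * (\<phi> x - avg (B \<times> T) \<phi>))) \<le> exp (s\<^sup>2 * (K1 + K2))"
    by (simp add: m_def)
qed

lemma transpose_comp_conj:
  assumes "\<tau> permutes V"
  shows "Transposition.transpose x y \<circ> \<tau> = \<tau> \<circ> Transposition.transpose (inv_into UNIV \<tau> x) (inv_into UNIV \<tau> y)"
proof
  fix z
  have "\<tau> z = x \<longleftrightarrow> z = inv_into UNIV \<tau> x" "\<tau> z = y \<longleftrightarrow> z = inv_into UNIV \<tau> y"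
    using permutes_inverses[OF assms] by metis+
  then show "(Transposition.transpose x y \<circ> \<tau>) z = (\<tau> \<circ> Transposition.transpose (inv_into UNIV \<tau> x) (inv_into UNIV \<tau> y)) z"
    using permutes_inverses[OF assms] by (simp add: Transposition.transpose_def)
qed

lemma bij_betw_permutes_insert:
  assumes "a \<notin> V"
  shows "bij_betw (\<lambda>(b, p). Transposition.transpose a b \<circ> p) (insert a V \<times> {p. p permutes V}) {p. p permutes insert a V}"
  unfolding bij_betw_def
proof
  show "inj_on (\<lambda>(b, p). Transposition.transpose a b \<circ> p) (insert a V \<times> {p. p permutes V})"
  proof (rule inj_onI, unfold split_paired_all)
    fix b p c q
    assume "(b, p) \<in> insert a V \<times> {p. p permutes V}" "(c, q) \<in> insert a V \<times> {p. p permutes V}"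
      and "(case (b, p) of (b, p) \<Rightarrow> Transposition.transpose a b \<circ> p) = (case (c, q) of (b, p) \<Rightarrow> Transposition.transpose a b \<circ> p)"
    then have p: "p permutes V" and q: "q permutes V"
      and eq: "Transposition.transpose a b \<circ> p = Transposition.transpose a c \<circ> q"
      by auto
    have "p a = a" "q a = a" using assms p q by (auto simp: permutes_def)
    then have bc: "b = c" using fun_cong[OF eq, of a] by simp
    have "Transposition.transpose a b \<circ> (Transposition.transpose a b \<circ> p) = Transposition.transpose a b \<circ> (Transposition.transpose a c \<circ> q)" using eq by simp
    then have "p = q" unfolding bc by (simp add: o_assoc)
    then show "(b, p) = (c, q)" using bc by simp
  qed
  have "insert a V \<times> {p. p permutes V} = {(b, p). b \<in> insert a V \<and> p \<in> {p. p permutes V}}" by auto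
  then show "(\<lambda>(b, p). Transposition.transpose a b \<circ> p) ` (insert a V \<times> {p. p permutes V}) = {p. p permutes insert a V}"
    by (simp only: permutes_insert)
qed

text \<open>The image of a point is exposed first; two choices for it are two transpositions apart, so the
  conditional means lie in an interval of length \<open>2 c\<close>, to which Hoeffding's lemma applies.\<close>

lemma subgaussian_permutes:
  assumes "finite V"
    and "\<And>\<tau> u w. \<tau> permutes V \<Longrightarrow> u \<in> V \<Longrightarrow> w \<in> V \<Longrightarrow> \<bar>\<phi> (\<tau> \<circ> Transposition.transpose u w) - \<phi> \<tau>\<bar> \<le> c"
  shows "subgaussian {\<tau>. \<tau> permutes V} \<phi> (real (card V) * (c\<^sup>2 / 2))"
  using assms
proof (induction V arbitrary: \<phi> rule: finite_induct)
  case empty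
  then show ?case by (simp add: subgaussian_def avg_def)
next
  case (insert a V)
  let ?P = "{p. p permutes V}"
  have P: "finite ?P" "?P \<noteq> {}"
    using finite_permutations[OF insert.hyps(1)] permutes_id[of V] by blast+
  have sub: "p permutes insert a V" if "p permutes V" for p
    using that by (rule permutes_subset) auto
  have tr: "Transposition.transpose a b \<circ> p permutes insert a V" if "p permutes V" "b \<in> insert a V" for p b
    using that by (intro permutes_compose[OF sub] permutes_swap_id) auto
  have left: "\<bar>\<phi> (Transposition.transpose a b \<circ> p) - \<phi> p\<bar> \<le> c" if "p permutes V" "b \<in> insert a V" for p b
  proof -
    have "inv_into UNIV p a \<in> insert a V" "inv_into UNIV p b \<in> insert a V"
      using permutes_in_image[OF permutes_inv[OF sub[OF that(1)]]] that(2) by auto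
    then show ?thesis
      unfolding transpose_comp_conj[OF that(1)] by (rule insert.prems[OF sub[OF that(1)]])
  qed
  have "subgaussian (insert a V \<times> ?P) (\<lambda>x. \<phi> ((\<lambda>(b, p). Transposition.transpose a b \<circ> p) x)) ((2 * c)\<^sup>2 / 8 + real (card V) * (c\<^sup>2 / 2))"
  proof (rule subgaussian_Times)
    fix b assume b: "b \<in> insert a V"
    show "subgaussian ?P (\<lambda>t. \<phi> ((\<lambda>(b, p). Transposition.transpose a b \<circ> p) (b, t))) (real (card V) * (c\<^sup>2 / 2))"
    proof (rule insert.IH)
      fix \<tau> u w assume "\<tau> permutes V" "u \<in> V" "w \<in> V"
      then show "\<bar>\<phi> ((\<lambda>(b, p). Transposition.transpose a b \<circ> p) (b, \<tau> \<circ> Transposition.transpose u w)) - \<phi> ((\<lambda>(b, p). Transposition.transpose a b \<circ> p) (b, \<tau>))\<bar> \<le> c"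
        using insert.prems[OF tr[OF _ b], of \<tau> u w] by (simp only: prod.case comp_assoc insertI2)
    qed
  next
    show "subgaussian (insert a V) (\<lambda>b. avg ?P (\<lambda>t. \<phi> ((\<lambda>(b, p). Transposition.transpose a b \<circ> p) (b, t)))) ((2 * c)\<^sup>2 / 8)"
    proof (rule subgaussian_bounded)
      fix x y assume xy: "x \<in> insert a V" "y \<in> insert a V"
      show "\<bar>avg ?P (\<lambda>t. \<phi> ((\<lambda>(b, p). Transposition.transpose a b \<circ> p) (x, t))) - avg ?P (\<lambda>t. \<phi> ((\<lambda>(b, p). Transposition.transpose a b \<circ> p) (y, t)))\<bar> \<le> 2 * c"
      proof (rule avg_diff_abs_le[OF P])
        fix p assume "p \<in> ?P"
        then show "\<bar>\<phi> ((\<lambda>(b, p). Transposition.transpose a b \<circ> p) (x, p)) - \<phi> ((\<lambda>(b, p). Transposition.transpose a b \<circ> p) (y, p))\<bar> \<le> 2 * c"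
          using left[of p x] left[of p y] xy by simp
      qed
    qed (use insert.hyps in auto)
  qed
  then have "subgaussian {p. p permutes insert a V} \<phi> ((2 * c)\<^sup>2 / 8 + real (card V) * (c\<^sup>2 / 2))"
    using subgaussian_reindex[OF bij_betw_permutes_insert[OF insert.hyps(2)], of \<phi>] by simp
  moreover have "(2 * c)\<^sup>2 / 8 + real (card V) * (c\<^sup>2 / 2) = real (card (insert a V)) * (c\<^sup>2 / 2)"
    using insert.hyps by (simp add: power_mult_distrib algebra_simps)
  ultimately show ?case by (simp only:)
qed

lemma bij_betw_PiE_insert:
  assumes "j \<notin> I"
  shows "bij_betw (\<lambda>(y, f). f(j := y)) (P \<times> (I \<rightarrow>\<^sub>E P)) (insert j I \<rightarrow>\<^sub>E P)"
  unfolding bij_betw_def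
proof
  show "inj_on (\<lambda>(y, f). f(j := y)) (P \<times> (I \<rightarrow>\<^sub>E P))"
    using inj_combinator[OF assms, of "\<lambda>_. P"] by simp
  show "(\<lambda>(y, f). f(j := y)) ` (P \<times> (I \<rightarrow>\<^sub>E P)) = (insert j I \<rightarrow>\<^sub>E P)"
    by (simp add: PiE_insert_eq)
qed

lemma subgaussian_tuples:
  fixes \<phi> :: "('i \<Rightarrow> 'v \<Rightarrow> 'v) \<Rightarrow> real"
  assumes "finite I" and V: "finite V"
    and "\<And>f i u w. f \<in> I \<rightarrow>\<^sub>E {\<tau>. \<tau> permutes V} \<Longrightarrow> i \<in> I \<Longrightarrow> u \<in> V \<Longrightarrow> w \<in> V \<Longrightarrow>
      \<bar>\<phi> (f(i := f i \<circ> Transposition.transpose u w)) - \<phi> f\<bar> \<le> c"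
  shows "subgaussian (I \<rightarrow>\<^sub>E {\<tau>. \<tau> permutes V}) \<phi> (real (card I) * (real (card V) * (c\<^sup>2 / 2)))"
  using assms(1,3)
proof (induction I arbitrary: \<phi> rule: finite_induct)
  case empty
  then show ?case by (simp add: subgaussian_def avg_def)
next
  case (insert j I)
  let ?P = "{\<tau>. \<tau> permutes V}" and ?K = "real (card V) * (c\<^sup>2 / 2)"
  let ?g = "\<lambda>(y, f). f(j := y)"
  have P: "finite ?P" "?P \<noteq> {}"
    using finite_permutations[OF V] permutes_id[of V] by blast+
  have T: "finite (I \<rightarrow>\<^sub>E ?P)" "(I \<rightarrow>\<^sub>E ?P) \<noteq> {}"
    using P insert.hyps by (auto intro!: finite_PiE simp: PiE_eq_empty_iff)
  have up: "f(j := y) \<in> insert j I \<rightarrow>\<^sub>E ?P" if "f \<in> I \<rightarrow>\<^sub>E ?P" "y \<in> ?P" for f y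
    using that by (intro PiE_fun_upd)
  have "subgaussian (?P \<times> (I \<rightarrow>\<^sub>E ?P)) (\<lambda>x. \<phi> (?g x)) (?K + real (card I) * ?K)"
  proof (rule subgaussian_Times)
    fix y assume y: "y \<in> ?P"
    show "subgaussian (I \<rightarrow>\<^sub>E ?P) (\<lambda>f. \<phi> (?g (y, f))) (real (card I) * ?K)"
    proof (rule insert.IH)
      fix f i u w assume f: "f \<in> I \<rightarrow>\<^sub>E ?P" and i: "i \<in> I" and uw: "u \<in> V" "w \<in> V"
      have ij: "i \<noteq> j" using i insert.hyps by auto
      show "\<bar>\<phi> (?g (y, f(i := f i \<circ> Transposition.transpose u w))) - \<phi> (?g (y, f))\<bar> \<le> c"
      proof -
        have "f(i := f i \<circ> Transposition.transpose u w, j := y) = f(j := y, i := (f(j := y)) i \<circ> Transposition.transpose u w)"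
          using ij by auto
        then show ?thesis unfolding prod.case
          using insert.prems[OF up[OF f y] insertI2[OF i] uw] by (simp only:)
      qed
    qed
  next
    show "subgaussian ?P (\<lambda>y. avg (I \<rightarrow>\<^sub>E ?P) (\<lambda>f. \<phi> (?g (y, f)))) ?K"
    proof (rule subgaussian_permutes[OF V], rule avg_diff_abs_le[OF T])
      fix \<tau> u w f assume \<tau>: "\<tau> permutes V" and uw: "u \<in> V" "w \<in> V" and f: "f \<in> I \<rightarrow>\<^sub>E ?P"
      have eq: "f(j := \<tau> \<circ> Transposition.transpose u w) = f(j := \<tau>, j := (f(j := \<tau>)) j \<circ> Transposition.transpose u w)"
        by simp
      have "\<tau> \<in> ?P" using \<tau> by simp
      from insert.prems[OF up[OF f this] insertI1 uw]
      show "\<bar>\<phi> (?g (\<tau> \<circ> Transposition.transpose u w, f)) - \<phi> (?g (\<tau>, f))\<bar> \<le> c"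
        unfolding prod.case eq .
    qed
  qed
  then have "subgaussian (insert j I \<rightarrow>\<^sub>E ?P) \<phi> (?K + real (card I) * ?K)"
    using subgaussian_reindex[OF bij_betw_PiE_insert[OF insert.hyps(2)], where P1 = ?P, of \<phi>] by simp
  moreover have "?K + real (card I) * ?K = real (card (insert j I)) * ?K"
    using insert.hyps by (simp add: algebra_simps)
  ultimately show ?case by (simp only:)
qed

lemma subgaussian_tail:
  assumes S: "finite S" "S \<noteq> {}" and K: "K > 0" and t: "t > 0" and sg: "subgaussian S \<phi> K"
  shows "real (card {x \<in> S. avg S \<phi> + t \<le> \<phi> x}) / card S \<le> exp (- (t\<^sup>2 / (4 * K)))"
proof -
  define s where "s = t / (2 * K)"
  have s: "s > 0" using t K by (simp add: s_def)
  let ?A = "{x \<in> S. avg S \<phi> + t \<le> \<phi> x}"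
  have "exp (s * t) * (real (card ?A) / card S) = (\<Sum>x\<in>?A. exp (s * t)) / card S" by simp
  also have "\<dots> \<le> (\<Sum>x\<in>?A. exp (s * (\<phi> x - avg S \<phi>))) / card S"
    using s by (intro divide_right_mono sum_mono) (auto intro!: mult_left_mono)
  also have "\<dots> \<le> avg S (\<lambda>x. exp (s * (\<phi> x - avg S \<phi>)))"
    unfolding avg_def using S by (intro divide_right_mono sum_mono2) auto
  also have "\<dots> \<le> exp (s\<^sup>2 * K)" using sg s unfolding subgaussian_def by blast
  finally have "real (card ?A) / card S \<le> exp (s\<^sup>2 * K) / exp (s * t)"
    by (simp add: field_simps)
  also have "\<dots> = exp (s\<^sup>2 * K - s * t)" by (simp add: exp_diff)
  also have "s\<^sup>2 * K - s * t = - (t\<^sup>2 / (4 * K))"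
    using K by (simp add: s_def power2_eq_square field_simps)
  finally show ?thesis .
qed

lemma subgaussian_hom_sym_group:
  fixes \<phi> :: "('r::finite free_word \<Rightarrow> nat \<Rightarrow> nat) \<Rightarrow> real"
  assumes lip: "\<And>\<sigma> \<sigma>' i u w. \<sigma> \<in> hom free_group (sym_group n) \<Longrightarrow> \<sigma>' \<in> hom free_group (sym_group n) \<Longrightarrow>
      u \<in> {1..n} \<Longrightarrow> w \<in> {1..n} \<Longrightarrow> \<sigma>' (gen i) = \<sigma> (gen i) \<circ> Transposition.transpose u w \<Longrightarrow>
      (\<And>j. j \<noteq> i \<Longrightarrow> \<sigma>' (gen j) = \<sigma> (gen j)) \<Longrightarrow> \<bar>\<phi> \<sigma>' - \<phi> \<sigma>\<bar> \<le> c"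
  shows "subgaussian (hom free_group (sym_group n)) \<phi> (real CARD('r) * (real n * (c\<^sup>2 / 2)))"
proof -
  let ?H = "hom (free_group :: 'r free_word monoid) (sym_group n)" and ?P = "{p. p permutes {1..n}}"
  let ?b = "\<lambda>\<sigma> i. \<sigma> (gen i) :: nat \<Rightarrow> nat" and ?T = "(UNIV :: 'r set) \<rightarrow>\<^sub>E {p. p permutes {1..n}}"
  have b: "bij_betw ?b ?H ?T"
    using free_group_universal[OF sym_group_is_group[of n], where 'r = 'r] by (simp add: sym_group_def PiE_UNIV_domain)
  define h where "h = inv_into ?H ?b"
  have h: "bij_betw h ?T ?H" unfolding h_def by (rule bij_betw_inv_into[OF b])
  have hb: "h t (gen i) = t i" if "t \<in> ?T" for t i
  proof -
    have "?b (h t) = t" unfolding h_def by (rule bij_betw_inv_into_right[OF b that])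
    from fun_cong[OF this, of i] show ?thesis .
  qed
  have hH: "h t \<in> ?H" if "t \<in> ?T" for t using h that by (rule bij_betwE[rule_format])
  have "subgaussian ?T (\<lambda>t. \<phi> (h t)) (real CARD('r) * (real (card {1..n}) * (c\<^sup>2 / 2)))"
  proof (rule subgaussian_tuples)
    fix f i u w assume f: "f \<in> ?T" and u: "u \<in> {1..n}" "w \<in> {1..n}"
    have "f i \<circ> Transposition.transpose u w permutes {1..n}"
      using f u by (intro permutes_compose permutes_swap_id) auto
    then have f': "f(i := f i \<circ> Transposition.transpose u w) \<in> ?T" using f by auto
    show "\<bar>\<phi> (h (f(i := f i \<circ> Transposition.transpose u w))) - \<phi> (h f)\<bar> \<le> c"
      by (rule lip[OF hH[OF f] hH[OF f'] u, of i]) (auto simp: hb[OF f] hb[OF f'])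
  qed auto
  then show ?thesis using subgaussian_reindex[OF h, of \<phi>] by simp
qed

section \<open>Block codes and the expected number of microstates\<close>


abbreviation sym_homs :: "nat \<Rightarrow> ('r free_word \<Rightarrow> nat \<Rightarrow> nat) set" where
  "sym_homs n \<equiv> hom free_group (sym_group n)"

lemma sym_homsD:
  assumes "\<sigma> \<in> sym_homs n"
  shows "\<sigma> g permutes {1..n}" "\<sigma> (g \<otimes>\<^bsub>free_group\<^esub> h) v = \<sigma> g (\<sigma> h v)"
    "\<sigma> \<one>\<^bsub>free_group\<^esub> = id"
proof -
  interpret group_hom free_group "sym_group n" \<sigma>
    using assms group_free_group sym_group_is_group by (intro group_hom.intro group_hom_axioms.intro)
  show "\<sigma> g permutes {1..n}" using hom_closed[of g] by (simp add: sym_group_def)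
  show "\<sigma> (g \<otimes>\<^bsub>free_group\<^esub> h) v = \<sigma> g (\<sigma> h v)" using hom_mult[of g h] by (simp add: sym_group_def)
  show "\<sigma> \<one>\<^bsub>free_group\<^esub> = id" using hom_one by (simp add: sym_group_def)
qed

lemma pullback_shift:
  "\<sigma> \<in> sym_homs n \<Longrightarrow> shift g (pullback \<sigma> x v) = pullback \<sigma> x (\<sigma> g v)"
  by (auto simp: shift_def pullback_def sym_homsD fun_eq_iff)

lemma length_foldr_push: "length (foldr push u w) \<le> length u + length w"
proof (induction u)
  case (Cons a u)
  have "length (push a v) \<le> Suc (length v)" for v by (cases v) auto
  from this[of "foldr push u w"] Cons show ?case by simp
qed simp

lemma word_length_mult_le:
  "word_length (g \<otimes>\<^bsub>free_group\<^esub> h) \<le> word_length g + word_length h"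
  unfolding word_length_def Rep_mult by (rule length_foldr_push)

lemma word_length_gen [simp]: "word_length (gen i) = 1"
  by (simp add: word_length_def gen_def Rep_Abs)

lemma word_length_eq_0: "word_length g = 0 \<Longrightarrow> g = \<one>\<^bsub>free_group\<^esub>"
  by (simp add: word_length_def Rep_free_word_inject[symmetric] Rep_one)

lemma reduced_appendD1: "reduced_word (u @ v) \<Longrightarrow> reduced_word u"
  by (simp add: reduced_word_def successively_append_iff)

lemma word_length_step:
  assumes "word_length h = Suc l"
  obtains h' i where "word_length h' = l" "h = h' \<otimes>\<^bsub>free_group\<^esub> gen i \<or> h' = h \<otimes>\<^bsub>free_group\<^esub> gen i"
proof -
  obtain w a where w: "Rep_free_word h = w @ [a]" "length w = l"
    using assms unfolding word_length_def by (metis length_Suc_conv_rev)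
  have red: "reduced_word (w @ [a])" using reduced_Rep[of h] w by simp
  then have rw: "reduced_word w" by (rule reduced_appendD1)
  define h' where "h' = (Abs_free_word w :: 'a free_word)"
  have h': "Rep_free_word h' = w" unfolding h'_def by (rule Rep_Abs[OF rw])
  obtain i b where a: "a = (i, b)" by (cases a)
  show thesis
  proof (rule that[of h' i])
    show "word_length h' = l" using h' w by (simp add: word_length_def)
    show "h = h' \<otimes>\<^bsub>free_group\<^esub> gen i \<or> h' = h \<otimes>\<^bsub>free_group\<^esub> gen i"
    proof (cases b)
      case True
      have "foldr push w [a] = w @ [a]" using foldr_push_Nil[OF red] by simp
      then have "h = h' \<otimes>\<^bsub>free_group\<^esub> gen i"
        using True by (simp add: Rep_free_word_inject[symmetric] Rep_mult h' w a gen_def Rep_Abs)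
      then show ?thesis ..
    next
      case False
      then have "foldr push (w @ [a]) [(i, True)] = w"
        using foldr_push_Nil[OF rw] by (simp add: a neg_def)
      then have "h' = h \<otimes>\<^bsub>free_group\<^esub> gen i"
        by (simp add: Rep_free_word_inject[symmetric] Rep_mult h' w(1) gen_def Rep_Abs)
      then show ?thesis ..
    qed
  qed
qed

definition consistent :: "nat \<Rightarrow> 'r \<Rightarrow> ('r, 'a) config \<times> ('r, 'a) config \<Rightarrow> bool" where
  "consistent k i z \<longleftrightarrow> (\<forall>h. word_length h \<le> k \<longrightarrow> word_length (h \<otimes>\<^bsub>free_group\<^esub> gen i) \<le> k \<longrightarrow>
     fst z (h \<otimes>\<^bsub>free_group\<^esub> gen i) = snd z h)"

lemma consistent_trunc: "consistent k i (trunc k y, trunc k (shift (gen i) y))"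
  by (auto simp: consistent_def trunc_def shift_def)

lemma block_decode:
  assumes \<sigma>: "\<sigma> \<in> sym_homs n"
    and c: "\<And>i v. v \<in> {1..n} \<Longrightarrow> consistent k i (X v, X (\<sigma> (gen i) v))"
    and X: "\<And>v. v \<in> {1..n} \<Longrightarrow> X v \<in> range (trunc k)"
    and x: "\<And>v. v \<in> {1..n} \<Longrightarrow> x v = X v \<one>\<^bsub>free_group\<^esub>"
    and v: "v \<in> {1..n}"
  shows "trunc k (pullback \<sigma> x v) = X v"
proof -
  have im: "\<sigma> g v \<in> {1..n}" if "v \<in> {1..n}" for g v
    using permutes_in_image[OF sym_homsD(1)[OF \<sigma>]] that by blast
  have "X v h = x (\<sigma> h v)" if "word_length h \<le> k" "v \<in> {1..n}" for h v
    using that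
  proof (induction "word_length h" arbitrary: h v)
    case 0
    then have "h = \<one>\<^bsub>free_group\<^esub>" by (simp add: word_length_eq_0)
    with 0 show ?case by (simp add: sym_homsD(3)[OF \<sigma>] x)
  next
    case (Suc l)
    obtain h' i where h': "word_length h' = l" "h = h' \<otimes>\<^bsub>free_group\<^esub> gen i \<or> h' = h \<otimes>\<^bsub>free_group\<^esub> gen i"
      using word_length_step[OF Suc.hyps(2)[symmetric]] by blast
    have l: "word_length h' \<le> k" using h'(1) Suc.hyps(2) Suc.prems(1) by simp
    from h'(2) show ?case
    proof
      assume h: "h = h' \<otimes>\<^bsub>free_group\<^esub> gen i"
      have "X v h = X (\<sigma> (gen i) v) h'"
        using c[OF Suc.prems(2), of i] l Suc.prems(1) by (simp add: consistent_def h)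
      also have "\<dots> = x (\<sigma> h' (\<sigma> (gen i) v))"
        by (rule Suc.hyps(1)[OF h'(1)[symmetric] l im[OF Suc.prems(2)]])
      finally show ?thesis by (simp add: h sym_homsD(2)[OF \<sigma>])
    next
      assume h: "h' = h \<otimes>\<^bsub>free_group\<^esub> gen i"
      define u where "u = inv_into UNIV (\<sigma> (gen i)) v"
      have u: "u \<in> {1..n}" "\<sigma> (gen i) u = v"
        unfolding u_def
        using permutes_in_image[OF permutes_inv[OF sym_homsD(1)[OF \<sigma>]]] Suc.prems(2)
          permutes_inverses(1)[OF sym_homsD(1)[OF \<sigma>]] by blast+
      have "X v h = X u h'"
        using c[OF u(1), of i] l Suc.prems(1) by (simp add: consistent_def h u(2))
      also have "\<dots> = x (\<sigma> h' u)"
        by (rule Suc.hyps(1)[OF h'(1)[symmetric] l u(1)])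
      finally show ?thesis by (simp add: h sym_homsD(2)[OF \<sigma>] u(2))
    qed
  qed
  note * = this
  obtain y where y: "X v = trunc k y" using X[OF v] by blast
  have "trunc k (pullback \<sigma> x v) = trunc k (X v)"
    unfolding trunc_eq_iff using *[OF _ v] by (simp add: pullback_def)
  then show ?thesis by (simp add: y)
qed

lemma pullback_measurable: "pullback \<sigma> x \<in> uniform_count_measure V \<rightarrow>\<^sub>M config_space"
  by (auto simp: measurable_def space_uniform_count_measure sets_uniform_count_measure)

lemma empirical_config_probs:
  assumes "finite V" "V \<noteq> {}"
  shows "empirical V \<sigma> x \<in> config_probs"
proof -
  interpret prob_space "uniform_count_measure V"
    using assms by (rule prob_space_uniform_count_measure)
  show ?thesis
    unfolding config_probs_def empirical_def by (simp add: prob_space_distr[OF pullback_measurable])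
qed

lemma measure_empirical:
  assumes "finite V" "S \<in> sets config_space"
  shows "measure (empirical V \<sigma> x) S = real (card {v\<in>V. pullback \<sigma> x v \<in> S}) / card V"
proof -
  have "pullback \<sigma> x -` S \<inter> V = {v\<in>V. pullback \<sigma> x v \<in> S}" by auto
  then show ?thesis
    unfolding empirical_def using assms
    by (subst measure_distr[OF pullback_measurable])
       (auto simp: space_uniform_count_measure measure_uniform_count_measure)
qed

lemma integral_empirical:
  fixes f :: "('r, 'a) config \<Rightarrow> real"
  assumes "finite V" "f \<in> borel_measurable config_space"
  shows "(\<integral>y. f y \<partial>empirical V \<sigma> x) = (\<Sum>v\<in>V. f (pullback \<sigma> x v)) / card V"
  unfolding empirical_def using assms
  by (subst integral_distr[OF pullback_measurable]) (auto simp: integral_uniform_count_measure)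

definition edge_set :: "nat \<Rightarrow> 'r \<Rightarrow> ('r, 'a) config \<times> ('r, 'a) config \<Rightarrow> ('r, 'a) config set" where
  "edge_set k i z = {y. trunc k y = fst z \<and> trunc k (shift (gen i) y) = snd z}"

definition vertex_stat :: "nat \<Rightarrow> ('r, 'a) config measure \<Rightarrow> ('r, 'a) config \<Rightarrow> real" where
  "vertex_stat k \<nu> p = measure \<nu> {y. trunc k y = p}"

definition edge_stat :: "nat \<Rightarrow> ('r, 'a) config measure \<Rightarrow> 'r \<Rightarrow> ('r, 'a) config \<times> ('r, 'a) config \<Rightarrow> real" where
  "edge_stat k \<nu> i z = measure \<nu> (edge_set k i z)"

definition block_entropy :: "nat \<Rightarrow> ('r::finite, 'a::finite) config measure \<Rightarrow> real" where
  "block_entropy k \<nu> = bethe (range (trunc k)) (vertex_stat k \<nu>) (edge_stat k \<nu>)"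

lemma trunc_shift_eq:
  assumes "trunc (k + word_length g) x = trunc (k + word_length g) y"
  shows "trunc k (shift g x) = trunc k (shift g y)"
proof -
  have "word_length (h \<otimes>\<^bsub>free_group\<^esub> g) \<le> k + word_length g" if "word_length h \<le> k" for h
    using word_length_mult_le[of h g] that by simp
  then show ?thesis using assms by (simp add: trunc_eq_iff shift_def)
qed

lemma cyl_set_edge_set: "cyl_set (Suc k) (edge_set k i z)"
  unfolding cyl_set_def edge_set_def mem_Collect_eq
  using trunc_shift_eq[of k "gen i"] trunc_eq_mono[of "Suc k" _ _ k] by (metis Suc_eq_plus1 le_add1 word_length_gen)

definition block :: "nat \<Rightarrow> nat \<Rightarrow> ('r free_word \<Rightarrow> nat \<Rightarrow> nat) \<Rightarrow> (nat \<Rightarrow> 'a) \<Rightarrow> nat \<Rightarrow> ('r, 'a) config" where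
  "block k n \<sigma> x = restrict (\<lambda>v. trunc k (pullback \<sigma> x v)) {1..n}"

lemma count_image_mset_mset_set:
  "finite V \<Longrightarrow> count (image_mset f (mset_set V)) p = card {v\<in>V. f v = p}"
  by (simp add: count_image_mset Int_def vimage_def conj_commute)

lemma count_block:
  fixes x :: "nat \<Rightarrow> 'a::finite" and \<sigma> :: "'r::finite free_word \<Rightarrow> nat \<Rightarrow> nat"
  shows "real (count (image_mset (block k n \<sigma> x) (mset_set {1..n})) p) / n
    = vertex_stat k (empirical {1..n} \<sigma> x) p"
proof -
  have "image_mset (block k n \<sigma> x) (mset_set {1..n}) = image_mset (\<lambda>v. trunc k (pullback \<sigma> x v)) (mset_set {1..n})"
    by (rule image_mset_mset_set_cong) (simp add: block_def)
  moreover have "vertex_stat k (empirical {1..n} \<sigma> x) p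
    = real (card {v\<in>{1..n}. pullback \<sigma> x v \<in> {y. trunc k y = p}}) / card {1..n}"
    unfolding vertex_stat_def by (rule measure_empirical[OF _ cyl_set_sets[OF cyl_set_fibre]]) simp
  ultimately show ?thesis by (simp add: count_image_mset_mset_set)
qed

lemma count_block_edge:
  fixes x :: "nat \<Rightarrow> 'a::finite" and \<sigma> :: "'r::finite free_word \<Rightarrow> nat \<Rightarrow> nat"
  assumes \<sigma>: "\<sigma> \<in> sym_homs n"
  shows "real (count (edge_mset {1..n} (block k n \<sigma> x) (\<sigma> (gen i))) z) / n
    = edge_stat k (empirical {1..n} \<sigma> x) i z"
proof -
  have "edge_mset {1..n} (block k n \<sigma> x) (\<sigma> (gen i)) =
      image_mset (\<lambda>v. (trunc k (pullback \<sigma> x v), trunc k (shift (gen i) (pullback \<sigma> x v)))) (mset_set {1..n})"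
    unfolding edge_mset_def
  proof (rule image_mset_mset_set_cong)
    fix v assume "v \<in> {1..n}"
    moreover from this have "\<sigma> (gen i) v \<in> {1..n}"
      using permutes_in_image[OF sym_homsD(1)[OF \<sigma>]] by blast
    ultimately show "(block k n \<sigma> x v, block k n \<sigma> x (\<sigma> (gen i) v)) =
        (trunc k (pullback \<sigma> x v), trunc k (shift (gen i) (pullback \<sigma> x v)))"
      by (simp add: block_def pullback_shift[OF \<sigma>])
  qed
  moreover have "edge_stat k (empirical {1..n} \<sigma> x) i z
    = real (card {v\<in>{1..n}. pullback \<sigma> x v \<in> edge_set k i z}) / card {1..n}"
    unfolding edge_stat_def by (rule measure_empirical[OF _ cyl_set_sets[OF cyl_set_edge_set]]) simp
  ultimately show ?thesis by (simp add: count_image_mset_mset_set edge_set_def prod_eq_iff)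
qed

definition block_pair :: "nat \<Rightarrow> nat \<Rightarrow> ('r free_word \<Rightarrow> nat \<Rightarrow> nat) \<times> (nat \<Rightarrow> 'a) \<Rightarrow>
    (nat \<Rightarrow> ('r, 'a) config) \<times> ('r \<Rightarrow> nat \<Rightarrow> nat)" where
  "block_pair k n = (\<lambda>(\<sigma>, x). (block k n \<sigma> x, \<lambda>i. \<sigma> (gen i)))"

lemma inj_on_block_pair:
  "inj_on (block_pair k n) (sym_homs n \<times> ({1..n} \<rightarrow>\<^sub>E UNIV) :: (('r::finite free_word \<Rightarrow> nat \<Rightarrow> nat) \<times> (nat \<Rightarrow> 'a)) set)"
proof (rule inj_onI, unfold split_paired_all)
  fix \<sigma> \<sigma>' :: "'r free_word \<Rightarrow> nat \<Rightarrow> nat" and x x' :: "nat \<Rightarrow> 'a"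
  assume a: "(\<sigma>, x) \<in> sym_homs n \<times> ({1..n} \<rightarrow>\<^sub>E UNIV)" "(\<sigma>', x') \<in> sym_homs n \<times> ({1..n} \<rightarrow>\<^sub>E UNIV)"
    and eq: "block_pair k n (\<sigma>, x) = block_pair k n (\<sigma>', x')"
  have "\<sigma> = \<sigma>'"
    using inj_onD[OF bij_betw_imp_inj_on[OF hom_tuples_bij[of n]], of \<sigma> \<sigma>'] a eq by (auto simp: block_pair_def)
  moreover have "x = x'"
  proof (rule PiE_ext)
    show "x \<in> {1..n} \<rightarrow>\<^sub>E UNIV" "x' \<in> {1..n} \<rightarrow>\<^sub>E UNIV" using a by auto
    fix v assume v: "v \<in> {1..n}"
    have "block k n \<sigma> x v \<one>\<^bsub>free_group\<^esub> = block k n \<sigma>' x' v \<one>\<^bsub>free_group\<^esub>" using eq by (simp add: block_pair_def)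
    then show "x v = x' v"
      using v a sym_homsD(3)[of \<sigma> n] sym_homsD(3)[of \<sigma>' n]
      by (simp add: block_def trunc_def pullback_def word_length_def Rep_one)
  qed
  ultimately show "(\<sigma>, x) = (\<sigma>', x')" by simp
qed

definition expected_microstates :: "('r::finite, 'a) config measure \<Rightarrow> real \<Rightarrow> nat \<Rightarrow> real" where
  "expected_microstates \<nu> \<epsilon> n =
     measure_pmf.expectation (uniform_hom n) (\<lambda>\<sigma>. real (card (microstates {1..n} \<sigma> \<nu> \<epsilon>)))"

lemma finite_microstates: "finite V \<Longrightarrow> finite (microstates V \<sigma> (\<nu> :: ('r::finite, 'a::finite) config measure) \<epsilon>)"
  unfolding microstates_def by (rule finite_subset[of _ "V \<rightarrow>\<^sub>E UNIV"]) (auto intro: finite_PiE)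

lemma expected_card:
  fixes \<Omega> :: "('r::finite free_word \<Rightarrow> nat \<Rightarrow> nat) \<Rightarrow> 'b set"
  assumes "\<And>\<sigma>. finite (\<Omega> \<sigma>)"
  shows "measure_pmf.expectation (uniform_hom n) (\<lambda>\<sigma>. real (card (\<Omega> \<sigma>))) =
    real (card (SIGMA \<sigma>:sym_homs n. \<Omega> \<sigma>)) / fact n ^ CARD('r)"
  unfolding expectation_uniform_hom using assms
  by (subst card_SigmaI[OF finite_hom_sym_group]) auto

lemma eventually_log_le_linear:
  fixes K1 K2 d :: real assumes "d > 0"
  shows "\<forall>\<^sub>F n in sequentially. K1 + K2 * ln (1 + real n) \<le> real n * d"
proof -
  have "((\<lambda>n. (K1 + K2 * ln (1 + real n)) / real n) \<longlongrightarrow> 0) sequentially" by real_asymp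
  then have "\<forall>\<^sub>F n in sequentially. (K1 + K2 * ln (1 + real n)) / real n < d"
    using assms by (rule order_tendstoD)
  with eventually_gt_at_top[of 0] show ?thesis
    by eventually_elim (simp add: field_simps)
qed

lemma microstates_expected_upper:
  fixes \<nu> :: "('r::finite, 'a::finite) config measure"
  assumes \<nu>: "\<nu> \<in> config_probs" and \<delta>: "\<delta> > 0"
  shows "\<exists>\<epsilon>>0. \<forall>\<^sub>F n in sequentially. expected_microstates \<nu> \<epsilon> n \<le> exp (n * (block_entropy k \<nu> + \<delta>))"
proof -
  interpret prob_space \<nu> using config_probsD[OF \<nu>] by simp
  let ?P = "range (trunc k) :: ('r, 'a) config set" and ?r = "CARD('r)"
  have P: "finite ?P" by (rule finite_pats)
  obtain e where e: "e > 0"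
    "\<And>a' w'. (\<And>p. p \<in> ?P \<Longrightarrow> a' p \<in> {0..1} \<and> \<bar>a' p - vertex_stat k \<nu> p\<bar> < e) \<Longrightarrow>
      (\<And>i z. z \<in> ?P \<times> ?P \<Longrightarrow> w' i z \<in> {0..1} \<and> \<bar>w' i z - edge_stat k \<nu> i z\<bar> < e) \<Longrightarrow>
      \<bar>bethe ?P a' w' - bethe ?P (vertex_stat k \<nu>) (edge_stat k \<nu>)\<bar> \<le> \<delta> / 2"
  proof (rule bethe_continuous[OF P, of "\<delta> / 2" "vertex_stat k \<nu>" "edge_stat k \<nu>"])
  qed (use \<delta> in \<open>auto simp: vertex_stat_def edge_stat_def\<close>)
  define C where "C = (5 * real CARD('r) ^ 2) ^ Suc k"
  have C: "C > 0" by (simp add: C_def)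
  define \<epsilon> where "\<epsilon> = e / C"
  define K where "K = real ?r * (1 + real (card ?P)) ^ 2"
  have "\<forall>\<^sub>F n in sequentially. K + (K + real (?r * card (?P \<times> ?P))) * ln (1 + real n) \<le> real n * (\<delta> / 2)"
    by (rule eventually_log_le_linear) (use \<delta> in simp)
  moreover have "\<forall>\<^sub>F n in sequentially. n > (0 :: nat)" by (rule eventually_gt_at_top)
  ultimately have "\<forall>\<^sub>F n in sequentially. expected_microstates \<nu> \<epsilon> n \<le> exp (n * (block_entropy k \<nu> + \<delta>))"
  proof eventually_elim
    case (elim n)
    let ?V = "{1..n}"
    define S where "S = (SIGMA \<sigma>:(sym_homs n :: ('r free_word \<Rightarrow> nat \<Rightarrow> nat) set). microstates ?V \<sigma> \<nu> \<epsilon>)"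
    define \<M> where "\<M> = {M \<in> UNIV \<rightarrow>\<^sub>E {M. set_mset M \<subseteq> ?P \<times> ?P \<and> size M = n}. \<exists>A.
       (\<forall>i :: 'r. image_mset fst (M i) = A \<and> image_mset snd (M i) = A) \<and>
       (\<forall>p\<in>?P. \<bar>count A p / n - vertex_stat k \<nu> p\<bar> < e) \<and>
       (\<forall>i. \<forall>z\<in>?P \<times> ?P. \<bar>count (M i) z / n - edge_stat k \<nu> i z\<bar> < e)}"
    define b where "b = exp (n * (block_entropy k \<nu> + \<delta> / 2) + K * (1 + ln (1 + real n)))"
    have fM: "finite (UNIV \<rightarrow>\<^sub>E {M. set_mset M \<subseteq> ?P \<times> ?P \<and> size M = n} :: ('r \<Rightarrow> _) set)"
      using card_multisets_of_size(1)[of "?P \<times> ?P" n] P by (intro finite_PiE) auto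
    then have f\<M>: "finite \<M>" unfolding \<M>_def by (rule finite_subset[rotated]) auto
    have c\<M>: "real (card \<M>) \<le> exp (real (?r * card (?P \<times> ?P)) * ln (1 + real n))"
    proof -
      have "card \<M> \<le> card (UNIV \<rightarrow>\<^sub>E {M. set_mset M \<subseteq> ?P \<times> ?P \<and> size M = n} :: ('r \<Rightarrow> _) set)"
        unfolding \<M>_def by (rule card_mono[OF fM]) auto
      also have "\<dots> = card {M. set_mset M \<subseteq> ?P \<times> ?P \<and> size M = n} ^ ?r" by (simp add: card_PiE)
      also have "\<dots> \<le> ((n + 1) ^ card (?P \<times> ?P)) ^ ?r"
        using card_multisets_of_size(2)[of "?P \<times> ?P" n] P by (intro power_mono) auto
      finally have "real (card \<M>) \<le> (1 + real n) ^ (?r * card (?P \<times> ?P))"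
        by (metis (mono_tags, lifting) add.commute mult.commute of_nat_1 of_nat_add of_nat_le_iff of_nat_power power_mult)
      also have "\<dots> = exp (real (?r * card (?P \<times> ?P)) * ln (1 + real n))"
        by (subst exp_of_nat_mult) simp
      finally show ?thesis .
    qed
    have bound: "real (card (edge_labelings ?V M)) / fact n ^ ?r \<le> b" and fin: "finite (edge_labelings ?V M)"
      if M\<M>: "M \<in> \<M>" for M
    proof -
      obtain A where A: "\<And>i. image_mset fst (M i) = A" "\<And>i. image_mset snd (M i) = A"
        and cA: "\<And>p. p \<in> ?P \<Longrightarrow> \<bar>count A p / n - vertex_stat k \<nu> p\<bar> < e"
        and cM: "\<And>i z. z \<in> ?P \<times> ?P \<Longrightarrow> \<bar>count (M i) z / n - edge_stat k \<nu> i z\<bar> < e"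
        using M\<M> unfolding \<M>_def by blast
      have Mi: "set_mset (M i) \<subseteq> ?P \<times> ?P" "size (M i) = n" for i
        using M\<M> by (auto simp: \<M>_def PiE_UNIV_domain)
      have sA: "size A = n" using A(1)[of undefined] Mi(2)[of undefined] by auto
      have "finite ?V" "card ?V = n" by auto
      note B = card_edge_labelings_bounds[where V = ?V and n = n and M = M and P = ?P, OF this elim(2) A P Mi(1) sA]
      show "finite (edge_labelings ?V M)"
        by (rule card_edge_labelings(2)[OF _ A]) (auto simp: sA)
      have frac: "real (count B z) / n \<in> {0..1}" if "size B = n" for B :: "'z multiset" and z
        using count_le_size[of B z] that elim(2) by (simp add: divide_le_eq)
      have "\<bar>bethe ?P (\<lambda>p. count A p / n) (\<lambda>i z. count (M i) z / n) - block_entropy k \<nu>\<bar> \<le> \<delta> / 2"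
        unfolding block_entropy_def using cA cM frac[OF sA] frac[OF Mi(2)] by (intro e(2)) auto
      then have "real n * bethe ?P (\<lambda>p. count A p / n) (\<lambda>i z. count (M i) z / n) \<le> n * (block_entropy k \<nu> + \<delta> / 2)"
        by (intro mult_left_mono) linarith+
      then have "ln (card (edge_labelings ?V M) / fact n ^ ?r) \<le> n * (block_entropy k \<nu> + \<delta> / 2) + K * (1 + ln (1 + real n))"
        using B(2) unfolding K_def by linarith
      moreover have "card (edge_labelings ?V M) / fact n ^ ?r > 0" using B(1) by simp
      ultimately show "real (card (edge_labelings ?V M)) / fact n ^ ?r \<le> b"
        unfolding b_def by (metis exp_le_cancel_iff exp_ln)
    qed
    have sub: "block_pair k n ` S \<subseteq> (\<Union>M\<in>\<M>. edge_labelings ?V M)"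
    proof (rule image_subsetI, unfold split_paired_all)
      fix \<sigma> x assume "(\<sigma>, x) \<in> S"
      then have \<sigma>: "\<sigma> \<in> sym_homs n" and x: "x \<in> ?V \<rightarrow>\<^sub>E UNIV"
        and near: "transport_dist (empirical ?V \<sigma> x) \<nu> < \<epsilon>"
        by (auto simp: S_def microstates_def)
      let ?e = "empirical ?V \<sigma> x" and ?X = "block k n \<sigma> x"
      have ep: "?e \<in> config_probs" using elim(2) by (intro empirical_config_probs) auto
      have close: "\<bar>measure ?e T - measure \<nu> T\<bar> < e" if "cyl_set (Suc k) T" for T
      proof -
        have "\<bar>measure ?e T - measure \<nu> T\<bar> \<le> C * transport_dist ?e \<nu>"
          unfolding C_def by (rule transport_ge_cyl[OF ep \<nu> that])
        also have "\<dots> < C * \<epsilon>" using near C by simp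
        also have "\<dots> = e" using C by (simp add: \<epsilon>_def)
        finally show ?thesis .
      qed
      define M where "M i = edge_mset ?V ?X (\<sigma> (gen i))" for i
      note perm = sym_homsD(1)[OF \<sigma>]
      have XP: "?X v \<in> ?P" if "v \<in> ?V" for v using that by (auto simp: block_def)
      have "M \<in> \<M>"
        unfolding \<M>_def mem_Collect_eq
      proof (intro conjI exI[of _ "image_mset ?X (mset_set ?V)"] allI ballI)
        have "set_mset (M i) \<subseteq> ?P \<times> ?P" "size (M i) = n" for i
          unfolding M_def edge_mset_def using XP permutes_in_image[OF perm, of "gen i"] by auto
        then show "M \<in> UNIV \<rightarrow>\<^sub>E {M. set_mset M \<subseteq> ?P \<times> ?P \<and> size M = n}" by auto
        show "image_mset fst (M i) = image_mset ?X (mset_set ?V)" "image_mset snd (M i) = image_mset ?X (mset_set ?V)" for i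
          unfolding M_def by (rule edge_mset_marginals[OF perm])+
        show "\<bar>count (image_mset ?X (mset_set ?V)) p / n - vertex_stat k \<nu> p\<bar> < e" for p
          unfolding count_block unfolding vertex_stat_def
          by (rule close[OF cyl_set_mono[OF cyl_set_fibre]]) simp
        show "\<bar>count (M i) z / n - edge_stat k \<nu> i z\<bar> < e" for i z
          unfolding M_def count_block_edge[OF \<sigma>] unfolding edge_stat_def
          by (rule close[OF cyl_set_edge_set])
      qed
      moreover have "block_pair k n (\<sigma>, x) \<in> edge_labelings ?V M"
        using perm by (auto simp: block_pair_def edge_labelings_def edge_perms_def M_def block_def)
      ultimately show "block_pair k n (\<sigma>, x) \<in> (\<Union>M\<in>\<M>. edge_labelings ?V M)" by blast
    qed
    have "card S = card (block_pair k n ` S)"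
      by (rule card_image[symmetric], rule inj_on_subset[OF inj_on_block_pair])
         (auto simp: S_def microstates_def)
    also have "\<dots> \<le> card (\<Union>M\<in>\<M>. edge_labelings ?V M)"
      using f\<M> fin by (intro card_mono[OF _ sub]) auto
    also have "\<dots> \<le> (\<Sum>M\<in>\<M>. card (edge_labelings ?V M))"
      by (rule card_UN_le[OF f\<M>])
    finally have "real (card S) \<le> (\<Sum>M\<in>\<M>. real (card (edge_labelings ?V M)))"
      by (metis of_nat_le_iff of_nat_sum)
    then have "real (card S) / fact n ^ ?r \<le> (\<Sum>M\<in>\<M>. real (card (edge_labelings ?V M)) / fact n ^ ?r)"
      by (simp add: sum_divide_distrib[symmetric] divide_right_mono)
    also have "\<dots> \<le> card \<M> * b"
      using bound by (rule sum_bounded_above)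
    also have "\<dots> \<le> exp (real (?r * card (?P \<times> ?P)) * ln (1 + real n)) * b"
      using c\<M> by (intro mult_right_mono) (auto simp: b_def)
    also have "\<dots> = exp (n * (block_entropy k \<nu> + \<delta> / 2) + (K + (K + real (?r * card (?P \<times> ?P))) * ln (1 + real n)))"
      unfolding b_def exp_add[symmetric] by (simp add: algebra_simps)
    also have "\<dots> \<le> exp (n * (block_entropy k \<nu> + \<delta>))"
      using elim(1) by (simp add: algebra_simps)
    finally show ?case
      unfolding expected_microstates_def S_def
      by (subst expected_card) (auto intro: finite_microstates)
  qed
  moreover have "\<epsilon> > 0" using e(1) C by (simp add: \<epsilon>_def)
  ultimately show ?thesis by blast
qed


lemma measurable_config_map:
  assumes "\<And>h. (\<lambda>x. f x h) \<in> M \<rightarrow>\<^sub>M count_space UNIV"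
  shows "f \<in> M \<rightarrow>\<^sub>M config_space"
proof -
  have "(\<lambda>x h. f x h) \<in> M \<rightarrow>\<^sub>M PiM UNIV (\<lambda>_. count_space UNIV)"
    by (rule measurable_PiM_single') (use assms in auto)
  then show ?thesis by (simp add: config_space_def)
qed

lemma measurable_config_component: "(\<lambda>x. x h) \<in> config_space \<rightarrow>\<^sub>M count_space UNIV"
  unfolding config_space_def by (rule measurable_component_singleton) simp

lemma measurable_shift: "shift g \<in> config_space \<rightarrow>\<^sub>M config_space"
  by (rule measurable_config_map) (simp add: shift_def measurable_config_component)

lemma measure_shift_vimage:
  assumes \<nu>: "\<nu> \<in> invariant_probs" and S: "S \<in> sets config_space"
  shows "measure \<nu> {y. shift g y \<in> S} = measure \<nu> S"
proof -
  have \<nu>': "sets \<nu> = sets config_space" "space \<nu> = UNIV"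
    using config_probsD[OF invariant_probsD[OF \<nu>]] by auto
  have "measure \<nu> S = measure (distr \<nu> config_space (shift g)) S"
    using \<nu> by (simp add: invariant_probs_def)
  also have "\<dots> = measure \<nu> (shift g -` S \<inter> space \<nu>)"
    using measurable_shift[of g] S by (intro measure_distr) (simp_all cong: measurable_cong_sets add: measurable_cong_sets[OF \<nu>'(1) refl])
  finally show ?thesis by (simp add: \<nu>' vimage_def)
qed

lemma edge_stat_marginals:
  fixes \<nu> :: "('r::finite, 'a::finite) config measure" and k :: nat
  assumes \<nu>: "\<nu> \<in> invariant_probs"
  defines "P \<equiv> range (trunc k)"
  shows "(\<Sum>z\<in>{z\<in>P \<times> P. fst z = p}. edge_stat k \<nu> i z) = vertex_stat k \<nu> p"
    and "(\<Sum>z\<in>{z\<in>P \<times> P. snd z = p}. edge_stat k \<nu> i z) = vertex_stat k \<nu> p"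
    and "(\<Sum>z\<in>P \<times> P. edge_stat k \<nu> i z) = 1"
proof -
  note \<nu>' = config_probsD[OF invariant_probsD[OF \<nu>]]
  interpret prob_space \<nu> by (rule \<nu>')
  have P: "finite P" unfolding P_def by (rule finite_pats)
  have union: "(\<Sum>z\<in>Z. edge_stat k \<nu> i z) = measure \<nu> (\<Union>z\<in>Z. edge_set k i z)" if "Z \<subseteq> P \<times> P" for Z
    unfolding edge_stat_def using cyl_set_sets[OF cyl_set_edge_set]
    by (intro finite_measure_finite_Union[symmetric] finite_subset[OF that])
       (auto simp: \<nu>' P disjoint_family_on_def edge_set_def prod_eq_iff)
  have "(\<Union>z\<in>{z\<in>P \<times> P. fst z = p}. edge_set k i z) = {y. trunc k y = p}"
    by (auto simp: edge_set_def P_def)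
  then show "(\<Sum>z\<in>{z\<in>P \<times> P. fst z = p}. edge_stat k \<nu> i z) = vertex_stat k \<nu> p"
    by (subst union) (auto simp: vertex_stat_def)
  have "(\<Union>z\<in>{z\<in>P \<times> P. snd z = p}. edge_set k i z) = {y. shift (gen i) y \<in> {y. trunc k y = p}}"
    by (auto simp: edge_set_def P_def)
  then show "(\<Sum>z\<in>{z\<in>P \<times> P. snd z = p}. edge_stat k \<nu> i z) = vertex_stat k \<nu> p"
    using measure_shift_vimage[OF \<nu> cyl_set_sets[OF cyl_set_fibre[of k p]], of "gen i"]
    by (subst union) (auto simp: vertex_stat_def)
  have "(\<Union>z\<in>P \<times> P. edge_set k i z) = UNIV"
    by (auto simp: edge_set_def P_def)
  then show "(\<Sum>z\<in>P \<times> P. edge_stat k \<nu> i z) = 1"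
    using prob_space by (subst union) (auto simp: \<nu>')
qed

lemma consistent_if_edge_stat_nonzero: "edge_stat k \<nu> i z \<noteq> 0 \<Longrightarrow> consistent k i z"
proof (rule ccontr)
  assume "edge_stat k \<nu> i z \<noteq> 0" and c: "\<not> consistent k i z"
  have "edge_set k i z = {}"
    using c consistent_trunc[of k i] by (cases z) (auto simp: edge_set_def)
  with \<open>edge_stat k \<nu> i z \<noteq> 0\<close> show False by (simp add: edge_stat_def)
qed

lemma simultaneous_approximation:
  fixes \<theta> :: "'z \<Rightarrow> real"
  assumes "finite Z" "N > 0"
  obtains q :: nat and h :: "'z \<Rightarrow> int"
  where "q > 0" "\<And>z. z \<in> Z \<Longrightarrow> \<bar>real q * \<theta> z - h z\<bar> < 1 / real N"
proof -
  obtain f where f: "bij_betw f {0..<card Z} Z"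
    using ex_bij_betw_nat_finite[OF assms(1)] by blast
  obtain q p where q: "(0 :: int) < q" and p: "\<And>i. i < card Z \<Longrightarrow> \<bar>of_int q * \<theta> (f i) - of_int (p i)\<bar> < 1 / N"
    using Dirichlet_approx_simult[OF assms(2), of "card Z" "\<lambda>i. \<theta> (f i)"] by metis
  show thesis
  proof (rule that[of "nat q" "\<lambda>z. p (inv_into {0..<card Z} f z)"])
    show "nat q > 0" using q by simp
    fix z assume z: "z \<in> Z"
    then have "inv_into {0..<card Z} f z < card Z" "f (inv_into {0..<card Z} f z) = z"
      using f bij_betw_inv_into_right[OF f z] bij_betwE[OF bij_betw_inv_into[OF f]] by auto
    then show "\<bar>real (nat q) * \<theta> z - p (inv_into {0..<card Z} f z)\<bar> < 1 / real N"
      using p[of "inv_into {0..<card Z} f z"] q by simp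
  qed
qed

lemma count_image_mset_superset:
  assumes "finite Q" "set_mset M \<subseteq> Q"
  shows "count (image_mset f M) x = (\<Sum>z\<in>{z\<in>Q. f z = x}. count M z)"
  unfolding count_image_mset using assms
  by (intro sum.mono_neutral_left) (auto simp: not_in_iff)

text \<open>Simultaneous Dirichlet approximation turns the stationary edge statistics into integral ones
  with denominator \<open>q\<close>; the marginal identities survive because they are integer equations that
  hold up to an error smaller than 1.\<close>

lemma rational_edge_stat:
  fixes \<nu> :: "('r::finite, 'a::finite) config measure" and k :: nat
  assumes \<nu>: "\<nu> \<in> invariant_probs" and e: "e > 0"
  defines "P \<equiv> range (trunc k)"
  obtains q :: nat and A and M :: "'r \<Rightarrow> (('r, 'a) config \<times> ('r, 'a) config) multiset"
  where "q > 0" "\<And>i. image_mset fst (M i) = A" "\<And>i. image_mset snd (M i) = A"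
    "\<And>i. size (M i) = q" "\<And>i. set_mset (M i) \<subseteq> {z \<in> P \<times> P. consistent k i z}"
    "\<And>i z. z \<in> P \<times> P \<Longrightarrow> \<bar>count (M i) z / q - edge_stat k \<nu> i z\<bar> < e"
    "\<And>p. \<bar>count A p / q - vertex_stat k \<nu> p\<bar> < e"
proof -
  note \<nu>' = config_probsD[OF invariant_probsD[OF \<nu>]]
  interpret prob_space \<nu> by (rule \<nu>')
  have P: "finite P" unfolding P_def by (rule finite_pats)
  then have PP: "finite (P \<times> P)" by simp
  let ?w = "edge_stat k \<nu>"
  define c where "c = real (card (P \<times> P))"
  have c0: "c \<ge> 0" by (simp add: c_def)
  have w0: "?w i z \<ge> 0" for i z by (simp add: edge_stat_def)
  obtain N :: nat where N: "(c + 1) * (2 + 1 / e) < real N" using reals_Archimedean2 by blast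
  have "0 < (c + 1) * (2 + 1 / e)" using e c0 by (intro mult_pos_pos add_pos_pos add_nonneg_pos) auto
  then have N0: "N > 0" using N by (metis of_nat_0_less_iff less_trans)
  have cN: "c / N < 1 / 2" "c / N < e" "1 / N < e" "1 / real N \<le> 1"
  proof -
    have "(c + 1) * 2 \<le> (c + 1) * (2 + 1 / e)" "(c + 1) * (1 / e) \<le> (c + 1) * (2 + 1 / e)"
      using e c0 by (intro mult_left_mono; simp)+
    then have 1: "(c + 1) * 2 < N" and "(c + 1) * (1 / e) < N" using N by linarith+
    then have 2: "c + 1 < e * N" using e by (simp add: field_simps)
    show "c / N < 1 / 2" using 1 N0 by (simp add: field_simps)
    show "c / N < e" using 2 N0 by (simp add: field_simps)
    have "1 < e * N" using 2 c0 by linarith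
    then show "1 / N < e" using N0 by (simp add: field_simps)
    show "1 / real N \<le> 1" using N0 by simp
  qed
  have "finite ((UNIV :: 'r set) \<times> P \<times> P)" using P by simp
  then obtain q and h' :: "'r \<times> ('r, 'a) config \<times> ('r, 'a) config \<Rightarrow> int" where q: "q > 0"
    and h'0: "\<And>z. z \<in> UNIV \<times> P \<times> P \<Longrightarrow> \<bar>real q * ?w (fst z) (snd z) - h' z\<bar> < 1 / real N"
    using simultaneous_approximation[OF _ N0, of "UNIV \<times> P \<times> P" "\<lambda>z. ?w (fst z) (snd z)"] by blast
  define h where "h i z = h' (i, z)" for i z
  have h: "\<bar>real q * ?w i z - h i z\<bar> < 1 / real N" if "z \<in> P \<times> P" for i z
    using h'0[of "(i, z)"] that by (simp add: h_def)
  have hnn: "h i z \<ge> 0" if "z \<in> P \<times> P" for i z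
  proof -
    have "real q * ?w i z \<ge> 0" using w0 by simp
    then have "real_of_int (h i z) > -1" using h[OF that, of i] cN(4) by linarith
    then show ?thesis by linarith
  qed
  have h0: "?w i z \<noteq> 0" if "h i z \<noteq> 0" "z \<in> P \<times> P" for i z
  proof
    assume "?w i z = 0"
    then have "\<bar>real_of_int (h i z)\<bar> < 1" using h[OF that(2), of i] cN(4) by simp
    with that(1) show False by linarith
  qed
  define M where "M i = (\<Sum>z\<in>P \<times> P. replicate_mset (nat (h i z)) z)" for i
  have cM: "count (M i) z = (if z \<in> P \<times> P then nat (h i z) else 0)" for i z
  proof -
    have "count (M i) z = (\<Sum>y\<in>P \<times> P. if z = y then nat (h i y) else 0)"
      unfolding M_def count_sum by (intro sum.cong refl) simp
    then show ?thesis unfolding sum.delta'[OF PP] .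
  qed
  have setM: "set_mset (M i) \<subseteq> {z \<in> P \<times> P. consistent k i z}" for i
  proof
    fix z assume "z \<in># M i"
    then have "count (M i) z \<noteq> 0" by simp
    then have "z \<in> P \<times> P" "h i z \<noteq> 0" by (auto simp: cM split: if_splits)
    then show "z \<in> {z \<in> P \<times> P. consistent k i z}"
      using h0 consistent_if_edge_stat_nonzero[of k \<nu> i z] by blast
  qed
  have setM': "set_mset (M i) \<subseteq> P \<times> P" for i using setM[of i] by auto
  have rM: "real (count (M i) z) = h i z" if "z \<in> P \<times> P" for i z
    using hnn[OF that] that by (simp add: cM)
  have part: "\<bar>(\<Sum>z\<in>Z. real (count (M i) z)) - q * (\<Sum>z\<in>Z. ?w i z)\<bar> \<le> c / N" if "Z \<subseteq> P \<times> P" for i Z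
  proof -
    have "(\<Sum>z\<in>Z. real (count (M i) z)) - q * (\<Sum>z\<in>Z. ?w i z) = (\<Sum>z\<in>Z. real (count (M i) z) - q * ?w i z)"
      by (simp add: sum_subtractf sum_distrib_left)
    also have "\<bar>\<dots>\<bar> \<le> (\<Sum>z\<in>Z. \<bar>real (count (M i) z) - q * ?w i z\<bar>)" by (rule sum_abs)
    also have "\<dots> \<le> card Z * (1 / N)"
    proof (rule sum_bounded_above)
      fix z assume "z \<in> Z"
      then have "z \<in> P \<times> P" using that by blast
      from h[OF this, of i] rM[OF this, of i] show "\<bar>real (count (M i) z) - q * ?w i z\<bar> \<le> 1 / N"
        by simp
    qed
    also have "\<dots> \<le> c / N"
    proof -
      have "real (card Z) \<le> c" unfolding c_def of_nat_le_iff using P by (intro card_mono that) simp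
      then show ?thesis by (simp add: divide_right_mono)
    qed
    finally show ?thesis .
  qed
  have unique: "m = l" if "\<bar>real m - x\<bar> \<le> c / N" "\<bar>real l - x\<bar> \<le> c / N" for m l x
  proof -
    have "\<bar>real m - real l\<bar> < 1" using that cN(1) by linarith
    then show ?thesis by linarith
  qed
  note marg = edge_stat_marginals[OF \<nu>, where k = k, folded P_def]
  have fstM: "\<bar>real (count (image_mset fst (M i)) p) - q * vertex_stat k \<nu> p\<bar> \<le> c / N" for i p
    using part[of "{z\<in>P \<times> P. fst z = p}" i]
    unfolding marg(1) count_image_mset_superset[OF PP setM'] of_nat_sum by blast
  have sndM: "\<bar>real (count (image_mset snd (M i)) p) - q * vertex_stat k \<nu> p\<bar> \<le> c / N" for i p
    using part[of "{z\<in>P \<times> P. snd z = p}" i]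
    unfolding marg(2) count_image_mset_superset[OF PP setM'] of_nat_sum by blast
  define A where "A = image_mset fst (M undefined)"
  show thesis
  proof (rule that[of q M A])
    show "q > 0" by (rule q)
    show "image_mset fst (M i) = A" for i
      by (rule multiset_eqI, rule unique[OF fstM]) (unfold A_def, rule fstM)
    show "image_mset snd (M i) = A" for i
      by (rule multiset_eqI, rule unique[OF sndM]) (unfold A_def, rule fstM)
    show "size (M i) = q" for i
    proof (rule unique)
      show "\<bar>real (size (M i)) - q\<bar> \<le> c / N"
        using part[of "P \<times> P" i]
        unfolding marg(3) sum_count_superset[OF PP setM', symmetric] of_nat_sum by simp
    qed (use c0 in simp)
    show "set_mset (M i) \<subseteq> {z \<in> P \<times> P. consistent k i z}" for i by (rule setM)
    show "\<bar>count (M i) z / q - ?w i z\<bar> < e" if "z \<in> P \<times> P" for i z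
    proof -
      have "\<bar>count (M i) z / q - ?w i z\<bar> = \<bar>real q * ?w i z - h i z\<bar> / q"
        using q rM[OF that, of i] by (simp add: field_simps abs_minus_commute)
      also have "\<dots> \<le> \<bar>real q * ?w i z - h i z\<bar> / 1" using q by (intro divide_left_mono) auto
      also have "\<dots> < e" using h[OF that, of i] cN(3) by simp
      finally show ?thesis .
    qed
    show "\<bar>count A p / q - vertex_stat k \<nu> p\<bar> < e" for p
    proof -
      have "\<bar>count A p / q - vertex_stat k \<nu> p\<bar> = \<bar>real (count A p) - q * vertex_stat k \<nu> p\<bar> / q"
        using q by (simp add: field_simps)
      also have "\<dots> \<le> \<bar>real (count A p) - q * vertex_stat k \<nu> p\<bar> / 1" using q by (intro divide_left_mono) auto
      also have "\<dots> < e" using fstM[of undefined p] cN(2) unfolding A_def by simp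
      finally show ?thesis .
    qed
  qed
qed

lemma image_repeat_mset: "image_mset f (repeat_mset m A) = repeat_mset m (image_mset f A)"
  by (induction m) auto

lemma padded_frequency:
  fixes q n m s :: nat
  assumes b: "count B z \<le> q" and q: "q > 0" and n: "n = q * m + s" "s < q" "n > 0"
  shows "\<bar>count (repeat_mset m B + replicate_mset s y) z / n - count B z / q\<bar> \<le> q / n"
proof -
  define u where "u = (if z = y then 1 else 0 :: real)"
  define f where "f = real (count B z) / q"
  have f: "0 \<le> f" "f \<le> 1" using b q by (auto simp: f_def)
  have "real (count (repeat_mset m B + replicate_mset s y) z) = m * (q * f) + s * u"
    using q by (auto simp: f_def u_def)
  also have "\<dots> = n * f + s * (u - f)" by (simp add: n(1) algebra_simps)
  finally have "real (count (repeat_mset m B + replicate_mset s y) z) / n - f = s * (u - f) / n"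
    using n(3) by (simp add: field_simps)
  moreover have "\<bar>s * (u - f) / n\<bar> \<le> q / n"
  proof -
    have "\<bar>u - f\<bar> \<le> 1" using f by (auto simp: u_def)
    then have "real s * \<bar>u - f\<bar> \<le> real q * 1" using n(2) by (intro mult_mono) auto
    then show ?thesis by (simp add: abs_mult divide_right_mono)
  qed
  ultimately show ?thesis by (simp add: f_def)
qed

lemma microstates_expected_lower:
  fixes \<nu> :: "('r::finite, 'a::finite) config measure"
  assumes \<nu>: "\<nu> \<in> invariant_probs" and \<epsilon>: "\<epsilon> > 0"
  shows "\<exists>k. \<forall>\<delta>>0. \<forall>\<^sub>F n in sequentially. exp (n * (block_entropy k \<nu> - \<delta>)) \<le> expected_microstates \<nu> \<epsilon> n"
proof -
  note cp = invariant_probsD[OF \<nu>]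
  interpret prob_space \<nu> by (rule config_probsD[OF cp])
  have "\<forall>\<^sub>F k in sequentially. tail TYPE('r) k < \<epsilon> / 4"
    using tail_tendsto_0 by (rule order_tendstoD) (use \<epsilon> in simp)
  then obtain k where k: "tail TYPE('r) k < \<epsilon> / 4"
    by (metis eventually_sequentially order_refl)
  let ?P = "range (trunc k) :: ('r, 'a) config set" and ?r = "CARD('r)" and ?D = "diam TYPE('r)"
  have P: "finite ?P" by (rule finite_pats)
  show ?thesis
  proof (intro exI[of _ k] allI impI)
    fix \<delta> :: real assume \<delta>: "\<delta> > 0"
    obtain e0 where e0: "e0 > 0"
      "\<And>a' w'. (\<And>p. p \<in> ?P \<Longrightarrow> a' p \<in> {0..1} \<and> \<bar>a' p - vertex_stat k \<nu> p\<bar> < e0) \<Longrightarrow>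
        (\<And>i z. z \<in> ?P \<times> ?P \<Longrightarrow> w' i z \<in> {0..1} \<and> \<bar>w' i z - edge_stat k \<nu> i z\<bar> < e0) \<Longrightarrow>
        \<bar>bethe ?P a' w' - bethe ?P (vertex_stat k \<nu>) (edge_stat k \<nu>)\<bar> \<le> \<delta> / 2"
    proof (rule bethe_continuous[OF P, of "\<delta> / 2" "vertex_stat k \<nu>" "edge_stat k \<nu>"])
    qed (use \<delta> in \<open>auto simp: vertex_stat_def edge_stat_def\<close>)
    define c where "c = (?D + 1) * (real (card ?P) + 1)"
    have c: "c > 0" using diam_nonneg[where 'r = 'r] by (simp add: c_def)
    define e where "e = min e0 (\<epsilon> / (2 * c))"
    have e: "e > 0" using e0 \<epsilon> c by (simp add: e_def)
    obtain q A0 and M0 :: "'r \<Rightarrow> (('r, 'a) config \<times> ('r, 'a) config) multiset"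
      where q: "q > 0" and A0: "\<And>i. image_mset fst (M0 i) = A0" "\<And>i. image_mset snd (M0 i) = A0"
        and sM0: "\<And>i. size (M0 i) = q" and setM0: "\<And>i. set_mset (M0 i) \<subseteq> {z \<in> ?P \<times> ?P. consistent k i z}"
        and wM0: "\<And>i z. z \<in> ?P \<times> ?P \<Longrightarrow> \<bar>count (M0 i) z / q - edge_stat k \<nu> i z\<bar> < e / 2"
        and aM0: "\<And>p. \<bar>count A0 p / q - vertex_stat k \<nu> p\<bar> < e / 2"
    proof (rule rational_edge_stat[OF \<nu>, of "e / 2" k])
    qed (use e in auto)
    have sA0: "size A0 = q" using A0(1)[of undefined] sM0[of undefined] by auto
    define K where "K = real ?r * (1 + real (card ?P)) ^ 2"
    define p0 :: "('r, 'a) config" where "p0 = trunc k (\<lambda>_. undefined)"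
    have p0: "(p0, p0) \<in> {z \<in> ?P \<times> ?P. consistent k i z}" for i
    proof -
      have "p0 \<in> ?P" by (simp add: p0_def)
      moreover have "consistent k i (p0, p0)" by (simp add: p0_def consistent_def trunc_def)
      ultimately show ?thesis by simp
    qed
    have "\<forall>\<^sub>F n in sequentially. K + K * ln (1 + real n) \<le> real n * (\<delta> / 2)"
      by (rule eventually_log_le_linear) (use \<delta> in simp)
    moreover have "\<forall>\<^sub>F n in sequentially. n > (0 :: nat)" by (rule eventually_gt_at_top)
    moreover have "\<forall>\<^sub>F n in sequentially. real q / real n < e / 2"
    proof -
      have "((\<lambda>n. real q / real n) \<longlongrightarrow> 0) sequentially" by real_asymp
      then show ?thesis by (rule order_tendstoD) (use e in simp)
    qed
    ultimately show "\<forall>\<^sub>F n in sequentially. exp (n * (block_entropy k \<nu> - \<delta>)) \<le> expected_microstates \<nu> \<epsilon> n"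
    proof eventually_elim
      case (elim n)
      let ?V = "{1..n}"
      define m where "m = n div q"
      define s where "s = n mod q"
      have n: "n = q * m + s" "s < q" "n > 0" using q elim(2) by (auto simp: m_def s_def)
      define M where "M i = repeat_mset m (M0 i) + replicate_mset s (p0, p0)" for i
      define A where "A = repeat_mset m A0 + replicate_mset s p0"
      have A: "image_mset fst (M i) = A" "image_mset snd (M i) = A" for i
        by (simp_all add: M_def A_def image_repeat_mset A0)
      have sA: "size A = n" by (simp add: A_def sA0 n(1) mult.commute)
      have sM: "size (M i) = n" for i by (simp add: M_def sM0 n(1) mult.commute)
      have setM: "set_mset (M i) \<subseteq> {z \<in> ?P \<times> ?P. consistent k i z}" for i
      proof -
        have "set_mset (repeat_mset m (M0 i)) \<subseteq> set_mset (M0 i)" by (induction m) auto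
        moreover have "set_mset (replicate_mset s (p0, p0)) \<subseteq> {(p0, p0)}" by auto
        ultimately show ?thesis using setM0[of i] p0[of i] unfolding M_def set_mset_union by blast
      qed
      then have setM': "set_mset (M i) \<subseteq> ?P \<times> ?P" for i by blast
      have cA: "\<bar>count A p / n - vertex_stat k \<nu> p\<bar> < e" for p
        using padded_frequency[of A0 p q n m s p0] count_le_size[of A0 p] q n sA0 aM0[of p] elim(3)
        unfolding A_def by linarith
      have cM: "\<bar>count (M i) z / n - edge_stat k \<nu> i z\<bar> < e" if "z \<in> ?P \<times> ?P" for i z
        using padded_frequency[of "M0 i" z q n m s "(p0, p0)"] count_le_size[of "M0 i" z] q n sM0[of i] wM0[OF that, of i] elim(3)
        unfolding M_def by linarith
      have fV: "finite ?V" "card ?V = n" by auto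
      note B = card_edge_labelings_bounds[where V = ?V and n = n and M = M and P = ?P, OF fV n(3) A P setM' sA]
      have frac: "real (count B z) / n \<in> {0..1}" if "size B = n" for B :: "'z multiset" and z
        using count_le_size[of B z] that elim(2) by (simp add: divide_le_eq)
      have "\<bar>bethe ?P (\<lambda>p. count A p / n) (\<lambda>i z. count (M i) z / n) - block_entropy k \<nu>\<bar> \<le> \<delta> / 2"
        unfolding block_entropy_def using cA cM frac[OF sA] frac[OF sM]
        by (intro e0(2)) (auto simp: e_def)
      then have "n * (block_entropy k \<nu> - \<delta> / 2) \<le> real n * bethe ?P (\<lambda>p. count A p / n) (\<lambda>i z. count (M i) z / n)"
        by (intro mult_left_mono) linarith+
      then have "n * (block_entropy k \<nu> - \<delta> / 2) - K * (1 + ln (1 + real n)) \<le> ln (card (edge_labelings ?V M) / fact n ^ ?r)"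
        using B(2) unfolding K_def by linarith
      moreover have "n * (block_entropy k \<nu> - \<delta>) \<le> n * (block_entropy k \<nu> - \<delta> / 2) - K * (1 + ln (1 + real n))"
        using elim(1) by (simp add: algebra_simps)
      ultimately have "n * (block_entropy k \<nu> - \<delta>) \<le> ln (card (edge_labelings ?V M) / fact n ^ ?r)" by linarith
      moreover have "card (edge_labelings ?V M) / fact n ^ ?r > 0" using B(1) by simp
      ultimately have main: "exp (n * (block_entropy k \<nu> - \<delta>)) \<le> card (edge_labelings ?V M) / fact n ^ ?r"
        by (metis exp_le_cancel_iff exp_ln)
      define S where "S = (SIGMA \<sigma>:(sym_homs n :: ('r free_word \<Rightarrow> nat \<Rightarrow> nat) set). microstates ?V \<sigma> \<nu> \<epsilon>)"
      have sub: "edge_labelings ?V M \<subseteq> block_pair k n ` S"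
      proof (rule subsetI, unfold split_paired_all)
        fix X t assume Xt: "(X, t) \<in> edge_labelings ?V M"
        then have X: "X \<in> ?V \<rightarrow>\<^sub>E UNIV" and t: "\<And>i. t i permutes ?V" "\<And>i. edge_mset ?V X (t i) = M i"
          by (auto simp: edge_labelings_def edge_perms_def)
        have "t \<in> (\<lambda>\<sigma> i. \<sigma> (gen i)) ` sym_homs n"
          using hom_tuples_bij[of n, where 'r = 'r] t(1) by (auto simp: bij_betw_def)
        then obtain \<sigma> where \<sigma>: "\<sigma> \<in> sym_homs n" and t': "t = (\<lambda>i. \<sigma> (gen i))" by blast
        define x where "x = restrict (\<lambda>v. X v \<one>\<^bsub>free_group\<^esub>) ?V"
        have edge: "(X v, X (\<sigma> (gen i) v)) \<in> {z \<in> ?P \<times> ?P. consistent k i z}" if "v \<in> ?V" for v i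
        proof -
          have "(X v, X (t i v)) \<in># edge_mset ?V X (t i)" using that by (auto simp: edge_mset_def)
          then show ?thesis using t(2)[of i] setM[of i] by (auto simp: t')
        qed
        have dec: "trunc k (pullback \<sigma> x v) = X v" if "v \<in> ?V" for v
          by (rule block_decode[OF \<sigma> _ _ _ that]) (use edge in \<open>auto simp: x_def\<close>)
        have bX: "block k n \<sigma> x = X"
          by (rule PiE_ext[OF _ X]) (auto simp: block_def dec)
        have "image_mset X (mset_set ?V) = A"
          using edge_labelings_marginals(1)[OF Xt, of undefined] A(1) by simp
        then have stat: "vertex_stat k (empirical ?V \<sigma> x) p = count A p / n" for p
          using count_block[of k n \<sigma> x p] by (simp add: bX)
        have "transport_dist (empirical ?V \<sigma> x) \<nu> \<le> 2 * tail TYPE('r) k +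
            ?D * (\<Sum>p\<in>?P. \<bar>vertex_stat k (empirical ?V \<sigma> x) p - vertex_stat k \<nu> p\<bar>)"
          unfolding vertex_stat_def using n(3) by (intro transport_le_trunc empirical_config_probs cp) auto
        also have "(\<Sum>p\<in>?P. \<bar>vertex_stat k (empirical ?V \<sigma> x) p - vertex_stat k \<nu> p\<bar>) \<le> card ?P * e"
          unfolding stat using cA by (intro sum_bounded_above) (simp add: less_imp_le)
        also have "?D * (card ?P * e) \<le> c * e"
          unfolding c_def using diam_nonneg[where 'r = 'r] e by (simp add: algebra_simps)
        also have "c * e \<le> \<epsilon> / 2"
        proof -
          have "c * e \<le> c * (\<epsilon> / (2 * c))" using c by (intro mult_left_mono) (auto simp: e_def)
          then show ?thesis using c by simp
        qed
        also have "2 * tail TYPE('r) k + \<epsilon> / 2 < \<epsilon>" using k by linarith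
        finally have "transport_dist (empirical ?V \<sigma> x) \<nu> < \<epsilon>"
          using diam_nonneg[where 'r = 'r] by (simp add: mult_left_mono)
        then have "(\<sigma>, x) \<in> S" using \<sigma> by (auto simp: S_def microstates_def x_def)
        moreover have "block_pair k n (\<sigma>, x) = (X, t)" by (simp add: block_pair_def bX t')
        ultimately show "(X, t) \<in> block_pair k n ` S" by (metis image_eqI)
      qed
      have fS: "finite S" unfolding S_def
        by (intro finite_SigmaI finite_hom_sym_group finite_microstates) simp
      have "card (edge_labelings ?V M) \<le> card S"
        by (rule surj_card_le[OF fS sub])
      then have "card (edge_labelings ?V M) / fact n ^ ?r \<le> card S / fact n ^ ?r"
        by (intro divide_right_mono) auto
      with main show ?case
        unfolding expected_microstates_def S_def
        by (subst expected_card) (auto intro: finite_microstates)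
    qed
  qed
qed

section \<open>The f invariant as an infimum of block entropies\<close>


lemma f_invariant_eq:
  "f_invariant \<nu> = (INF \<epsilon>\<in>{0<..}. limsup (\<lambda>n. elog (expected_microstates \<nu> \<epsilon> n) / ereal (real n)))"
  by (simp add: f_invariant_def expected_microstates_def)

lemma expected_microstates_nonneg: "expected_microstates \<nu> \<epsilon> n \<ge> 0"
  unfolding expected_microstates_def by (rule integral_nonneg_AE) simp

lemma elog_div_le_iff:
  fixes c :: real
  assumes "t \<ge> 0" "n > 0"
  shows "elog t / ereal (real n) \<le> ereal c \<longleftrightarrow> t \<le> exp (n * c)"
proof (cases "t = 0")
  case False
  then have "t \<le> exp (n * c) \<longleftrightarrow> ln t \<le> n * c" using assms ln_ge_iff[of t] 
    by (metis exp_gt_zero exp_ln ln_exp ln_le_cancel_iff order_le_less)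
  then show ?thesis using False assms by (simp add: elog_def pos_divide_le_eq mult.commute)
qed (use assms in \<open>simp add: elog_def\<close>)

lemma elog_div_ge_iff:
  fixes c :: real
  assumes "t \<ge> 0" "n > 0"
  shows "ereal c \<le> elog t / ereal (real n) \<longleftrightarrow> exp (n * c) \<le> t"
proof (cases "t = 0")
  case False
  then have "exp (n * c) \<le> t \<longleftrightarrow> n * c \<le> ln t" using assms
    by (metis ln_ge_iff order_le_less)
  then show ?thesis using False assms by (simp add: elog_def pos_le_divide_eq mult.commute)
qed (use assms in \<open>simp add: elog_def not_le\<close>)

lemma f_invariant_le:
  fixes c :: real
  assumes "\<epsilon> > 0" "\<forall>\<^sub>F n in sequentially. expected_microstates \<nu> \<epsilon> n \<le> exp (n * c)"
  shows "f_invariant \<nu> \<le> ereal c"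
  unfolding f_invariant_eq
proof (rule INF_lower2)
  show "\<epsilon> \<in> {0<..}" using assms by simp
  show "limsup (\<lambda>n. elog (expected_microstates \<nu> \<epsilon> n) / ereal (real n)) \<le> ereal c"
  proof (rule Limsup_bounded)
    show "\<forall>\<^sub>F n in sequentially. elog (expected_microstates \<nu> \<epsilon> n) / ereal (real n) \<le> ereal c"
      using assms(2) eventually_gt_at_top[of 0]
      by eventually_elim (simp add: elog_div_le_iff expected_microstates_nonneg)
  qed
qed

lemma f_invariant_ge:
  fixes c :: real
  assumes "\<And>\<epsilon>. \<epsilon> > 0 \<Longrightarrow> \<exists>\<^sub>F n in sequentially. exp (n * c) \<le> expected_microstates \<nu> \<epsilon> n"
  shows "ereal c \<le> f_invariant \<nu>"
  unfolding f_invariant_eq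
proof (rule INF_greatest, rule ccontr)
  fix \<epsilon> :: real assume \<epsilon>: "\<epsilon> \<in> {0<..}"
    and "\<not> ereal c \<le> limsup (\<lambda>n. elog (expected_microstates \<nu> \<epsilon> n) / ereal (real n))"
  then have "\<forall>\<^sub>F n in sequentially. elog (expected_microstates \<nu> \<epsilon> n) / ereal (real n) < ereal c"
    by (intro Limsup_lessD) simp
  with eventually_gt_at_top[of 0]
  have "\<forall>\<^sub>F n in sequentially. \<not> exp (n * c) \<le> expected_microstates \<nu> \<epsilon> n"
    by eventually_elim (simp add: elog_div_ge_iff[symmetric] expected_microstates_nonneg not_le)
  then show False using assms[of \<epsilon>] \<epsilon> by (simp add: frequently_def)
qed

lemma f_invariant_le_block_entropy:
  fixes \<nu> :: "('r::finite, 'a::finite) config measure"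
  assumes "\<nu> \<in> config_probs"
  shows "f_invariant \<nu> \<le> ereal (block_entropy k \<nu>)"
proof (rule ereal_le_epsilon2)
  fix \<delta> :: real assume "0 < \<delta>"
  then obtain \<epsilon> where "\<epsilon> > 0" "\<forall>\<^sub>F n in sequentially. expected_microstates \<nu> \<epsilon> n \<le> exp (n * (block_entropy k \<nu> + \<delta>))"
    using microstates_expected_upper[OF assms] by blast
  from f_invariant_le[OF this] show "f_invariant \<nu> \<le> ereal (block_entropy k \<nu>) + ereal \<delta>" by simp
qed

lemma f_invariant_ge_block_entropy:
  fixes \<nu> :: "('r::finite, 'a::finite) config measure"
  assumes \<nu>: "\<nu> \<in> invariant_probs" and c: "\<And>k. c \<le> block_entropy k \<nu>"
  shows "ereal c \<le> f_invariant \<nu>"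
proof (rule ereal_le_epsilon2)
  fix \<delta> :: real assume \<delta>: "0 < \<delta>"
  have "ereal (c - \<delta>) \<le> f_invariant \<nu>"
  proof (rule f_invariant_ge)
    fix \<epsilon> :: real assume "\<epsilon> > 0"
    then obtain k where "\<forall>\<^sub>F n in sequentially. exp (n * (block_entropy k \<nu> - \<delta>)) \<le> expected_microstates \<nu> \<epsilon> n"
      using microstates_expected_lower[OF \<nu>] \<delta> by blast
    then have "\<forall>\<^sub>F n in sequentially. exp (n * (c - \<delta>)) \<le> expected_microstates \<nu> \<epsilon> n"
    proof eventually_elim
      case (elim n)
      have "exp (n * (c - \<delta>)) \<le> exp (n * (block_entropy k \<nu> - \<delta>))"
        using c[of k] by (simp add: mult_left_mono)
      with elim show ?case by linarith
    qed
    then show "\<exists>\<^sub>F n in sequentially. exp (n * (c - \<delta>)) \<le> expected_microstates \<nu> \<epsilon> n"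
      by (rule eventually_frequently[rotated]) simp
  qed
  then have "ereal (c - \<delta>) + ereal \<delta> \<le> f_invariant \<nu> + ereal \<delta>" by (rule add_right_mono)
  then show "ereal c \<le> f_invariant \<nu> + ereal \<delta>" by simp
qed

definition pair_config :: "('r, 'a) config \<Rightarrow> ('r, 'b) config \<Rightarrow> ('r, 'a \<times> 'b) config" where
  "pair_config x y = (\<lambda>g. (x g, y g))"

definition pair_pat :: "nat \<Rightarrow> ('r, 'a) config \<times> ('r, 'b) config \<Rightarrow> ('r, 'a \<times> 'b) config" where
  "pair_pat k = (\<lambda>(p, p'). trunc k (pair_config p p'))"

lemma trunc_idem: "p \<in> range (trunc k) \<Longrightarrow> trunc k p = p"
  by auto

lemma trunc_pair_config_eq_iff:
  assumes "p \<in> range (trunc k)" "p' \<in> range (trunc k)"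
  shows "trunc k (pair_config x y) = pair_pat k (p, p') \<longleftrightarrow> trunc k x = p \<and> trunc k y = p'"
proof -
  have "trunc k (pair_config x y) = pair_pat k (p, p') \<longleftrightarrow> trunc k x = trunc k p \<and> trunc k y = trunc k p'"
    unfolding pair_pat_def prod.case trunc_eq_iff by (auto simp: pair_config_def)
  then show ?thesis unfolding trunc_idem[OF assms(1)] trunc_idem[OF assms(2)] .
qed

lemma bij_betw_pair_pat:
  "bij_betw (pair_pat k :: ('r, 'a) config \<times> ('r, 'b) config \<Rightarrow> _)
     (range (trunc k) \<times> range (trunc k)) (range (trunc k))"
  unfolding bij_betw_def
proof
  show "inj_on (pair_pat k :: ('r, 'a) config \<times> ('r, 'b) config \<Rightarrow> _) (range (trunc k) \<times> range (trunc k))"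
  proof (rule inj_onI, unfold split_paired_all)
    fix p q :: "('r, 'a) config" and p' q' :: "('r, 'b) config"
    assume "(p, p') \<in> range (trunc k) \<times> range (trunc k)" "(q, q') \<in> range (trunc k) \<times> range (trunc k)"
      and "pair_pat k (p, p') = pair_pat k (q, q')"
    then have a: "p \<in> range (trunc k)" "p' \<in> range (trunc k)" "q \<in> range (trunc k)" "q' \<in> range (trunc k)"
      and "trunc k (pair_config p p') = pair_pat k (q, q')" by (simp_all add: pair_pat_def)
    then have "trunc k p = q \<and> trunc k p' = q'" by (simp only: trunc_pair_config_eq_iff)
    then show "(p, p') = (q, q')" unfolding trunc_idem[OF a(1)] trunc_idem[OF a(2)] by simp
  qed
  show "(pair_pat k :: ('r, 'a) config \<times> ('r, 'b) config \<Rightarrow> _) ` (range (trunc k) \<times> range (trunc k)) = range (trunc k)"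
  proof (intro subset_antisym subsetI)
    fix z :: "('r, 'a \<times> 'b) config" assume "z \<in> range (trunc k)"
    then obtain y where "z = trunc k y" by blast
    then have "z = pair_pat k (trunc k (\<lambda>g. fst (y g)), trunc k (\<lambda>g. snd (y g)))"
      by (auto simp: pair_pat_def pair_config_def trunc_def fun_eq_iff)
    then show "z \<in> pair_pat k ` (range (trunc k) \<times> range (trunc k))" by blast
  qed (auto simp: pair_pat_def)
qed

lemma xlnx_mult: "a \<ge> 0 \<Longrightarrow> b \<ge> 0 \<Longrightarrow> xlnx (a * b) = a * xlnx b + b * xlnx a"
  by (cases "a = 0 \<or> b = 0") (auto simp: xlnx_def ln_mult algebra_simps)

lemma sum_xlnx_product:
  assumes "\<And>x. x \<in> S \<Longrightarrow> a x \<ge> 0" "(\<Sum>x\<in>S. a x) = 1"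
  shows "(\<Sum>(x, y)\<in>S \<times> S. xlnx (a x * a y)) = 2 * (\<Sum>x\<in>S. xlnx (a x))"
proof -
  have "(\<Sum>(x, y)\<in>S \<times> S. xlnx (a x * a y)) = (\<Sum>(x, y)\<in>S \<times> S. a x * xlnx (a y) + a y * xlnx (a x))"
    by (rule sum.cong) (auto simp: xlnx_mult assms(1))
  also have "\<dots> = (\<Sum>x\<in>S. \<Sum>y\<in>S. a x * xlnx (a y)) + (\<Sum>x\<in>S. \<Sum>y\<in>S. xlnx (a x) * a y)"
    by (simp add: sum.cartesian_product[symmetric] sum.distrib mult.commute)
  also have "(\<Sum>x\<in>S. \<Sum>y\<in>S. a x * xlnx (a y)) = (\<Sum>y\<in>S. xlnx (a y))"
    using sum_product[of a S "\<lambda>y. xlnx (a y)" S] assms(2) by simp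
  also have "(\<Sum>x\<in>S. \<Sum>y\<in>S. xlnx (a x) * a y) = (\<Sum>x\<in>S. xlnx (a x))"
    using sum_product[of "\<lambda>x. xlnx (a x)" S a S] assms(2) by simp
  finally show ?thesis by simp
qed

lemma measurable_pair_config:
  fixes \<mu> \<mu>' :: "('r::finite, 'a::finite) config measure"
  assumes "sets \<mu> = sets config_space" "sets \<mu>' = sets config_space"
  shows "(\<lambda>(x, y). pair_config x y) \<in> \<mu> \<Otimes>\<^sub>M \<mu>' \<rightarrow>\<^sub>M config_space"
proof (rule measurable_config_map)
  fix h
  have c: "(\<lambda>x. x h) \<in> \<mu> \<rightarrow>\<^sub>M count_space (UNIV :: 'a set)" "(\<lambda>x. x h) \<in> \<mu>' \<rightarrow>\<^sub>M count_space (UNIV :: 'a set)"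
    using measurable_config_component[of h] measurable_cong_sets[OF assms(1) refl] measurable_cong_sets[OF assms(2) refl] by auto
  have "(\<lambda>z. (fst z h, snd z h)) \<in> \<mu> \<Otimes>\<^sub>M \<mu>' \<rightarrow>\<^sub>M count_space (UNIV :: 'a set) \<Otimes>\<^sub>M count_space (UNIV :: 'a set)"
    using c by measurable
  then show "(\<lambda>x. (case x of (x, y) \<Rightarrow> pair_config x y) h) \<in> \<mu> \<Otimes>\<^sub>M \<mu>' \<rightarrow>\<^sub>M count_space UNIV"
    by (simp add: pair_measure_countable pair_config_def case_prod_beta)
qed

lemma product_self_joining_eq:
  "product_self_joining \<mu> = distr (\<mu> \<Otimes>\<^sub>M \<mu>) config_space (\<lambda>(x, y). pair_config x y)"
  unfolding product_self_joining_def pair_config_def by (rule arg_cong[where f = "distr _ _"]) auto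

lemma product_self_joining_config_probs:
  fixes \<mu> :: "('r::finite, 'a::finite) config measure"
  assumes \<mu>: "\<mu> \<in> config_probs"
  shows "product_self_joining \<mu> \<in> config_probs"
proof -
  note \<mu>' = config_probsD[OF \<mu>]
  interpret prob_space \<mu> by (rule \<mu>')
  interpret P: pair_prob_space \<mu> \<mu> ..
  show ?thesis
    unfolding product_self_joining_eq config_probs_def
    using P.prob_space_distr[OF measurable_pair_config[OF \<mu>'(2) \<mu>'(2)]] by simp
qed

lemma measure_product_self_joining:
  fixes \<mu> :: "('r::finite, 'a::finite) config measure"
  assumes \<mu>: "\<mu> \<in> config_probs" and S: "S \<in> sets config_space"
    and eq: "\<And>x y. pair_config x y \<in> S \<longleftrightarrow> x \<in> A \<and> y \<in> B"
    and AB: "A \<in> sets config_space" "B \<in> sets config_space"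
  shows "measure (product_self_joining \<mu>) S = measure \<mu> A * measure \<mu> B"
proof -
  note \<mu>' = config_probsD[OF \<mu>]
  interpret prob_space \<mu> by (rule \<mu>')
  have "measure (product_self_joining \<mu>) S = measure (\<mu> \<Otimes>\<^sub>M \<mu>) ((\<lambda>(x, y). pair_config x y) -` S \<inter> space (\<mu> \<Otimes>\<^sub>M \<mu>))"
    unfolding product_self_joining_eq by (rule measure_distr[OF measurable_pair_config[OF \<mu>'(2) \<mu>'(2)] S])
  also have "(\<lambda>(x, y). pair_config x y) -` S \<inter> space (\<mu> \<Otimes>\<^sub>M \<mu>) = A \<times> B"
    using eq by (auto simp: space_pair_measure \<mu>')
  also have "measure (\<mu> \<Otimes>\<^sub>M \<mu>) (A \<times> B) = measure \<mu> A * measure \<mu> B"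
    using AB unfolding measure_def by (subst emeasure_pair_measure_Times) (simp_all add: \<mu>' enn2real_mult)
  finally show ?thesis .
qed

lemma block_entropy_product:
  fixes \<mu> :: "('r::finite, 'a::finite) config measure"
  assumes \<mu>: "\<mu> \<in> invariant_probs"
  shows "block_entropy k (product_self_joining \<mu>) = 2 * block_entropy k \<mu>"
proof -
  note cp = invariant_probsD[OF \<mu>]
  note \<mu>' = config_probsD[OF cp]
  interpret prob_space \<mu> by (rule \<mu>')
  let ?P = "range (trunc k) :: ('r, 'a) config set"
  let ?Q = "range (trunc k) :: ('r, 'a \<times> 'a) config set"
  let ?\<pi> = "product_self_joining \<mu>"
  have v: "vertex_stat k ?\<pi> (pair_pat k (p, p')) = vertex_stat k \<mu> p * vertex_stat k \<mu> p'"
    if "p \<in> ?P" "p' \<in> ?P" for p p'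
    unfolding vertex_stat_def using trunc_pair_config_eq_iff[OF that]
    by (intro measure_product_self_joining[OF cp] cyl_set_sets[OF cyl_set_fibre]) auto
  have sh: "shift g (pair_config x y) = pair_config (shift g x) (shift g y)" for g and x y :: "('r, 'a) config"
    by (simp add: shift_def pair_config_def)
  have e: "edge_stat k ?\<pi> i (pair_pat k (p, p'), pair_pat k (q, q')) = edge_stat k \<mu> i (p, q) * edge_stat k \<mu> i (p', q')"
    if "p \<in> ?P" "p' \<in> ?P" "q \<in> ?P" "q' \<in> ?P" for i p p' q q'
    unfolding edge_stat_def
    using trunc_pair_config_eq_iff[OF that(1,2)] trunc_pair_config_eq_iff[OF that(3,4)]
    by (intro measure_product_self_joining[OF cp] cyl_set_sets[OF cyl_set_edge_set])
       (auto simp: edge_set_def sh)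
  have one: "(\<Sum>p\<in>?P. vertex_stat k \<mu> p) = 1"
  proof -
    have "measure \<mu> UNIV = (\<Sum>p\<in>trunc k ` UNIV. measure \<mu> {x. trunc k x = p})"
      by (rule measure_cyl_set_sum[OF cp]) (simp add: cyl_set_def)
    then show ?thesis using prob_space by (simp add: vertex_stat_def \<mu>')
  qed
  have "(\<Sum>p\<in>?Q. xlnx (vertex_stat k ?\<pi> p)) = (\<Sum>x\<in>?P \<times> ?P. xlnx (vertex_stat k ?\<pi> (pair_pat k x)))"
    by (rule sum.reindex_bij_betw[OF bij_betw_pair_pat, symmetric])
  also have "\<dots> = (\<Sum>(p, p')\<in>?P \<times> ?P. xlnx (vertex_stat k \<mu> p * vertex_stat k \<mu> p'))"
    by (rule sum.cong) (auto simp: v)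
  also have "\<dots> = 2 * (\<Sum>p\<in>?P. xlnx (vertex_stat k \<mu> p))"
    by (rule sum_xlnx_product[OF _ one]) (simp add: vertex_stat_def)
  finally have V: "(\<Sum>p\<in>?Q. xlnx (vertex_stat k ?\<pi> p)) = 2 * (\<Sum>p\<in>?P. xlnx (vertex_stat k \<mu> p))" .
  have E: "(\<Sum>z\<in>?Q \<times> ?Q. xlnx (edge_stat k ?\<pi> i z)) = 2 * (\<Sum>z\<in>?P \<times> ?P. xlnx (edge_stat k \<mu> i z))" for i
  proof -
    let ?f = "\<lambda>((p, q), (p', q')). (pair_pat k (p, p'), pair_pat k (q, q'))"
    have "bij_betw (\<lambda>((p, q), (p', q')). ((p, p'), (q, q'))) ((?P \<times> ?P) \<times> (?P \<times> ?P)) ((?P \<times> ?P) \<times> (?P \<times> ?P))"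
      by (rule bij_betwI[where g = "\<lambda>((p, p'), (q, q')). ((p, q), (p', q'))"]) auto
    from bij_betw_trans[OF this bij_betw_map_prod[OF bij_betw_pair_pat bij_betw_pair_pat]]
    have b: "bij_betw ?f ((?P \<times> ?P) \<times> (?P \<times> ?P)) (?Q \<times> ?Q)"
      by (rule bij_betw_cong[THEN iffD1, rotated]) auto
    have "(\<Sum>z\<in>?Q \<times> ?Q. xlnx (edge_stat k ?\<pi> i z)) = (\<Sum>x\<in>(?P \<times> ?P) \<times> (?P \<times> ?P). xlnx (edge_stat k ?\<pi> i (?f x)))"
      by (rule sum.reindex_bij_betw[OF b, symmetric])
    also have "\<dots> = (\<Sum>(z, z')\<in>(?P \<times> ?P) \<times> (?P \<times> ?P). xlnx (edge_stat k \<mu> i z * edge_stat k \<mu> i z'))"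
    proof (rule sum.cong[OF refl])
      fix x assume "x \<in> (?P \<times> ?P) \<times> (?P \<times> ?P)"
      then obtain p q p' q' where x: "x = ((p, q), (p', q'))" "p \<in> ?P" "q \<in> ?P" "p' \<in> ?P" "q' \<in> ?P"
        by (metis SigmaE)
      show "xlnx (edge_stat k ?\<pi> i (?f x)) = (case x of (z, z') \<Rightarrow> xlnx (edge_stat k \<mu> i z * edge_stat k \<mu> i z'))"
        unfolding x(1) prod.case e[OF x(2,4,3,5)] ..
    qed
    also have "\<dots> = 2 * (\<Sum>z\<in>?P \<times> ?P. xlnx (edge_stat k \<mu> i z))"
      by (rule sum_xlnx_product[OF _ edge_stat_marginals(3)[OF \<mu>]]) (simp add: edge_stat_def)
    finally show ?thesis .
  qed
  show ?thesis
    unfolding block_entropy_def bethe_def V E by (simp add: sum_distrib_left[symmetric] algebra_simps)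
qed

lemma f_invariant_product_le:
  fixes \<mu> :: "('r::finite, 'a::finite) config measure"
  assumes \<mu>: "\<mu> \<in> invariant_probs" and f: "f_invariant \<mu> = ereal \<phi>"
  shows "f_invariant (product_self_joining \<mu>) \<le> ereal (2 * \<phi>)"
proof (rule ccontr)
  assume "\<not> f_invariant (product_self_joining \<mu>) \<le> ereal (2 * \<phi>)"
  then obtain c where c: "ereal (2 * \<phi>) < ereal c" "ereal c < f_invariant (product_self_joining \<mu>)"
    using ereal_dense2[of "ereal (2 * \<phi>)"] by (auto simp: not_le)
  have "c / 2 \<le> block_entropy k \<mu>" for k
  proof -
    have "ereal c \<le> ereal (block_entropy k (product_self_joining \<mu>))"
      using c(2) f_invariant_le_block_entropy[OF product_self_joining_config_probs[OF invariant_probsD[OF \<mu>]], of k]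
      by (rule order_trans[OF less_imp_le])
    then show ?thesis by (simp add: block_entropy_product[OF \<mu>])
  qed
  from f_invariant_ge_block_entropy[OF \<mu> this] have "c / 2 \<le> \<phi>" using f by simp
  then show False using c(1) by simp
qed

section \<open>Weak limits of empirical distributions\<close>


definition cylinders :: "('r, 'a) config set set" where
  "cylinders = {S. \<exists>k. cyl_set k S}"

lemma cylindersI: "cyl_set k S \<Longrightarrow> S \<in> cylinders"
  by (auto simp: cylinders_def)

lemma cylinders_sets: "S \<in> cylinders \<Longrightarrow> S \<in> sets config_space"
  for S :: "('r::finite, 'a::finite) config set"
  by (auto simp: cylinders_def dest: cyl_set_sets)

lemma cyl_set_Un: "cyl_set k A \<Longrightarrow> cyl_set k B \<Longrightarrow> cyl_set k (A \<union> B)"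
  unfolding cyl_set_def by blast

lemma cyl_set_Compl: "cyl_set k A \<Longrightarrow> cyl_set k (- A)"
  unfolding cyl_set_def by (metis ComplD ComplI)

lemma cyl_set_Int: "cyl_set k A \<Longrightarrow> cyl_set k B \<Longrightarrow> cyl_set k (A \<inter> B)"
  unfolding cyl_set_def by blast

lemma cylinders_common:
  assumes "A \<in> cylinders" "B \<in> cylinders"
  obtains k where "cyl_set k A" "cyl_set k B"
proof -
  obtain k l where "cyl_set k A" "cyl_set l B" using assms by (auto simp: cylinders_def)
  then have "cyl_set (max k l) A" "cyl_set (max k l) B" by (auto intro: cyl_set_mono)
  then show thesis by (rule that)
qed

lemma cylinders_Un: "A \<in> cylinders \<Longrightarrow> B \<in> cylinders \<Longrightarrow> A \<union> B \<in> cylinders"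
  by (metis cylinders_common cylindersI cyl_set_Un)

lemma cylinders_Int: "A \<in> cylinders \<Longrightarrow> B \<in> cylinders \<Longrightarrow> A \<inter> B \<in> cylinders"
  by (metis cylinders_common cylindersI cyl_set_Int)

lemma cylinders_Compl: "A \<in> cylinders \<Longrightarrow> - A \<in> cylinders"
  unfolding cylinders_def using cyl_set_Compl by blast

lemma cylinders_UNIV: "UNIV \<in> cylinders"
  by (rule cylindersI[of 0]) (simp add: cyl_set_def)

lemma cylinders_empty: "{} \<in> cylinders"
  by (rule cylindersI[of 0]) (simp add: cyl_set_def)

lemma ring_of_sets_cylinders: "ring_of_sets UNIV cylinders"
  unfolding ring_of_sets_iff Diff_eq
  by (auto intro: cylinders_Un cylinders_Int cylinders_Compl cylinders_empty)

lemma sets_config_space_cylinders: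
  "sets (config_space :: ('r::finite, 'a::finite) config measure) = sigma_sets UNIV cylinders"
proof
  let ?N = "sigma UNIV (cylinders :: ('r, 'a) config set set)"
  have "sets (config_space :: ('r, 'a) config measure) \<subseteq> sets ?N"
    unfolding config_space_def
  proof (rule sets_PiM_in_sets)
    fix i :: "'r free_word" and A :: "'a set"
    have "cyl_set (word_length i) {x :: ('r, 'a) config. x i \<in> A}"
      unfolding cyl_set_def trunc_eq_iff by auto
    then have "{x :: ('r, 'a) config. x i \<in> A} \<in> cylinders" by (rule cylindersI)
    then show "{x \<in> space ?N. x i \<in> A} \<in> sets ?N" by (simp add: space_measure_of_conv)
  qed (simp add: space_measure_of_conv)
  then show "sets (config_space :: ('r, 'a) config measure) \<subseteq> sigma_sets UNIV cylinders" by simp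
  show "sigma_sets UNIV cylinders \<subseteq> sets (config_space :: ('r, 'a) config measure)"
    using sets.sigma_sets_subset[of cylinders "config_space :: ('r, 'a) config measure"] cylinders_sets by auto
qed

lemma config_probs_eqI:
  fixes \<nu> \<nu>' :: "('r::finite, 'a::finite) config measure"
  assumes \<nu>: "\<nu> \<in> config_probs" and \<nu>': "\<nu>' \<in> config_probs"
    and eq: "\<And>S. S \<in> cylinders \<Longrightarrow> measure \<nu> S = measure \<nu>' S"
  shows "\<nu> = \<nu>'"
proof -
  interpret N: prob_space \<nu> by (rule config_probsD[OF \<nu>])
  interpret N': prob_space \<nu>' by (rule config_probsD[OF \<nu>'])
  show ?thesis
  proof (rule measure_eqI_generator_eq[where E = cylinders and \<Omega> = UNIV and A = "\<lambda>_. UNIV"])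
    show "Int_stable (cylinders :: ('r, 'a) config set set)" by (simp add: Int_stable_def cylinders_Int)
    show "sets \<nu> = sigma_sets UNIV cylinders" "sets \<nu>' = sigma_sets UNIV cylinders"
      using config_probsD(2)[OF \<nu>] config_probsD(2)[OF \<nu>'] sets_config_space_cylinders by auto
    show "emeasure \<nu> X = emeasure \<nu>' X" if "X \<in> cylinders" for X
      using eq[OF that] by (simp add: N.emeasure_eq_measure N'.emeasure_eq_measure)
  qed (auto simp: cylinders_UNIV)
qed

lemma decseq_cylinders_Inter_empty:
  fixes A :: "nat \<Rightarrow> ('r::finite, 'a::finite) config set"
  assumes A: "range A \<subseteq> cylinders" "decseq A" "(\<Inter>i. A i) = {}"
  shows "\<exists>i. A i = {}"
proof (rule ccontr)
  assume ne: "\<not> (\<exists>i. A i = {})"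
  let ?T = "product_topology (\<lambda>_. discrete_topology UNIV) UNIV :: ('r, 'a) config topology"
  have op: "openin ?T S" if S: "S \<in> cylinders" for S :: "('r, 'a) config set"
    unfolding openin_product_topology_alt
  proof
    fix x assume x: "x \<in> S"
    obtain k where k: "cyl_set k S" using S by (auto simp: cylinders_def)
    let ?U = "\<lambda>g. if word_length g \<le> k then {x g} else UNIV"
    have "{i. ?U i \<noteq> (UNIV :: 'a set)} \<subseteq> {g. word_length g \<le> k}" by auto
    then have "finite {i. ?U i \<noteq> (UNIV :: 'a set)}" by (rule finite_subset[OF _ finite_ball])
    moreover have "Pi\<^sub>E UNIV ?U \<subseteq> S"
    proof
      fix y assume "y \<in> Pi\<^sub>E UNIV ?U"
      then have "trunc k x = trunc k y" unfolding trunc_eq_iff PiE_UNIV_domain Pi_iff by (metis UNIV_I singletonD)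
      then show "y \<in> S" using k x unfolding cyl_set_def by blast
    qed
    moreover have "x \<in> Pi\<^sub>E UNIV ?U" by (auto simp: PiE_UNIV_domain)
    ultimately show "\<exists>U. finite {i \<in> UNIV. U i \<noteq> topspace (discrete_topology (UNIV :: 'a set))} \<and>
      (\<forall>i\<in>UNIV. openin (discrete_topology UNIV) (U i)) \<and> x \<in> Pi\<^sub>E UNIV U \<and> Pi\<^sub>E UNIV U \<subseteq> S"
      by (intro exI[of _ ?U]) simp
  qed
  have "compact_space ?T" by (simp add: compact_space_product_topology compact_space_discrete_topology)
  moreover have "closedin ?T (A n)" for n
  proof -
    have "A n \<in> cylinders" using A(1) by blast
    from op[OF cylinders_Compl[OF this]] show ?thesis by (simp add: closedin_def Compl_eq_Diff_UNIV)
  qed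
  ultimately have "(\<Inter>n. A n) \<noteq> {}"
    using ne A(2) by (intro compact_space_imp_nest[of ?T A]) auto
  with A(3) show False by simp
qed

text \<open>Weak limits exist because a finitely additive function on the cylinder sets is
  automatically countably additive, by compactness.\<close>

lemma cylinder_limit_measure:
  fixes \<eta> :: "nat \<Rightarrow> ('r::finite, 'a::finite) config measure"
  assumes \<eta>: "\<And>j. \<eta> j \<in> config_probs"
    and L: "\<And>S. S \<in> cylinders \<Longrightarrow> (\<lambda>j. measure (\<eta> j) S) \<longlonglongrightarrow> L S"
  obtains \<nu> where "\<nu> \<in> config_probs" "\<And>S. S \<in> cylinders \<Longrightarrow> measure \<nu> S = L S"
proof -
  interpret ring_of_sets UNIV "cylinders :: ('r, 'a) config set set" by (rule ring_of_sets_cylinders)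
  have L0: "L S \<ge> 0" if "S \<in> cylinders" for S
    by (rule LIMSEQ_le_const[OF L[OF that]]) simp
  have Lemp: "L {} = 0"
    using L[OF cylinders_empty] by (simp add: LIMSEQ_const_iff)
  have L1: "L UNIV = 1"
  proof -
    have "measure (\<eta> j) UNIV = 1" for j
      using prob_space.prob_space[OF config_probsD(1)[OF \<eta>]] by (simp add: config_probsD(3)[OF \<eta>])
    then show ?thesis using L[OF cylinders_UNIV] by (simp add: LIMSEQ_const_iff)
  qed
  have Ladd: "L (A \<union> B) = L A + L B" if "A \<in> cylinders" "B \<in> cylinders" "A \<inter> B = {}" for A B
  proof (rule LIMSEQ_unique[OF L[OF cylinders_Un[OF that(1,2)]]])
    have "measure (\<eta> j) (A \<union> B) = measure (\<eta> j) A + measure (\<eta> j) B" for j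
    proof -
      interpret prob_space "\<eta> j" by (rule config_probsD[OF \<eta>])
      show ?thesis using that cylinders_sets by (intro finite_measure_Union) (auto simp: config_probsD[OF \<eta>])
    qed
    then show "(\<lambda>j. measure (\<eta> j) (A \<union> B)) \<longlonglongrightarrow> L A + L B"
      using tendsto_add[OF L[OF that(1)] L[OF that(2)]] by simp
  qed
  have "\<exists>m :: ('r, 'a) config set \<Rightarrow> ennreal. (\<forall>S\<in>cylinders. m S = ennreal (L S)) \<and> measure_space UNIV (sigma_sets UNIV cylinders) m"
  proof (rule caratheodory_empty_continuous)
    show "positive cylinders (\<lambda>S. ennreal (L S))" by (simp add: positive_def Lemp)
    show "additive cylinders (\<lambda>S. ennreal (L S))"
      by (auto simp: additive_def Ladd L0)
    fix A :: "nat \<Rightarrow> ('r, 'a) config set"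
    assume A: "range A \<subseteq> cylinders" "decseq A" "(\<Inter>i. A i) = {}"
    then obtain i where i: "A i = {}" using decseq_cylinders_Inter_empty by blast
    have "\<forall>\<^sub>F j in sequentially. ennreal (L (A j)) = 0"
      using eventually_ge_at_top[of i]
    proof eventually_elim
      case (elim j)
      then have "A j = {}" using A(2) i unfolding decseq_def by blast
      then show ?case by (simp add: Lemp)
    qed
    then show "(\<lambda>i. ennreal (L (A i))) \<longlonglongrightarrow> 0" by (rule tendsto_eventually)
  qed simp
  then obtain m where m: "\<And>S. S \<in> cylinders \<Longrightarrow> m S = ennreal (L S)"
    and ms: "measure_space UNIV (sigma_sets UNIV (cylinders :: ('r, 'a) config set set)) m" by blast
  define \<nu> where "\<nu> = measure_of UNIV (cylinders :: ('r, 'a) config set set) m"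
  have s\<nu>: "sets \<nu> = sigma_sets UNIV cylinders" by (simp add: \<nu>_def)
  have em: "emeasure \<nu> S = ennreal (L S)" if "S \<in> cylinders" for S
  proof -
    have "emeasure \<nu> S = m S"
      using ms that unfolding measure_space_def
      by (intro emeasure_measure_of[OF \<nu>_def]) (auto simp: s\<nu>)
    then show ?thesis by (simp add: m[OF that])
  qed
  have sets: "sets \<nu> = sets config_space"
    by (simp add: s\<nu> sets_config_space_cylinders)
  have "space \<nu> = UNIV" by (simp add: \<nu>_def space_measure_of_conv)
  then have "prob_space \<nu>" by (intro prob_spaceI) (simp add: em[OF cylinders_UNIV] L1)
  then have "\<nu> \<in> config_probs" using sets by (simp add: config_probs_def)
  moreover have "measure \<nu> S = L S" if "S \<in> cylinders" for S
    using em[OF that] L0[OF that] by (simp add: measure_def)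
  ultimately show thesis by (rule that)
qed

lemma countable_cylinders: "countable (cylinders :: ('r::finite, 'a::finite) config set set)"
proof -
  have "finite {S :: ('r, 'a) config set. cyl_set k S}" for k
  proof (rule finite_imageD[of "\<lambda>S. trunc k ` S"])
    show "finite ((\<lambda>S. trunc k ` S) ` {S :: ('r, 'a) config set. cyl_set k S})"
      by (rule finite_subset[of _ "Pow (range (trunc k))"]) (auto simp: finite_pats)
    show "inj_on (\<lambda>S. trunc k ` S) {S :: ('r, 'a) config set. cyl_set k S}"
    proof (rule inj_onI)
      fix S T :: "('r, 'a) config set"
      assume "S \<in> {S. cyl_set k S}" "T \<in> {S. cyl_set k S}" and eq: "trunc k ` S = trunc k ` T"
      then have "cyl_set k S" "cyl_set k T" by auto
      from cyl_set_UN[OF this(1)] cyl_set_UN[OF this(2)] show "S = T" unfolding eq by (rule trans[OF _ sym])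
    qed
  qed
  then have "countable (\<Union>k. {S :: ('r, 'a) config set. cyl_set k S})" 
    by (intro Countable_Set.countable_UN countableI_type countable_finite)
  moreover have "cylinders = (\<Union>k. {S :: ('r, 'a) config set. cyl_set k S})" by (auto simp: cylinders_def)
  ultimately show ?thesis by simp
qed

lemma config_probs_convergent_subsequence:
  fixes \<eta> :: "nat \<Rightarrow> ('r::finite, 'a::finite) config measure"
  assumes \<eta>: "\<And>j. \<eta> j \<in> config_probs"
  obtains s \<nu> where "strict_mono s" "\<nu> \<in> config_probs"
    "\<And>S. S \<in> cylinders \<Longrightarrow> (\<lambda>j. measure (\<eta> (s j)) S) \<longlonglongrightarrow> measure \<nu> S"
proof -
  have "norm (measure (\<eta> j) S) \<le> 1" for j S
    using prob_space.prob_le_1[OF config_probsD(1)[OF \<eta>]] by simp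
  then obtain s where s: "strict_mono s"
    and "\<And>S. S \<in> cylinders \<Longrightarrow> \<exists>l. (\<lambda>j. measure (\<eta> (s j)) S) \<longlonglongrightarrow> l"
    using function_convergent_subsequence[OF countable_cylinders, of "\<lambda>j S. measure (\<eta> j) S" 1] by blast
  then obtain L where L: "\<And>S. S \<in> cylinders \<Longrightarrow> (\<lambda>j. measure (\<eta> (s j)) S) \<longlonglongrightarrow> L S" by metis
  obtain \<nu> where "\<nu> \<in> config_probs" "\<And>S. S \<in> cylinders \<Longrightarrow> measure \<nu> S = L S"
    using cylinder_limit_measure[of "\<lambda>j. \<eta> (s j)" L] \<eta> L by blast
  with s L show thesis by (intro that[of s \<nu>]) auto
qed

lemma cylinders_shift: "S \<in> cylinders \<Longrightarrow> {y. shift g y \<in> S} \<in> cylinders"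
proof -
  assume "S \<in> cylinders"
  then obtain k where k: "cyl_set k S" by (auto simp: cylinders_def)
  have "cyl_set (k + word_length g) {y. shift g y \<in> S}"
    unfolding cyl_set_def mem_Collect_eq using k trunc_shift_eq[of k g] unfolding cyl_set_def by blast
  then show ?thesis by (rule cylindersI)
qed

lemma measure_empirical_shift:
  fixes S :: "('r::finite, 'a::finite) config set"
  assumes \<sigma>: "\<sigma> \<in> sym_homs n" and S: "S \<in> sets config_space"
  shows "measure (empirical {1..n} \<sigma> x) {y. shift g y \<in> S} = measure (empirical {1..n} \<sigma> x) S"
proof -
  note perm = sym_homsD(1)[OF \<sigma>, of g]
  have S': "{y. shift g y \<in> S} \<in> sets config_space"
    using measurable_sets[OF measurable_shift S, of g] by (simp add: vimage_def)
  have "bij_betw (\<sigma> g) {v \<in> {1..n}. pullback \<sigma> x v \<in> {y. shift g y \<in> S}} {v \<in> {1..n}. pullback \<sigma> x v \<in> S}"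
  proof (rule bij_betw_subset[OF permutes_imp_bij[OF perm]])
    show "\<sigma> g ` {v \<in> {1..n}. pullback \<sigma> x v \<in> {y. shift g y \<in> S}} = {v \<in> {1..n}. pullback \<sigma> x v \<in> S}"
    proof (intro subset_antisym subsetI)
      fix u assume u: "u \<in> {v \<in> {1..n}. pullback \<sigma> x v \<in> S}"
      define v where "v = inv_into UNIV (\<sigma> g) u"
      have "\<sigma> g v = u" "v \<in> {1..n}"
        unfolding v_def using u permutes_inverses[OF perm] permutes_in_image[OF permutes_inv[OF perm]] by auto
      then show "u \<in> \<sigma> g ` {v \<in> {1..n}. pullback \<sigma> x v \<in> {y. shift g y \<in> S}}"
        using u by (intro image_eqI[of _ _ v]) (auto simp: pullback_shift[OF \<sigma>])
    next
      fix u assume "u \<in> \<sigma> g ` {v \<in> {1..n}. pullback \<sigma> x v \<in> {y. shift g y \<in> S}}"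
      then obtain v where v: "u = \<sigma> g v" "v \<in> {1..n}" "pullback \<sigma> x v \<in> {y. shift g y \<in> S}" by blast
      have "u \<in> {1..n}" unfolding v(1) using permutes_in_image[OF perm] v(2) by blast
      moreover have "pullback \<sigma> x u \<in> S" using v(3) by (simp add: v(1) pullback_shift[OF \<sigma>])
      ultimately show "u \<in> {v \<in> {1..n}. pullback \<sigma> x v \<in> S}" by blast
    qed
  qed auto
  then have "card {v \<in> {1..n}. pullback \<sigma> x v \<in> {y. shift g y \<in> S}} = card {v \<in> {1..n}. pullback \<sigma> x v \<in> S}"
    by (rule bij_betw_same_card)
  then show ?thesis using S S' by (simp add: measure_empirical)
qed

definition map_config :: "('a \<Rightarrow> 'b) \<Rightarrow> ('r, 'a) config \<Rightarrow> ('r, 'b) config" where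
  "map_config f z = (\<lambda>g. f (z g))"

lemma measurable_map_config: "map_config f \<in> config_space \<rightarrow>\<^sub>M config_space"
proof (rule measurable_config_map)
  fix h
  show "(\<lambda>x. map_config f x h) \<in> config_space \<rightarrow>\<^sub>M count_space UNIV"
    unfolding map_config_def
    by (rule measurable_compose[OF measurable_config_component]) simp
qed

lemma cylinders_map_config: "S \<in> cylinders \<Longrightarrow> {z. map_config f z \<in> S} \<in> cylinders"
proof -
  assume "S \<in> cylinders"
  then obtain k where k: "cyl_set k S" by (auto simp: cylinders_def)
  have "trunc k (map_config f x) = trunc k (map_config f y)" if "trunc k x = trunc k y" for x y
    using that unfolding trunc_eq_iff map_config_def by simp
  then have "cyl_set k {z. map_config f z \<in> S}"
    using k unfolding cyl_set_def mem_Collect_eq by blast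
  then show ?thesis by (rule cylindersI)
qed

lemma measure_empirical_map_config:
  fixes S :: "('r::finite, 'b::finite) config set" and z :: "nat \<Rightarrow> 'a::finite"
  assumes \<sigma>: "\<sigma> \<in> sym_homs n" and S: "S \<in> cylinders"
  shows "measure (empirical {1..n} \<sigma> z) {y. map_config f y \<in> S}
    = measure (empirical {1..n} \<sigma> (restrict (\<lambda>v. f (z v)) {1..n})) S"
proof -
  have "map_config f (pullback \<sigma> z v) = pullback \<sigma> (restrict (\<lambda>v. f (z v)) {1..n}) v" if "v \<in> {1..n}" for v
    using permutes_in_image[OF sym_homsD(1)[OF \<sigma>]] that
    by (auto simp: map_config_def pullback_def fun_eq_iff)
  then have "{v \<in> {1..n}. pullback \<sigma> z v \<in> {y. map_config f y \<in> S}}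
    = {v \<in> {1..n}. pullback \<sigma> (restrict (\<lambda>v. f (z v)) {1..n}) v \<in> S}" by auto
  then show ?thesis
    using cylinders_sets[OF S] cylinders_sets[OF cylinders_map_config[OF S, of f]]
    by (simp add: measure_empirical)
qed

lemma distr_map_config_probs:
  fixes \<nu> :: "('r::finite, 'a::finite) config measure"
  assumes \<nu>: "\<nu> \<in> config_probs" and f: "f \<in> config_space \<rightarrow>\<^sub>M (config_space :: ('r, 'b::finite) config measure)"
  shows "distr \<nu> config_space f \<in> config_probs"
    and "S \<in> sets config_space \<Longrightarrow> measure (distr \<nu> config_space f) S = measure \<nu> {y. f y \<in> S}"
proof -
  note \<nu>' = config_probsD[OF \<nu>]
  interpret prob_space \<nu> by (rule \<nu>')
  have m: "f \<in> \<nu> \<rightarrow>\<^sub>M config_space" using f measurable_cong_sets[OF \<nu>'(2) refl] by blast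
  show "distr \<nu> config_space f \<in> config_probs"
    unfolding config_probs_def using prob_space_distr[OF m] by simp
  show "measure (distr \<nu> config_space f) S = measure \<nu> {y. f y \<in> S}" if "S \<in> sets config_space"
    using measure_distr[OF m that] by (simp add: \<nu>' vimage_def)
qed

lemma limit_self_joining:
  fixes \<mu> :: "('r::finite, 'a::finite) config measure"
  assumes \<mu>: "\<mu> \<in> invariant_probs" and n: "\<And>j. n j > (0::nat)" and \<sigma>: "\<And>j. \<sigma> j \<in> sym_homs (n j)"
    and fst: "\<And>j. transport_dist (empirical {1..n j} (\<sigma> j) (restrict (\<lambda>v. fst (z j v)) {1..n j})) \<mu> < 1 / real (Suc j)"
    and snd: "\<And>j. transport_dist (empirical {1..n j} (\<sigma> j) (restrict (\<lambda>v. snd (z j v)) {1..n j})) \<mu> < 1 / real (Suc j)"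
  obtains s \<xi> where "strict_mono s" "\<xi> \<in> self_joinings \<mu>"
    "\<And>S. S \<in> cylinders \<Longrightarrow> (\<lambda>j. measure (empirical {1..n (s j)} (\<sigma> (s j)) (z (s j))) S) \<longlonglongrightarrow> measure \<xi> S"
proof -
  define \<eta> where "\<eta> j = empirical {1..n j} (\<sigma> j) (z j)" for j
  have ep: "empirical {1..n j} (\<sigma> j) x \<in> config_probs" for j and x :: "nat \<Rightarrow> 'b::finite"
    using n[of j] by (intro empirical_config_probs) auto
  have \<eta>: "\<eta> j \<in> config_probs" for j unfolding \<eta>_def by (rule ep)
  obtain s \<xi> where s: "strict_mono s" and \<xi>: "\<xi> \<in> config_probs"
    and lim: "\<And>S. S \<in> cylinders \<Longrightarrow> (\<lambda>j. measure (\<eta> (s j)) S) \<longlonglongrightarrow> measure \<xi> S"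
    using config_probs_convergent_subsequence[of \<eta>, OF \<eta>] by blast
  have inv: "distr \<xi> config_space (shift g) = \<xi>" for g
  proof (rule config_probs_eqI[OF distr_map_config_probs(1)[OF \<xi> measurable_shift] \<xi>])
    fix S :: "('r, 'a \<times> 'a) config set" assume S: "S \<in> cylinders"
    have "(\<lambda>j. measure (\<eta> (s j)) {y. shift g y \<in> S}) = (\<lambda>j. measure (\<eta> (s j)) S)"
      unfolding \<eta>_def using measure_empirical_shift[OF \<sigma> cylinders_sets[OF S]] by simp
    then have "measure \<xi> {y. shift g y \<in> S} = measure \<xi> S"
      using LIMSEQ_unique lim[OF S] lim[OF cylinders_shift[OF S, of g]] by metis
    then show "measure (distr \<xi> config_space (shift g)) S = measure \<xi> S"
      using distr_map_config_probs(2)[OF \<xi> measurable_shift cylinders_sets[OF S]] by simp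
  qed
  have marg: "distr \<xi> config_space (map_config f) = \<mu>"
    if near: "\<And>j. transport_dist (empirical {1..n j} (\<sigma> j) (restrict (\<lambda>v. f (z j v)) {1..n j})) \<mu> < 1 / real (Suc j)"
    for f :: "'a \<times> 'a \<Rightarrow> 'a"
  proof (rule config_probs_eqI[OF distr_map_config_probs(1)[OF \<xi> measurable_map_config] invariant_probsD[OF \<mu>]])
    fix S :: "('r, 'a) config set" assume S: "S \<in> cylinders"
    then obtain k where k: "cyl_set k S" by (auto simp: cylinders_def)
    define C where "C = (5 * real CARD('r) ^ 2) ^ k"
    have C: "C \<ge> 0" by (simp add: C_def)
    have "(\<lambda>j. measure (\<eta> (s j)) {y. map_config f y \<in> S} - measure \<mu> S) \<longlonglongrightarrow> 0"
    proof (rule tendsto_rabs_zero_cancel, rule tendsto_sandwich)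
      show "\<forall>\<^sub>F j in sequentially. (0 :: real) \<le> \<bar>measure (\<eta> (s j)) {y. map_config f y \<in> S} - measure \<mu> S\<bar>" by simp
      show "\<forall>\<^sub>F j in sequentially. \<bar>measure (\<eta> (s j)) {y. map_config f y \<in> S} - measure \<mu> S\<bar> \<le> C * (1 / real (Suc j))"
      proof (rule always_eventually, rule allI)
        fix j
        let ?e = "empirical {1..n (s j)} (\<sigma> (s j)) (restrict (\<lambda>v. f (z (s j) v)) {1..n (s j)})"
        have "\<bar>measure ?e S - measure \<mu> S\<bar> \<le> C * transport_dist ?e \<mu>"
          unfolding C_def by (rule transport_ge_cyl[OF ep invariant_probsD[OF \<mu>] k])
        also have "\<dots> \<le> C * (1 / real (Suc (s j)))" using near[of "s j"] C by (intro mult_left_mono) auto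
        also have "\<dots> \<le> C * (1 / real (Suc j))"
          using C seq_suble[OF s, of j] by (intro mult_left_mono divide_left_mono) auto
        finally show "\<bar>measure (\<eta> (s j)) {y. map_config f y \<in> S} - measure \<mu> S\<bar> \<le> C * (1 / real (Suc j))"
          unfolding \<eta>_def measure_empirical_map_config[OF \<sigma> S] .
      qed
      show "(\<lambda>j. C * (1 / real (Suc j))) \<longlonglongrightarrow> 0"
        using tendsto_mult_right_zero[OF LIMSEQ_inverse_real_of_nat, of C] by (simp add: inverse_eq_divide)
    qed simp
    then have "(\<lambda>j. measure (\<eta> (s j)) {y. map_config f y \<in> S}) \<longlonglongrightarrow> measure \<mu> S"
      by (rule LIM_zero_cancel)
    then have "measure \<xi> {y. map_config f y \<in> S} = measure \<mu> S"
      by (rule LIMSEQ_unique[OF lim[OF cylinders_map_config[OF S, of f]]])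
    then show "measure (distr \<xi> config_space (map_config f)) S = measure \<mu> S"
      using distr_map_config_probs(2)[OF \<xi> measurable_map_config cylinders_sets[OF S]] by simp
  qed
  have "\<xi> \<in> self_joinings \<mu>"
    using inv marg[OF fst] marg[OF snd] config_probsD[OF \<xi>]
    unfolding self_joinings_def invariant_probs_def map_config_def[abs_def] by simp
  with s lim show thesis unfolding \<eta>_def by (intro that[of s \<xi>])
qed

section \<open>The second moment\<close>


definition pair_microstates ::
    "nat \<Rightarrow> ('r::finite, 'a) config measure \<Rightarrow> real \<Rightarrow> ('r free_word \<Rightarrow> nat \<Rightarrow> nat) \<Rightarrow> (nat \<Rightarrow> 'a \<times> 'a) set" where
  "pair_microstates n \<mu> \<epsilon> \<sigma> = {z \<in> {1..n} \<rightarrow>\<^sub>E UNIV.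
     restrict (\<lambda>v. fst (z v)) {1..n} \<in> microstates {1..n} \<sigma> \<mu> \<epsilon> \<and>
     restrict (\<lambda>v. snd (z v)) {1..n} \<in> microstates {1..n} \<sigma> \<mu> \<epsilon>}"

lemma card_pair_microstates:
  fixes \<mu> :: "('r::finite, 'a) config measure"
  shows "card (pair_microstates n \<mu> \<epsilon> \<sigma>) = card (microstates {1..n} \<sigma> \<mu> \<epsilon>) ^ 2"
proof -
  let ?M = "microstates {1..n} \<sigma> \<mu> \<epsilon>"
  have M: "restrict x {1..n} = x" if "x \<in> ?M" for x
    using that by (auto simp: microstates_def)
  have "bij_betw (\<lambda>(x, y). restrict (\<lambda>v. (x v, y v)) {1..n}) (?M \<times> ?M) (pair_microstates n \<mu> \<epsilon> \<sigma>)"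
  proof (rule bij_betwI[where g = "\<lambda>z. (restrict (\<lambda>v. fst (z v)) {1..n}, restrict (\<lambda>v. snd (z v)) {1..n})"])
    have r1: "restrict (\<lambda>v. fst (restrict (\<lambda>v. (a v, b v)) {1..n} v)) {1..n} = restrict a {1..n}"
      and r2: "restrict (\<lambda>v. snd (restrict (\<lambda>v. (a v, b v)) {1..n} v)) {1..n} = restrict b {1..n}"
      for a b :: "nat \<Rightarrow> 'a"
      by (rule restrict_ext; simp)+
    show "(\<lambda>(x, y). restrict (\<lambda>v. (x v, y v)) {1..n}) \<in> ?M \<times> ?M \<rightarrow> pair_microstates n \<mu> \<epsilon> \<sigma>"
    proof (rule funcsetI, clarify)
      fix x y assume xy: "x \<in> ?M" "y \<in> ?M"
      show "restrict (\<lambda>v. (x v, y v)) {1..n} \<in> pair_microstates n \<mu> \<epsilon> \<sigma>"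
        unfolding pair_microstates_def mem_Collect_eq r1 r2 M[OF xy(1)] M[OF xy(2)] using xy by simp
    qed
    show "(\<lambda>z. (restrict (\<lambda>v. fst (z v)) {1..n}, restrict (\<lambda>v. snd (z v)) {1..n})) \<in> pair_microstates n \<mu> \<epsilon> \<sigma> \<rightarrow> ?M \<times> ?M"
      by (auto simp: pair_microstates_def)
    show "(restrict (\<lambda>v. fst ((case p of (x, y) \<Rightarrow> restrict (\<lambda>v. (x v, y v)) {1..n}) v)) {1..n},
        restrict (\<lambda>v. snd ((case p of (x, y) \<Rightarrow> restrict (\<lambda>v. (x v, y v)) {1..n}) v)) {1..n}) = p"
      if pM: "p \<in> ?M \<times> ?M" for p
    proof -
      obtain x y where p: "p = (x, y)" "x \<in> ?M" "y \<in> ?M" using pM by blast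
      show ?thesis unfolding p(1) prod.case r1 r2 M[OF p(2)] M[OF p(3)] ..
    qed
    show "(case (restrict (\<lambda>v. fst (z v)) {1..n}, restrict (\<lambda>v. snd (z v)) {1..n}) of
        (x, y) \<Rightarrow> restrict (\<lambda>v. (x v, y v)) {1..n}) = z" if "z \<in> pair_microstates n \<mu> \<epsilon> \<sigma>" for z
      using that by (auto simp: pair_microstates_def PiE_def extensional_def restrict_def fun_eq_iff)
  qed
  then show ?thesis by (simp add: bij_betw_same_card[symmetric] card_cartesian_product power2_eq_square)
qed

lemma finite_pair_microstates: "finite (pair_microstates n (\<mu> :: ('r::finite, 'a::finite) config measure) \<epsilon> \<sigma>)"
  unfolding pair_microstates_def by (rule finite_subset[of _ "{1..n} \<rightarrow>\<^sub>E UNIV"]) (auto intro: finite_PiE)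

definition same_stat :: "nat \<Rightarrow> nat \<Rightarrow> ('r::finite free_word \<Rightarrow> nat \<Rightarrow> nat) \<times> (nat \<Rightarrow> 'a::finite) \<Rightarrow>
    (('r free_word \<Rightarrow> nat \<Rightarrow> nat) \<times> (nat \<Rightarrow> 'a)) set" where
  "same_stat k n w = {w' \<in> sym_homs n \<times> ({1..n} \<rightarrow>\<^sub>E UNIV).
     vertex_stat k (empirical {1..n} (fst w') (snd w')) = vertex_stat k (empirical {1..n} (fst w) (snd w))}"

lemma finite_same_stat: "finite (same_stat k n w)"
proof -
  have "finite ({1..n} \<rightarrow>\<^sub>E (UNIV :: 'b set))" by (intro finite_PiE) auto
  then show ?thesis unfolding same_stat_def
    by (intro finite_subset[OF _ finite_cartesian_product[OF finite_hom_sym_group[of n]]]) auto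
qed

text \<open>Pigeonhole: there are only polynomially many statistics of radius \<open>k\<close>.\<close>

lemma stat_pigeonhole:
  fixes S :: "(('r::finite free_word \<Rightarrow> nat \<Rightarrow> nat) \<times> (nat \<Rightarrow> 'a::finite)) set"
  assumes S: "S \<subseteq> sym_homs n \<times> ({1..n} \<rightarrow>\<^sub>E UNIV)" "S \<noteq> {}"
  shows "\<exists>w\<in>S. card S \<le> (n + 1) ^ card (range (trunc k) :: ('r, 'a) config set) * card (same_stat k n w)"
proof -
  let ?P = "range (trunc k) :: ('r, 'a) config set"
  have fS: "finite S"
    using S(1) by (rule finite_subset) (intro finite_cartesian_product finite_hom_sym_group finite_PiE; simp)
  define f where "f w = image_mset (block k n (fst w) (snd w)) (mset_set {1..n})"
    for w :: "('r free_word \<Rightarrow> nat \<Rightarrow> nat) \<times> (nat \<Rightarrow> 'a)"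
  let ?F = "\<lambda>w. {w' \<in> S. f w' = f w}"
  let ?c = "\<lambda>w. card (?F w)"
  have "Max (?c ` S) \<in> ?c ` S" using fS S(2) by (intro Max_in) auto
  then obtain w where w: "w \<in> S" and cw: "Max (?c ` S) = ?c w" by blast
  have max: "?c w' \<le> ?c w" if "w' \<in> S" for w'
    unfolding cw[symmetric] using fS that by (intro Max_ge) auto
  have fibre: "?F w \<subseteq> same_stat k n w"
  proof
    fix w' assume w': "w' \<in> ?F w"
    have "vertex_stat k (empirical {1..n} (fst w') (snd w')) p = vertex_stat k (empirical {1..n} (fst w) (snd w)) p" for p
      using w' unfolding count_block[symmetric] by (simp add: f_def)
    then show "w' \<in> same_stat k n w" using w' S(1) unfolding same_stat_def by auto
  qed
  have im: "f ` S \<subseteq> {M. set_mset M \<subseteq> ?P \<and> size M = n}"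
    by (auto simp: f_def block_def)
  have fin: "finite (f ` S)" using fS by simp
  have "S = (\<Union>T\<in>f ` S. {w' \<in> S. f w' = T})" by auto
  then have "card S = card (\<Union>T\<in>f ` S. {w' \<in> S. f w' = T})" by simp
  also have "\<dots> \<le> (\<Sum>T\<in>f ` S. card {w' \<in> S. f w' = T})" by (rule card_UN_le[OF fin])
  also have "\<dots> \<le> of_nat (card (f ` S)) * card (?F w)"
    using max by (intro sum_bounded_above) auto
  also have "\<dots> \<le> (n + 1) ^ card ?P * card (same_stat k n w)"
  proof -
    have "card (f ` S) \<le> card {M. set_mset M \<subseteq> ?P \<and> size M = n}"
      by (rule card_mono[OF card_multisets_of_size(1)[OF finite_pats] im])
    also have "\<dots> \<le> (n + 1) ^ card ?P" by (rule card_multisets_of_size(2)[OF finite_pats])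
    finally show ?thesis
      using card_mono[OF finite_same_stat fibre] by (simp add: mult_mono)
  qed
  finally show ?thesis using w by blast
qed

lemma same_stat_measure:
  fixes w w' :: "('r::finite free_word \<Rightarrow> nat \<Rightarrow> nat) \<times> (nat \<Rightarrow> 'a::finite)"
  assumes n: "n > 0" and w': "w' \<in> same_stat k n w" and S: "cyl_set k S"
  shows "measure (empirical {1..n} (fst w') (snd w')) S = measure (empirical {1..n} (fst w) (snd w)) S"
proof -
  have e: "empirical {1..n} (fst u) (snd u) \<in> config_probs" for u :: "('r free_word \<Rightarrow> nat \<Rightarrow> nat) \<times> (nat \<Rightarrow> 'a)"
    using n by (intro empirical_config_probs) auto
  have "vertex_stat k (empirical {1..n} (fst w') (snd w')) = vertex_stat k (empirical {1..n} (fst w) (snd w))"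
    using w' by (simp add: same_stat_def)
  then show ?thesis
    unfolding measure_cyl_set_sum[OF e S] vertex_stat_def by metis
qed

lemma expected_square:
  fixes \<mu> :: "('r::finite, 'a::finite) config measure"
  shows "measure_pmf.expectation (uniform_hom n) (\<lambda>\<sigma>. real (card (microstates {1..n} \<sigma> \<mu> \<epsilon>)) ^ 2) =
    real (card (SIGMA \<sigma>:sym_homs n. pair_microstates n \<mu> \<epsilon> \<sigma>)) / fact n ^ CARD('r)"
  using expected_card[of "pair_microstates n \<mu> \<epsilon>" n, OF finite_pair_microstates]
  by (simp add: card_pair_microstates)

lemma large_second_moment_witness:
  fixes \<mu> :: "('r::finite, 'a::finite) config measure" and c \<delta> :: real
  assumes \<delta>: "\<delta> > 0"
    and large: "\<not> (\<forall>\<^sub>F n in sequentially. measure_pmf.expectation (uniform_hom n)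
      (\<lambda>\<sigma>. real (card (microstates {1..n} \<sigma> \<mu> (1 / real (Suc j)))) ^ 2) \<le> exp (n * (c + \<delta>)))"
  shows "\<exists>n w. n > j \<and> w \<in> sym_homs n \<times> ({1..n} \<rightarrow>\<^sub>E UNIV) \<and>
    transport_dist (empirical {1..n} (fst w) (restrict (\<lambda>v. fst (snd w v)) {1..n})) \<mu> < 1 / real (Suc j) \<and>
    transport_dist (empirical {1..n} (fst w) (restrict (\<lambda>v. snd (snd w v)) {1..n})) \<mu> < 1 / real (Suc j) \<and>
    exp (n * c) \<le> real (card (same_stat j n w)) / fact n ^ CARD('r)"
proof -
  let ?P = "range (trunc j) :: ('r, 'a \<times> 'a) config set" and ?\<epsilon> = "1 / real (Suc j)"
  let ?E = "\<lambda>n. measure_pmf.expectation (uniform_hom n) (\<lambda>\<sigma>. real (card (microstates {1..n} \<sigma> \<mu> ?\<epsilon>)) ^ 2)"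
  have "\<exists>\<^sub>F n in sequentially. \<not> ?E n \<le> exp (n * (c + \<delta>))"
    using large by (simp add: not_eventually)
  moreover have "\<forall>\<^sub>F n in sequentially. 0 + real (card ?P) * ln (1 + real n) \<le> real n * \<delta>"
    by (rule eventually_log_le_linear[OF \<delta>])
  moreover have "\<forall>\<^sub>F n in sequentially. n > j" by (rule eventually_gt_at_top)
  ultimately have fr: "\<exists>\<^sub>F n in sequentially. \<not> ?E n \<le> exp (n * (c + \<delta>)) \<and>
      (0 + real (card ?P) * ln (1 + real n) \<le> real n * \<delta> \<and> n > j)"
    by (intro frequently_eventually_frequently eventually_conj)
  then obtain n where E: "?E n > exp (n * (c + \<delta>))" and poly: "real (card ?P) * ln (1 + real n) \<le> real n * \<delta>" and n: "n > j"
    using frequently_ex[OF fr] by (auto simp: not_le)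
  define S where "S = (SIGMA \<sigma>:(sym_homs n :: ('r free_word \<Rightarrow> nat \<Rightarrow> nat) set). pair_microstates n \<mu> ?\<epsilon> \<sigma>)"
  have cS: "exp (n * (c + \<delta>)) < real (card S) / fact n ^ CARD('r)"
    using E unfolding expected_square S_def .
  then have "S \<noteq> {}" using exp_gt_zero[of "n * (c + \<delta>)"] by (auto simp: not_less)
  moreover have "S \<subseteq> sym_homs n \<times> ({1..n} \<rightarrow>\<^sub>E UNIV)" by (auto simp: S_def pair_microstates_def)
  ultimately obtain w where w: "w \<in> S" and pig: "card S \<le> (n + 1) ^ card ?P * card (same_stat j n w)"
    using stat_pigeonhole[of S n j] by blast
  have "real (card S) \<le> (1 + real n) ^ card ?P * card (same_stat j n w)"
    using pig by (metis (mono_tags, lifting) add.commute of_nat_1 of_nat_add of_nat_le_iff of_nat_mult of_nat_power)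
  also have "(1 + real n) ^ card ?P = exp (real (card ?P) * ln (1 + real n))"
    by (subst exp_of_nat_mult) simp
  also have "\<dots> * card (same_stat j n w) \<le> exp (real n * \<delta>) * card (same_stat j n w)"
    using poly by (intro mult_right_mono) auto
  finally have "real (card S) / fact n ^ CARD('r) \<le> exp (real n * \<delta>) * (card (same_stat j n w) / fact n ^ CARD('r))"
    by (simp add: divide_right_mono)
  with cS have "exp (real n * \<delta>) * exp (n * c) \<le> exp (real n * \<delta>) * (card (same_stat j n w) / fact n ^ CARD('r))"
    by (simp add: exp_add[symmetric] algebra_simps)
  then have "exp (n * c) \<le> card (same_stat j n w) / fact n ^ CARD('r)"
    by (subst (asm) mult_le_cancel_left_pos) auto
  moreover have "w \<in> sym_homs n \<times> ({1..n} \<rightarrow>\<^sub>E UNIV)"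
    "transport_dist (empirical {1..n} (fst w) (restrict (\<lambda>v. fst (snd w v)) {1..n})) \<mu> < ?\<epsilon>"
    "transport_dist (empirical {1..n} (fst w) (restrict (\<lambda>v. snd (snd w v)) {1..n})) \<mu> < ?\<epsilon>"
    using w unfolding S_def pair_microstates_def microstates_def by auto
  ultimately show ?thesis using n by blast
qed

lemma second_moment_bound:
  fixes \<mu> :: "('r::finite, 'a::finite) config measure" and c \<delta> :: real
  assumes \<mu>: "\<mu> \<in> invariant_probs" and joinings: "\<And>\<xi>. \<xi> \<in> self_joinings \<mu> \<Longrightarrow> f_invariant \<xi> \<le> ereal c"
    and \<delta>: "\<delta> > 0"
  shows "\<exists>\<epsilon>>0. \<forall>\<^sub>F n in sequentially. measure_pmf.expectation (uniform_hom n)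
      (\<lambda>\<sigma>. real (card (microstates {1..n} \<sigma> \<mu> \<epsilon>)) ^ 2) \<le> exp (n * (c + \<delta>))"
proof (rule ccontr)
  assume contra: "\<not> ?thesis"
  let ?c = "c + \<delta> / 2"
  have "\<exists>n w. n > j \<and> w \<in> sym_homs n \<times> ({1..n} \<rightarrow>\<^sub>E UNIV) \<and>
    transport_dist (empirical {1..n} (fst w) (restrict (\<lambda>v. fst (snd w v)) {1..n})) \<mu> < 1 / real (Suc j) \<and>
    transport_dist (empirical {1..n} (fst w) (restrict (\<lambda>v. snd (snd w v)) {1..n})) \<mu> < 1 / real (Suc j) \<and>
    exp (n * ?c) \<le> real (card (same_stat j n w)) / fact n ^ CARD('r)" for j
  proof (rule large_second_moment_witness[of "\<delta> / 2"])
    have neg: "\<not> (\<forall>\<^sub>F n in sequentially. measure_pmf.expectation (uniform_hom n)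
      (\<lambda>\<sigma>. real (card (microstates {1..n} \<sigma> \<mu> \<epsilon>)) ^ 2) \<le> exp (n * (c + \<delta>)))" if "\<epsilon> > 0" for \<epsilon>
      using contra that by blast
    have "?c + \<delta> / 2 = c + \<delta>" by simp
    then show "\<not> (\<forall>\<^sub>F n in sequentially. measure_pmf.expectation (uniform_hom n)
      (\<lambda>\<sigma>. real (card (microstates {1..n} \<sigma> \<mu> (1 / real (Suc j)))) ^ 2) \<le> exp (n * (?c + \<delta> / 2)))"
      by (simp only:) (rule neg; simp)
  qed (use \<delta> in simp)
  then obtain n w where nw: "\<And>j. n j > j \<and> w j \<in> sym_homs (n j) \<times> ({1..n j} \<rightarrow>\<^sub>E UNIV) \<and>
    transport_dist (empirical {1..n j} (fst (w j)) (restrict (\<lambda>v. fst (snd (w j) v)) {1..n j})) \<mu> < 1 / real (Suc j) \<and>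
    transport_dist (empirical {1..n j} (fst (w j)) (restrict (\<lambda>v. snd (snd (w j) v)) {1..n j})) \<mu> < 1 / real (Suc j) \<and>
    exp (n j * ?c) \<le> real (card (same_stat j (n j) (w j))) / fact (n j) ^ CARD('r)"
    by metis
  have n: "n j > j" and n0: "n j > 0" and w: "fst (w j) \<in> sym_homs (n j)"
    and big: "exp (n j * ?c) \<le> real (card (same_stat j (n j) (w j))) / fact (n j) ^ CARD('r)" for j
    using nw[of j] by (auto simp: mem_Times_iff)
  obtain s \<xi> where s: "strict_mono s" and \<xi>: "\<xi> \<in> self_joinings \<mu>"
    and lim: "\<And>S. S \<in> cylinders \<Longrightarrow>
      (\<lambda>j. measure (empirical {1..n (s j)} (fst (w (s j))) (snd (w (s j)))) S) \<longlonglongrightarrow> measure \<xi> S"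
    by (rule limit_self_joining[OF \<mu>, of n "\<lambda>j. fst (w j)" "\<lambda>j. snd (w j)"]) (use nw n0 w in auto)
  have \<xi>c: "\<xi> \<in> config_probs" using \<xi> by (auto simp: self_joinings_def intro: invariant_probsD)
  have "ereal ?c \<le> f_invariant \<xi>"
  proof (rule f_invariant_ge)
    fix \<epsilon> :: real assume \<epsilon>: "\<epsilon> > 0"
    have "\<forall>\<^sub>F k in sequentially. tail TYPE('r) k < \<epsilon> / 4"
      using tail_tendsto_0 by (rule order_tendstoD) (use \<epsilon> in simp)
    then obtain k where k: "tail TYPE('r) k < \<epsilon> / 4"
      by (metis eventually_sequentially order_refl)
    let ?P = "range (trunc k) :: ('r, 'a \<times> 'a) config set" and ?D = "diam TYPE('r)"
    define C where "C = (?D + 1) * (real (card ?P) + 1)"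
    have D0: "?D \<ge> 0" by (rule diam_nonneg)
    then have C: "C > 0" by (simp add: C_def)
    define e where "e = \<epsilon> / (2 * C)"
    have e: "e > 0" using \<epsilon> C by (simp add: e_def)
    let ?\<eta> = "\<lambda>j. empirical {1..n (s j)} (fst (w (s j))) (snd (w (s j)))"
    have "\<forall>\<^sub>F j in sequentially. \<forall>p\<in>?P. dist (measure (?\<eta> j) {y. trunc k y = p}) (measure \<xi> {y. trunc k y = p}) < e"
      using tendstoD[OF lim[OF cylindersI[OF cyl_set_fibre]] e]
      by (intro eventually_ball_finite finite_pats ballI)
    moreover have "\<forall>\<^sub>F j in sequentially. j \<ge> k" by (rule eventually_ge_at_top)
    ultimately have ev: "\<forall>\<^sub>F j in sequentially. exp (n (s j) * ?c) \<le> expected_microstates \<xi> \<epsilon> (n (s j))"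
    proof eventually_elim
      case (elim j)
      let ?N = "n (s j)"
      have ks: "k \<le> s j" using elim(2) seq_suble[OF s, of j] by simp
      have sub: "same_stat (s j) ?N (w (s j)) \<subseteq> (SIGMA \<sigma>:sym_homs ?N. microstates {1..?N} \<sigma> \<xi> \<epsilon>)"
      proof (rule subsetI, unfold split_paired_all)
        fix \<sigma> x assume in_stat: "(\<sigma>, x) \<in> same_stat (s j) ?N (w (s j))"
        let ?e = "empirical {1..?N} \<sigma> x"
        have ep: "?e \<in> config_probs" using n0[of "s j"] by (intro empirical_config_probs) auto
        have "measure ?e {y. trunc k y = p} = measure (?\<eta> j) {y. trunc k y = p}" for p
          using same_stat_measure[OF n0 in_stat cyl_set_mono[OF cyl_set_fibre ks]] by simp
        then have "\<bar>measure ?e {y. trunc k y = p} - measure \<xi> {y. trunc k y = p}\<bar> \<le> e" if "p \<in> ?P" for p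
          using elim(1) that by (auto simp: dist_real_def less_imp_le)
        then have "(\<Sum>p\<in>?P. \<bar>measure ?e {y. trunc k y = p} - measure \<xi> {y. trunc k y = p}\<bar>) \<le> card ?P * e"
          by (intro sum_bounded_above)
        then have "?D * (\<Sum>p\<in>?P. \<bar>measure ?e {y. trunc k y = p} - measure \<xi> {y. trunc k y = p}\<bar>) \<le> ?D * (card ?P * e)"
          using D0 by (rule mult_left_mono)
        also have "\<dots> \<le> C * e" unfolding C_def using D0 e by (simp add: algebra_simps)
        also have "C * e = \<epsilon> / 2" using C by (simp add: e_def)
        finally have "transport_dist ?e \<xi> < \<epsilon>"
          using transport_le_trunc[OF ep \<xi>c, of k] k by linarith
        then show "(\<sigma>, x) \<in> (SIGMA \<sigma>:sym_homs ?N. microstates {1..?N} \<sigma> \<xi> \<epsilon>)"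
          using in_stat by (auto simp: same_stat_def microstates_def)
      qed
      have "finite (SIGMA \<sigma>:(sym_homs ?N :: ('r free_word \<Rightarrow> nat \<Rightarrow> nat) set). microstates {1..?N} \<sigma> \<xi> \<epsilon>)"
        by (intro finite_SigmaI finite_hom_sym_group finite_microstates) simp
      from card_mono[OF this sub]
      have "real (card (same_stat (s j) ?N (w (s j)))) / fact ?N ^ CARD('r) \<le>
         real (card (SIGMA \<sigma>:(sym_homs ?N :: ('r free_word \<Rightarrow> nat \<Rightarrow> nat) set). microstates {1..?N} \<sigma> \<xi> \<epsilon>)) / fact ?N ^ CARD('r)"
        by (intro divide_right_mono) auto
      also have "\<dots> = expected_microstates \<xi> \<epsilon> ?N"
        unfolding expected_microstates_def by (subst expected_card) (auto intro: finite_microstates)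
      finally show ?case using big[of "s j"] by linarith
    qed
    show "\<exists>\<^sub>F m in sequentially. exp (m * ?c) \<le> expected_microstates \<xi> \<epsilon> m"
      unfolding frequently_sequentially
    proof
      fix N
      obtain j0 where j0: "\<And>j. j \<ge> j0 \<Longrightarrow> exp (n (s j) * ?c) \<le> expected_microstates \<xi> \<epsilon> (n (s j))"
        using ev unfolding eventually_sequentially by blast
      have "n (s (max j0 N)) \<ge> N" using n[of "s (max j0 N)"] seq_suble[OF s, of "max j0 N"] by linarith
      then show "\<exists>m\<ge>N. exp (m * ?c) \<le> expected_microstates \<xi> \<epsilon> m" using j0[of "max j0 N"] by auto
    qed
  qed
  also have "f_invariant \<xi> \<le> ereal c" by (rule joinings[OF \<xi>])
  finally show False using \<delta> by simp
qed

lemma first_moment_bound: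
  fixes \<mu> :: "('r::finite, 'a::finite) config measure" and \<phi> \<delta> :: real
  assumes \<mu>: "\<mu> \<in> invariant_probs" and f: "f_invariant \<mu> = ereal \<phi>" and \<epsilon>: "\<epsilon> > 0" and \<delta>: "\<delta> > 0"
  shows "\<forall>\<^sub>F n in sequentially. exp (n * (\<phi> - \<delta>)) \<le> expected_microstates \<mu> \<epsilon> n"
proof -
  obtain k where "\<forall>\<^sub>F n in sequentially. exp (n * (block_entropy k \<mu> - \<delta>)) \<le> expected_microstates \<mu> \<epsilon> n"
    using microstates_expected_lower[OF \<mu> \<epsilon>] \<delta> by blast
  then show ?thesis
  proof eventually_elim
    case (elim n)
    have "\<phi> \<le> block_entropy k \<mu>"
      using f_invariant_le_block_entropy[OF invariant_probsD[OF \<mu>], of k] f by simp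
    then have "exp (n * (\<phi> - \<delta>)) \<le> exp (n * (block_entropy k \<mu> - \<delta>))" by (simp add: mult_left_mono)
    with elim show ?case by linarith
  qed
qed

section \<open>Concentration of the microstate radius\<close>


definition hom_lip :: "'r::finite itself \<Rightarrow> real" where
  "hom_lip _ = 2 * (\<Sum>\<^sub>\<infinity>g :: 'r free_word. (1 + real (word_length g)) * wt g)"

lemma hom_lip_pos: "hom_lip TYPE('r::finite) > 0"
proof -
  let ?f = "\<lambda>g :: 'r free_word. (1 + real (word_length g)) * wt g"
  have "infsum ?f {\<one>\<^bsub>free_group\<^esub>} \<le> infsum ?f UNIV"
    using weighted_length_summable by (intro infsum_mono2) (auto simp: wt_pos less_imp_le)
  moreover have "infsum ?f {\<one>\<^bsub>free_group\<^esub>} > 0" by (simp add: wt_pos add_pos_nonneg)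
  ultimately show ?thesis by (simp add: hom_lip_def)
qed

lemma card_disagreement:
  fixes \<sigma> \<sigma>' :: "'r free_word \<Rightarrow> nat \<Rightarrow> nat"
  assumes \<sigma>: "\<sigma> \<in> sym_homs n" and \<sigma>': "\<sigma>' \<in> sym_homs n"
    and gens: "\<And>i. card {v \<in> {1..n}. \<sigma> (gen i) v \<noteq> \<sigma>' (gen i) v} \<le> 2"
  shows "card {v \<in> {1..n}. \<sigma> g v \<noteq> \<sigma>' g v} \<le> 2 * word_length g"
proof (induction "word_length g" arbitrary: g)
  case 0
  then have "g = \<one>\<^bsub>free_group\<^esub>" by (simp add: word_length_eq_0)
  then show ?case by (simp add: sym_homsD(3)[OF \<sigma>] sym_homsD(3)[OF \<sigma>'])
next
  case (Suc l)
  let ?D = "\<lambda>g. {v \<in> {1..n}. \<sigma> g v \<noteq> \<sigma>' g v}"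
  obtain h i where h: "word_length h = l" "g = h \<otimes>\<^bsub>free_group\<^esub> gen i \<or> h = g \<otimes>\<^bsub>free_group\<^esub> gen i"
    using word_length_step[OF Suc.hyps(2)[symmetric]] by blast
  have fin: "finite (?D g)" for g by simp
  have IH: "card (?D h) \<le> 2 * l" using Suc.hyps(1)[OF h(1)[symmetric]] h(1) by simp
  let ?s = "\<sigma> (gen i)"
  note perm = sym_homsD(1)[OF \<sigma>, of "gen i"]
  have "card (?D g) \<le> card (?D (gen i)) + card (?D h)"
    using h(2)
  proof
    assume g: "g = h \<otimes>\<^bsub>free_group\<^esub> gen i"
    have "?D g \<subseteq> ?D (gen i) \<union> inv_into UNIV ?s ` ?D h"
    proof
      fix v assume v: "v \<in> ?D g"
      show "v \<in> ?D (gen i) \<union> inv_into UNIV ?s ` ?D h"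
      proof (cases "?s v = \<sigma>' (gen i) v")
        case True
        have "?s v \<in> {1..n}" using v permutes_in_image[OF perm] by blast
        moreover have "\<sigma> h (?s v) \<noteq> \<sigma>' h (?s v)"
          using v True by (simp add: g sym_homsD(2)[OF \<sigma>] sym_homsD(2)[OF \<sigma>'])
        ultimately have "?s v \<in> ?D h" by blast
        moreover have "v = inv_into UNIV ?s (?s v)" by (simp add: permutes_inverses(2)[OF perm])
        ultimately show ?thesis by blast
      qed (use v in auto)
    qed
    then have "card (?D g) \<le> card (?D (gen i) \<union> inv_into UNIV ?s ` ?D h)"
      using fin by (intro card_mono) auto
    also have "\<dots> \<le> card (?D (gen i)) + card (inv_into UNIV ?s ` ?D h)" by (rule card_Un_le)
    also have "card (inv_into UNIV ?s ` ?D h) \<le> card (?D h)" by (rule card_image_le[OF fin])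
    finally show ?thesis by simp
  next
    assume g: "h = g \<otimes>\<^bsub>free_group\<^esub> gen i"
    have "?D g \<subseteq> ?s ` (?D (gen i) \<union> ?D h)"
    proof
      fix u assume u: "u \<in> ?D g"
      define v where "v = inv_into UNIV ?s u"
      have v: "?s v = u" "v \<in> {1..n}"
        unfolding v_def using u permutes_inverses[OF perm] permutes_in_image[OF permutes_inv[OF perm]] by blast+
      have "v \<in> ?D (gen i) \<union> ?D h"
      proof (cases "?s v = \<sigma>' (gen i) v")
        case True
        then have "\<sigma> h v \<noteq> \<sigma>' h v"
          using u v by (simp add: g sym_homsD(2)[OF \<sigma>] sym_homsD(2)[OF \<sigma>'])
        then show ?thesis using v by blast
      qed (use v in blast)
      then show "u \<in> ?s ` (?D (gen i) \<union> ?D h)" using v(1) by blast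
    qed
    then have "card (?D g) \<le> card (?s ` (?D (gen i) \<union> ?D h))"
      using fin by (intro card_mono) auto
    also have "\<dots> \<le> card (?D (gen i) \<union> ?D h)" using fin by (intro card_image_le) auto
    also have "\<dots> \<le> card (?D (gen i)) + card (?D h)" by (rule card_Un_le)
    finally show ?thesis .
  qed
  also have "\<dots> \<le> 2 + 2 * l" using gens[of i] IH by simp
  also have "\<dots> = 2 * word_length g" using Suc.hyps(2) by simp
  finally show ?case .
qed

lemma sum_infsum_swap:
  fixes f :: "'v \<Rightarrow> 'g \<Rightarrow> real"
  assumes "finite V" "\<And>v. v \<in> V \<Longrightarrow> f v summable_on A"
  shows "(\<Sum>v\<in>V. infsum (f v) A) = infsum (\<lambda>g. \<Sum>v\<in>V. f v g) A"
    and "(\<lambda>g. \<Sum>v\<in>V. f v g) summable_on A"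
  using assms by (induction V rule: finite_induct) (auto simp: infsum_add summable_on_add)

lemma transport_empirical_le:
  fixes \<sigma> \<sigma>' :: "'r::finite free_word \<Rightarrow> nat \<Rightarrow> nat" and x :: "nat \<Rightarrow> 'a::finite"
  assumes \<sigma>: "\<sigma> \<in> sym_homs n" and \<sigma>': "\<sigma>' \<in> sym_homs n" and n: "n > 0"
    and gens: "\<And>i. card {v \<in> {1..n}. \<sigma> (gen i) v \<noteq> \<sigma>' (gen i) v} \<le> 2"
  shows "transport_dist (empirical {1..n} \<sigma> x) (empirical {1..n} \<sigma>' x) \<le> hom_lip TYPE('r) / n"
proof (rule transport_least)
  fix f :: "('r, 'a) config \<Rightarrow> real" assume f: "lip f"
  let ?V = "{1..n}"
  define F :: "nat \<Rightarrow> 'r free_word \<Rightarrow> real" where "F v g = (if \<sigma> g v \<noteq> \<sigma>' g v then wt g else 0)" for v g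
  have F: "F v summable_on UNIV" for v
    by (rule summable_on_comparison_test[OF wt_summable[of UNIV]]) (auto simp: F_def wt_pos less_imp_le)
  have d: "config_dist (pullback \<sigma> x v) (pullback \<sigma>' x v) \<le> infsum (F v) UNIV" for v
  proof -
    have "(\<lambda>g. if pullback \<sigma> x v g \<noteq> pullback \<sigma>' x v g then wt g else 0) summable_on UNIV"
      by (rule summable_on_comparison_test[OF wt_summable[of UNIV]]) (auto simp: wt_pos less_imp_le)
    then show ?thesis unfolding config_dist_eq
      by (rule infsum_mono[OF _ F]) (auto simp: F_def pullback_def wt_pos less_imp_le)
  qed
  have m: "f \<in> borel_measurable config_space" by (rule lip_measurable[OF f])
  have "\<bar>(\<integral>y. f y \<partial>empirical ?V \<sigma> x) - (\<integral>y. f y \<partial>empirical ?V \<sigma>' x)\<bar>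
      = \<bar>\<Sum>v\<in>?V. f (pullback \<sigma> x v) - f (pullback \<sigma>' x v)\<bar> / n"
    using m by (simp add: integral_empirical sum_subtractf diff_divide_distrib[symmetric])
  also have "\<dots> \<le> (\<Sum>v\<in>?V. infsum (F v) UNIV) / n"
    using f d by (intro divide_right_mono order_trans[OF sum_abs] sum_mono) (auto intro: order_trans)
  also have "(\<Sum>v\<in>?V. infsum (F v) UNIV) = infsum (\<lambda>g. \<Sum>v\<in>?V. F v g) UNIV"
    by (rule sum_infsum_swap[OF _ F]) simp
  also have "\<dots> \<le> infsum (\<lambda>g :: 'r free_word. 2 * ((1 + real (word_length g)) * wt g)) UNIV"
  proof (rule infsum_mono)
    show "(\<lambda>g. \<Sum>v\<in>?V. F v g) summable_on UNIV" by (rule sum_infsum_swap(2)[OF _ F]) simp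
    show "(\<lambda>g :: 'r free_word. 2 * ((1 + real (word_length g)) * wt g)) summable_on UNIV"
      by (rule summable_on_cmult_right[OF weighted_length_summable])
    fix g :: "'r free_word"
    have "(\<Sum>v\<in>?V. F v g) = real (card {v \<in> ?V. \<sigma> g v \<noteq> \<sigma>' g v}) * wt g"
      by (simp add: F_def sum.If_cases Int_def)
    also have "\<dots> \<le> (2 * (1 + real (word_length g))) * wt g"
      using card_disagreement[OF \<sigma> \<sigma>' gens, of g] by (intro mult_right_mono) (auto simp: wt_pos less_imp_le)
    finally show "(\<Sum>v\<in>?V. F v g) \<le> 2 * ((1 + real (word_length g)) * wt g)"
      by (simp only: mult.assoc)
  qed
  also have "\<dots> = hom_lip TYPE('r)"
    unfolding hom_lip_def by (rule infsum_cmult_right) (use weighted_length_summable in blast)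
  finally show "\<bar>(\<integral>y. f y \<partial>empirical ?V \<sigma> x) - (\<integral>y. f y \<partial>empirical ?V \<sigma>' x)\<bar> \<le> hom_lip TYPE('r) / n"
    by (simp add: divide_right_mono)
qed

context
  fixes \<mu> :: "('r::finite, 'a::finite) config measure" and n :: nat and h :: real
  assumes \<mu>: "\<mu> \<in> config_probs" and n: "n > 0"
begin

lemma rho_eq: "rho {1..n} \<mu> \<sigma> h = Inf {\<epsilon>. \<epsilon> > 0 \<and> exp (n * h) \<le> card (microstates {1..n} \<sigma> \<mu> \<epsilon>)}"
  unfolding rho_def using n elog_div_ge_iff[of "real (card (microstates {1..n} \<sigma> \<mu> _))" n h]
  by simp

lemma microstates_mono: "\<epsilon> \<le> \<epsilon>' \<Longrightarrow> microstates {1..n} \<sigma> \<mu> \<epsilon> \<subseteq> microstates {1..n} \<sigma> \<mu> \<epsilon>'"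
  by (auto simp: microstates_def)

lemma rho_le:
  assumes "\<epsilon> > 0" "exp (n * h) \<le> card (microstates {1..n} \<sigma> \<mu> \<epsilon>)"
  shows "rho {1..n} \<mu> \<sigma> h \<le> \<epsilon>"
  unfolding rho_eq using assms by (intro cInf_lower bdd_belowI[of _ 0]) auto

lemma rho_set_nonempty:
  assumes h: "h \<le> ln (real CARD('a))"
  shows "\<exists>\<epsilon>>0. exp (n * h) \<le> card (microstates {1..n} \<sigma> \<mu> \<epsilon>)"
proof -
  interpret M: prob_space \<mu> by (rule config_probsD[OF \<mu>])
  let ?P = "range (trunc 0) :: ('r, 'a) config set"
  define b where "b = 2 * tail TYPE('r) 0 + diam TYPE('r) * real (card ?P) + 1"
  have b: "b > 0" unfolding b_def using tail_nonneg[of 0, where 'r = 'r] diam_nonneg[where 'r = 'r] by (simp add: add_nonneg_pos)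
  have "transport_dist (empirical {1..n} \<sigma> x) \<mu> < b" for x
  proof -
    have e: "empirical {1..n} \<sigma> x \<in> config_probs" using n by (intro empirical_config_probs) auto
    interpret E: prob_space "empirical {1..n} \<sigma> x" by (rule config_probsD[OF e])
    have "\<bar>measure (empirical {1..n} \<sigma> x) S - measure \<mu> S\<bar> \<le> 1" for S
      using E.prob_le_1[of S] M.prob_le_1[of S] measure_nonneg[of \<mu> S] measure_nonneg[of "empirical {1..n} \<sigma> x" S]
      by linarith
    then have "(\<Sum>p\<in>?P. \<bar>measure (empirical {1..n} \<sigma> x) {y. trunc 0 y = p} - measure \<mu> {y. trunc 0 y = p}\<bar>) \<le> real (card ?P) * 1"
      by (intro sum_bounded_above)
    then have "diam TYPE('r) * (\<Sum>p\<in>?P. \<bar>measure (empirical {1..n} \<sigma> x) {y. trunc 0 y = p} - measure \<mu> {y. trunc 0 y = p}\<bar>) \<le> diam TYPE('r) * (real (card ?P) * 1)"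
      by (rule mult_left_mono[OF _ diam_nonneg])
    then show ?thesis using transport_le_trunc[OF e \<mu>, of 0] by (simp add: b_def)
  qed
  then have "microstates {1..n} \<sigma> \<mu> b = {1..n} \<rightarrow>\<^sub>E UNIV" by (auto simp: microstates_def)
  then have "real (card (microstates {1..n} \<sigma> \<mu> b)) = real CARD('a) ^ n" by (simp add: card_PiE)
  also have "\<dots> = exp (n * ln (real CARD('a)))" by (subst exp_of_nat_mult) simp
  finally have "exp (n * h) \<le> card (microstates {1..n} \<sigma> \<mu> b)" using h by (simp add: mult_left_mono)
  with b show ?thesis by blast
qed

lemma rho_nonneg: "h \<le> ln (real CARD('a)) \<Longrightarrow> rho {1..n} \<mu> \<sigma> h \<ge> 0"
  unfolding rho_eq using rho_set_nonempty by (intro cInf_greatest) fastforce+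

lemma rho_lessD:
  assumes h: "h \<le> ln (real CARD('a))" and "rho {1..n} \<mu> \<sigma> h < \<epsilon>"
  shows "exp (n * h) \<le> card (microstates {1..n} \<sigma> \<mu> \<epsilon>)"
proof -
  have "{\<epsilon>. \<epsilon> > 0 \<and> exp (n * h) \<le> card (microstates {1..n} \<sigma> \<mu> \<epsilon>)} \<noteq> {}" using rho_set_nonempty[OF h] by blast
  then obtain \<epsilon>' where "\<epsilon>' < \<epsilon>" "exp (n * h) \<le> card (microstates {1..n} \<sigma> \<mu> \<epsilon>')"
    using cInf_lessD[OF _ assms(2)[unfolded rho_eq]] by blast
  moreover have "card (microstates {1..n} \<sigma> \<mu> \<epsilon>') \<le> card (microstates {1..n} \<sigma> \<mu> \<epsilon>)"
    using \<open>\<epsilon>' < \<epsilon>\<close> by (intro card_mono finite_microstates microstates_mono) auto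
  ultimately show ?thesis by linarith
qed

lemma rho_lipschitz:
  assumes h: "h \<le> ln (real CARD('a))" and \<sigma>: "\<sigma> \<in> sym_homs n" "\<sigma>' \<in> sym_homs n"
    and gens: "\<And>i. card {v \<in> {1..n}. \<sigma> (gen i) v \<noteq> \<sigma>' (gen i) v} \<le> 2"
  shows "rho {1..n} \<mu> \<sigma>' h \<le> rho {1..n} \<mu> \<sigma> h + hom_lip TYPE('r) / n"
proof -
  let ?c = "hom_lip TYPE('r) / n"
  have c: "?c > 0" using hom_lip_pos[where 'r = 'r] n by simp
  have "rho {1..n} \<mu> \<sigma>' h - ?c \<le> rho {1..n} \<mu> \<sigma> h"
    unfolding rho_eq[of \<sigma>]
  proof (rule cInf_greatest)
    show "{\<epsilon>. \<epsilon> > 0 \<and> exp (n * h) \<le> card (microstates {1..n} \<sigma> \<mu> \<epsilon>)} \<noteq> {}" using rho_set_nonempty[OF h] by blast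
    fix \<epsilon> assume "\<epsilon> \<in> {\<epsilon>. \<epsilon> > 0 \<and> exp (n * h) \<le> card (microstates {1..n} \<sigma> \<mu> \<epsilon>)}"
    then have \<epsilon>: "\<epsilon> > 0" "exp (n * h) \<le> card (microstates {1..n} \<sigma> \<mu> \<epsilon>)" by auto
    have "microstates {1..n} \<sigma> \<mu> \<epsilon> \<subseteq> microstates {1..n} \<sigma>' \<mu> (\<epsilon> + ?c)"
    proof
      fix x assume x: "x \<in> microstates {1..n} \<sigma> \<mu> \<epsilon>"
      have e: "empirical {1..n} \<tau> x \<in> config_probs" for \<tau> :: "'r free_word \<Rightarrow> nat \<Rightarrow> nat"
        using n by (intro empirical_config_probs) auto
      have g': "card {v \<in> {1..n}. \<sigma>' (gen i) v \<noteq> \<sigma> (gen i) v} \<le> 2" for i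
      proof -
        have "{v \<in> {1..n}. \<sigma>' (gen i) v \<noteq> \<sigma> (gen i) v} = {v \<in> {1..n}. \<sigma> (gen i) v \<noteq> \<sigma>' (gen i) v}" by auto
        then show ?thesis using gens[of i] by (simp only:)
      qed
      have "transport_dist (empirical {1..n} \<sigma>' x) \<mu> \<le> ?c + transport_dist (empirical {1..n} \<sigma> x) \<mu>"
        using transport_triangle[OF e[of \<sigma>'] e[of \<sigma>] \<mu>] transport_empirical_le[OF \<sigma>(2,1) n g', of x] by linarith
      then show "x \<in> microstates {1..n} \<sigma>' \<mu> (\<epsilon> + ?c)" using x by (auto simp: microstates_def)
    qed
    then have "card (microstates {1..n} \<sigma> \<mu> \<epsilon>) \<le> card (microstates {1..n} \<sigma>' \<mu> (\<epsilon> + ?c))"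
      by (intro card_mono finite_microstates) auto
    then have "exp (n * h) \<le> card (microstates {1..n} \<sigma>' \<mu> (\<epsilon> + ?c))" using \<epsilon>(2) by linarith
    then have "rho {1..n} \<mu> \<sigma>' h \<le> \<epsilon> + ?c" using \<epsilon>(1) c by (intro rho_le) auto
    then show "rho {1..n} \<mu> \<sigma>' h - ?c \<le> \<epsilon>" by simp
  qed
  then show ?thesis by simp
qed

lemma rho_subgaussian:
  assumes h: "h \<le> ln (real CARD('a))"
  shows "subgaussian (sym_homs n) (\<lambda>\<sigma>. - rho {1..n} \<mu> \<sigma> h) (real CARD('r) * (hom_lip TYPE('r))\<^sup>2 / (2 * n))"
proof -
  have "subgaussian (sym_homs n) (\<lambda>\<sigma>. - rho {1..n} \<mu> \<sigma> h) (real CARD('r) * (real n * ((hom_lip TYPE('r) / n)\<^sup>2 / 2)))"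
  proof (rule subgaussian_hom_sym_group)
    fix \<sigma> \<sigma>' :: "'r free_word \<Rightarrow> nat \<Rightarrow> nat" and i u w
    assume \<sigma>: "\<sigma> \<in> sym_homs n" "\<sigma>' \<in> sym_homs n"
      and i: "\<sigma>' (gen i) = \<sigma> (gen i) \<circ> Transposition.transpose u w"
      and j: "\<And>j. j \<noteq> i \<Longrightarrow> \<sigma>' (gen j) = \<sigma> (gen j)"
    have "card {v \<in> {1..n}. \<sigma> (gen k) v \<noteq> \<sigma>' (gen k) v} \<le> 2" for k
    proof (cases "k = i")
      case True
      have "{v \<in> {1..n}. \<sigma> (gen k) v \<noteq> \<sigma>' (gen k) v} \<subseteq> {u, w}"
        unfolding True i by (auto simp: Transposition.transpose_def split: if_splits)
      then have "card {v \<in> {1..n}. \<sigma> (gen k) v \<noteq> \<sigma>' (gen k) v} \<le> card {u, w}" by (intro card_mono) auto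
      also have "\<dots> \<le> 2" by (simp add: card_insert_if)
      finally show ?thesis .
    qed (simp add: j)
    moreover have "card {v \<in> {1..n}. \<sigma>' (gen k) v \<noteq> \<sigma> (gen k) v} \<le> 2"
      if "\<And>k. card {v \<in> {1..n}. \<sigma> (gen k) v \<noteq> \<sigma>' (gen k) v} \<le> 2" for k
    proof -
      have "{v \<in> {1..n}. \<sigma>' (gen k) v \<noteq> \<sigma> (gen k) v} = {v \<in> {1..n}. \<sigma> (gen k) v \<noteq> \<sigma>' (gen k) v}" by auto
      then show ?thesis using that[of k] by (simp only:)
    qed
    ultimately show "\<bar>- rho {1..n} \<mu> \<sigma>' h - - rho {1..n} \<mu> \<sigma> h\<bar> \<le> hom_lip TYPE('r) / n"
      using rho_lipschitz[OF h \<sigma>] rho_lipschitz[OF h \<sigma>(2,1)] by (simp add: abs_le_iff)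
  qed
  moreover have "real CARD('r) * (real n * ((hom_lip TYPE('r) / n)\<^sup>2 / 2)) = real CARD('r) * (hom_lip TYPE('r))\<^sup>2 / (2 * n)"
    using n by (simp add: power2_eq_square field_simps)
  ultimately show ?thesis by (simp only:)
qed

end

lemma paley_zygmund:
  assumes S: "finite S" "S \<noteq> {}" and X: "\<And>x. x \<in> S \<Longrightarrow> X x \<ge> (0 :: real)"
  shows "(avg S X)\<^sup>2 \<le> 4 * avg S (\<lambda>x. (X x)\<^sup>2) * (card {x \<in> S. avg S X / 2 \<le> X x} / card S)"
proof -
  define m where "m = avg S X"
  let ?A = "{x \<in> S. m / 2 \<le> X x}"
  have c: "real (card S) > 0" using S by (simp add: card_gt_0_iff)
  have m0: "m \<ge> 0" unfolding m_def avg_def using X by (simp add: sum_nonneg)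
  have "card S * m = (\<Sum>x\<in>S. X x)" using c by (simp add: m_def avg_def)
  also have "\<dots> = (\<Sum>x\<in>?A. X x) + (\<Sum>x\<in>S - ?A. X x)"
    using S by (subst sum.subset_diff[of ?A S]) auto
  also have "(\<Sum>x\<in>S - ?A. X x) \<le> (\<Sum>x\<in>S - ?A. m / 2)" by (rule sum_mono) auto
  also have "(\<Sum>x\<in>S - ?A. m / 2) \<le> card S * (m / 2)"
    using m0 card_mono[of S "S - ?A"] S by (simp add: mult_right_mono)
  finally have "card S * (m / 2) \<le> (\<Sum>x\<in>?A. X x)" by simp
  then have "(card S * (m / 2))\<^sup>2 \<le> (\<Sum>x\<in>?A. X x)\<^sup>2"
    using m0 by (intro power_mono) auto
  also have "\<dots> \<le> (\<Sum>x\<in>?A. (X x)\<^sup>2) * card ?A"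
    by (rule sum_squared_le_sum_of_squares)
  also have "\<dots> \<le> (\<Sum>x\<in>S. (X x)\<^sup>2) * card ?A"
    using S by (intro mult_right_mono sum_mono2) auto
  finally have "(card S * (m / 2))\<^sup>2 / (card S)\<^sup>2 \<le> (\<Sum>x\<in>S. (X x)\<^sup>2) * card ?A / (card S)\<^sup>2"
    by (rule divide_right_mono) simp
  then have "m\<^sup>2 / 4 \<le> avg S (\<lambda>x. (X x)\<^sup>2) * (card ?A / card S)"
    using c by (simp add: avg_def power_mult_distrib power_divide power2_eq_square)
  then have "m\<^sup>2 \<le> 4 * (avg S (\<lambda>x. (X x)\<^sup>2) * (card ?A / card S))" by linarith
  then show ?thesis by (simp only: m_def mult.assoc)
qed

lemma expectation_avg: "measure_pmf.expectation (uniform_hom n) \<phi> = avg (sym_homs n) \<phi>"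
  for \<phi> :: "('r::finite free_word \<Rightarrow> nat \<Rightarrow> nat) \<Rightarrow> real"
  unfolding uniform_hom_def by (rule avg_pmf_of_set[OF finite_hom_sym_group hom_sym_group_nonempty, symmetric])


lemma expected_rho_eventually_le:
  fixes \<mu> :: "('r::finite, 'a::finite) config measure" and \<phi> h \<eta> :: real
  assumes \<mu>: "\<mu> \<in> invariant_probs" and f: "f_invariant \<mu> = ereal \<phi>"
    and joinings: "\<And>\<xi>. \<xi> \<in> self_joinings \<mu> \<Longrightarrow> f_invariant \<xi> \<le> ereal (2 * \<phi>)"
    and h: "h \<le> ln (real CARD('a))" "h = 0 \<or> h < \<phi>" and \<eta>: "\<eta> > 0"
  shows "\<forall>\<^sub>F n in sequentially. avg (sym_homs n) (\<lambda>\<sigma>. rho {1..n} \<mu> \<sigma> h) \<le> \<eta>"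
proof -
  note cp = invariant_probsD[OF \<mu>]
  let ?C = "hom_lip TYPE('r)" and ?r = "real CARD('r)"
  define t where "t = \<eta> / 2"
  have t: "t > 0" using \<eta> by (simp add: t_def)
  have rC: "?r * ?C\<^sup>2 > 0" using hom_lip_pos[where 'r = 'r] by simp
  define \<kappa> where "\<kappa> = t\<^sup>2 / (2 * (?r * ?C\<^sup>2))"
  have \<kappa>: "\<kappa> > 0" using t rC by (simp add: \<kappa>_def)
  define \<delta> where "\<delta> = min (\<kappa> / 8) (if h < \<phi> then (\<phi> - h) / 2 else 1)"
  have \<delta>: "\<delta> > 0" using \<kappa> by (simp add: \<delta>_def)
  have \<delta>\<kappa>: "\<kappa> / 2 \<le> \<kappa> - 3 * \<delta>" using \<kappa> by (simp add: \<delta>_def min_def)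
  obtain \<epsilon>1 where \<epsilon>1: "\<epsilon>1 > 0" and second: "\<forall>\<^sub>F n in sequentially. measure_pmf.expectation (uniform_hom n)
      (\<lambda>\<sigma>. real (card (microstates {1..n} \<sigma> \<mu> \<epsilon>1)) ^ 2) \<le> exp (n * (2 * \<phi> + \<delta>))"
    using second_moment_bound[OF \<mu> joinings \<delta>] by blast
  define \<epsilon> where "\<epsilon> = min \<epsilon>1 t"
  have \<epsilon>: "\<epsilon> > 0" "\<epsilon> \<le> t" "\<epsilon> \<le> \<epsilon>1" using \<epsilon>1 t by (auto simp: \<epsilon>_def)
  have first: "\<forall>\<^sub>F n in sequentially. exp (n * (\<phi> - \<delta>)) \<le> expected_microstates \<mu> \<epsilon> n"
    by (rule first_moment_bound[OF \<mu> f \<epsilon>(1) \<delta>])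
  have "\<forall>\<^sub>F n in sequentially. ln 5 + 0 * ln (1 + real n) \<le> real n * (\<kappa> / 2)"
    by (rule eventually_log_le_linear) (use \<kappa> in simp)
  moreover have "\<forall>\<^sub>F n in sequentially. h < \<phi> \<longrightarrow> ln 2 + 0 * ln (1 + real n) \<le> real n * ((\<phi> - h) / 2)"
  proof (cases "h < \<phi>")
    case True
    then have "(\<phi> - h) / 2 > 0" by simp
    from eventually_log_le_linear[OF this, of "ln 2" 0] show ?thesis by simp
  qed simp
  moreover have "\<forall>\<^sub>F n in sequentially. n > (0 :: nat)" by (rule eventually_gt_at_top)
  ultimately show ?thesis using first second
  proof eventually_elim
    case (elim n)
    let ?H = "sym_homs n :: ('r free_word \<Rightarrow> nat \<Rightarrow> nat) set"
    let ?R = "\<lambda>\<sigma>. rho {1..n} \<mu> \<sigma> h"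
    note n = elim(3)
    note H = finite_hom_sym_group[of n, where 'r = 'r] hom_sym_group_nonempty[of n, where 'r = 'r]
    define X where "X \<sigma> = real (card (microstates {1..n} \<sigma> \<mu> \<epsilon>))" for \<sigma> :: "'r free_word \<Rightarrow> nat \<Rightarrow> nat"
    define m where "m = avg ?H X"
    have m: "exp (n * (\<phi> - \<delta>)) \<le> m"
      using elim(4) unfolding m_def X_def expected_microstates_def expectation_avg .
    have m0: "m > 0" using less_le_trans[OF exp_gt_zero m] .
    have sq: "avg ?H (\<lambda>\<sigma>. (X \<sigma>)\<^sup>2) \<le> exp (n * (2 * \<phi> + \<delta>))"
    proof -
      have "(X \<sigma>)\<^sup>2 \<le> real (card (microstates {1..n} \<sigma> \<mu> \<epsilon>1)) ^ 2" for \<sigma>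
        unfolding X_def using microstates_mono[OF cp n \<epsilon>(3)] by (intro power_mono) (auto intro!: card_mono finite_microstates)
      then have "avg ?H (\<lambda>\<sigma>. (X \<sigma>)\<^sup>2) \<le> avg ?H (\<lambda>\<sigma>. real (card (microstates {1..n} \<sigma> \<mu> \<epsilon>1)) ^ 2)"
        by (intro avg_mono)
      then show ?thesis using elim(5) unfolding expectation_avg by linarith
    qed
    have large: "exp (n * h) \<le> X \<sigma>" if "m / 2 \<le> X \<sigma>" for \<sigma>
    proof (cases "h < \<phi>")
      case True
      have "ln 2 \<le> n * ((\<phi> - h) / 2)" using elim(2) True by simp
      also have "\<dots> \<le> n * (\<phi> - \<delta> - h)"
      proof (rule mult_left_mono)
        have "\<delta> \<le> (\<phi> - h) / 2" using True unfolding \<delta>_def by (simp only: if_True min.cobounded2)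
        then show "(\<phi> - h) / 2 \<le> \<phi> - \<delta> - h" by (simp add: field_simps)
      qed simp
      finally have "n * h \<le> n * (\<phi> - \<delta>) - ln 2" by (simp add: algebra_simps)
      then have "exp (n * h) \<le> exp (n * (\<phi> - \<delta>) - ln 2)" by simp
      also have "\<dots> = exp (n * (\<phi> - \<delta>)) / 2" by (simp add: exp_diff)
      finally show ?thesis using m that by linarith
    next
      case False
      then have "h = 0" using h(2) by simp
      moreover have "X \<sigma> > 0" using that m0 by linarith
      then have "X \<sigma> \<ge> 1" unfolding X_def by simp
      ultimately show ?thesis by simp
    qed
    have sub: "{\<sigma> \<in> ?H. m / 2 \<le> X \<sigma>} \<subseteq> {\<sigma> \<in> ?H. ?R \<sigma> \<le> t}"
      using large rho_le[OF cp n \<epsilon>(1)] \<epsilon>(2) unfolding X_def by (auto intro: order_trans)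
    show "avg ?H ?R \<le> \<eta>"
    proof (rule ccontr)
      assume "\<not> avg ?H ?R \<le> \<eta>"
      then have gt: "2 * t < avg ?H ?R" by (simp add: t_def)
      have neg: "avg ?H (\<lambda>\<sigma>. - ?R \<sigma>) = - avg ?H ?R"
        unfolding avg_def by (simp add: sum_negf)
      have "{\<sigma> \<in> ?H. ?R \<sigma> \<le> t} \<subseteq> {\<sigma> \<in> ?H. avg ?H (\<lambda>\<sigma>. - ?R \<sigma>) + t \<le> - ?R \<sigma>}"
        unfolding neg using gt by auto
      then have "card {\<sigma> \<in> ?H. m / 2 \<le> X \<sigma>} \<le> card {\<sigma> \<in> ?H. avg ?H (\<lambda>\<sigma>. - ?R \<sigma>) + t \<le> - ?R \<sigma>}"
        using sub H(1) by (intro card_mono) auto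
      then have "real (card {\<sigma> \<in> ?H. m / 2 \<le> X \<sigma>}) / card ?H \<le> real (card {\<sigma> \<in> ?H. avg ?H (\<lambda>\<sigma>. - ?R \<sigma>) + t \<le> - ?R \<sigma>}) / card ?H"
        by (simp add: divide_right_mono)
      also have "\<dots> \<le> exp (- (t\<^sup>2 / (4 * (?r * ?C\<^sup>2 / (2 * n)))))"
        by (rule subgaussian_tail[OF H _ t rho_subgaussian[OF cp n h(1)]])
           (use rC n in \<open>simp add: divide_pos_pos\<close>)
      also have "t\<^sup>2 / (4 * (?r * ?C\<^sup>2 / (2 * n))) = n * \<kappa>"
        using n rC by (simp add: \<kappa>_def field_simps)
      finally have P: "real (card {\<sigma> \<in> ?H. m / 2 \<le> X \<sigma>}) / card ?H \<le> exp (- (n * \<kappa>))" .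
      have exp4: "exp (a - b) \<le> 4" if "exp a \<le> 4 * exp b" for a b :: real
        using that by (simp add: exp_diff pos_divide_le_eq)
      have "exp (n * (\<phi> - \<delta>)) ^ 2 \<le> m\<^sup>2" using m by (intro power_mono) auto
      also have "m\<^sup>2 \<le> 4 * avg ?H (\<lambda>\<sigma>. (X \<sigma>)\<^sup>2) * (real (card {\<sigma> \<in> ?H. m / 2 \<le> X \<sigma>}) / card ?H)"
        unfolding m_def by (rule paley_zygmund[OF H]) (simp add: X_def)
      also have "\<dots> \<le> 4 * exp (n * (2 * \<phi> + \<delta>)) * exp (- (n * \<kappa>))"
      proof -
        have "0 \<le> avg ?H (\<lambda>\<sigma>. (X \<sigma>)\<^sup>2)" unfolding avg_def by (intro divide_nonneg_nonneg sum_nonneg) auto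
        with sq P show ?thesis by (intro mult_mono) auto
      qed
      also have "\<dots> = 4 * exp (n * (2 * \<phi> + \<delta>) - n * \<kappa>)" by (simp add: exp_diff exp_minus field_simps)
      finally have "exp (2 * (n * (\<phi> - \<delta>))) \<le> 4 * exp (n * (2 * \<phi> + \<delta>) - n * \<kappa>)"
        by (simp add: exp_double)
      then have "exp (2 * (n * (\<phi> - \<delta>)) - (n * (2 * \<phi> + \<delta>) - n * \<kappa>)) \<le> 4"
        by (rule exp4)
      then have "exp (n * (\<kappa> - 3 * \<delta>)) \<le> 4" by (simp add: algebra_simps)
      moreover have "ln 5 \<le> n * (\<kappa> - 3 * \<delta>)"
        using elim(1) mult_left_mono[OF \<delta>\<kappa>, of "real n"] by simp
      then have "5 \<le> exp (n * (\<kappa> - 3 * \<delta>))" by (subst (asm) exp_le_cancel_iff[symmetric]) simp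
      ultimately show False by linarith
    qed
  qed
qed

lemma f_invariant_nonneg:
  fixes \<mu> :: "('r::finite, 'a::finite) config measure" and \<phi> :: real
  assumes \<mu>: "\<mu> \<in> invariant_probs" and f: "f_invariant \<mu> = ereal \<phi>"
    and joinings: "\<And>\<xi>. \<xi> \<in> self_joinings \<mu> \<Longrightarrow> f_invariant \<xi> \<le> ereal (2 * \<phi>)"
  shows "\<phi> \<ge> 0"
proof (rule ccontr)
  assume "\<not> \<phi> \<ge> 0"
  then have \<delta>: "- \<phi> / 4 > 0" by simp
  obtain \<epsilon> where \<epsilon>: "\<epsilon> > 0" and second: "\<forall>\<^sub>F n in sequentially. measure_pmf.expectation (uniform_hom n)
      (\<lambda>\<sigma>. real (card (microstates {1..n} \<sigma> \<mu> \<epsilon>)) ^ 2) \<le> exp (n * (2 * \<phi> + - \<phi> / 4))"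
    using second_moment_bound[OF \<mu> joinings \<delta>] by blast
  have "\<forall>\<^sub>F n in sequentially. False"
    using second first_moment_bound[OF \<mu> f \<epsilon> \<delta>] eventually_gt_at_top[of 0]
  proof eventually_elim
    case (elim n)
    have "real k \<le> real k ^ 2" for k :: nat by (cases k) (auto simp: power2_eq_square)
    then have "expected_microstates \<mu> \<epsilon> n \<le> measure_pmf.expectation (uniform_hom n)
      (\<lambda>\<sigma>. real (card (microstates {1..n} \<sigma> \<mu> \<epsilon>)) ^ 2)"
      unfolding expected_microstates_def expectation_avg by (intro avg_mono)
    then have "exp (n * (\<phi> - - \<phi> / 4)) \<le> exp (n * (2 * \<phi> + - \<phi> / 4))" using elim(1,2) by linarith
    then have "n * (\<phi> - - \<phi> / 4) \<le> n * (2 * \<phi> + - \<phi> / 4)" by (simp only: exp_le_cancel_iff)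
    then have "\<phi> - - \<phi> / 4 \<le> 2 * \<phi> + - \<phi> / 4"
      using elim(3) by (simp only: mult_le_cancel_left_pos of_nat_0_less_iff)
    then show False using \<delta> by simp
  qed
  then show False by simp
qed

lemma expected_rho_nonneg:
  fixes \<mu> :: "('r::finite, 'a::finite) config measure"
  assumes "\<mu> \<in> config_probs" "h \<le> ln (real CARD('a))" "n > 0"
  shows "avg (sym_homs n) (\<lambda>\<sigma>. rho {1..n} \<mu> \<sigma> h) \<ge> 0"
  unfolding avg_def using rho_nonneg[OF assms(1,3,2)] by (intro divide_nonneg_nonneg sum_nonneg) auto

lemma rho_upper_eq: "rho_upper \<mu> h = limsup (\<lambda>n. ereal (avg (sym_homs n) (\<lambda>\<sigma>. rho {1..n} \<mu> \<sigma> h)))"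
  unfolding rho_upper_def expectation_avg ..

lemma rho_lower_eq: "rho_lower \<mu> h = liminf (\<lambda>n. ereal (avg (sym_homs n) (\<lambda>\<sigma>. rho {1..n} \<mu> \<sigma> h)))"
  unfolding rho_lower_def expectation_avg ..

lemma rho_lower_nonneg:
  fixes \<mu> :: "('r::finite, 'a::finite) config measure"
  assumes "\<mu> \<in> config_probs" "h \<le> ln (real CARD('a))"
  shows "0 \<le> rho_lower \<mu> h"
  unfolding rho_lower_eq
proof (rule Liminf_bounded)
  show "\<forall>\<^sub>F n in sequentially. 0 \<le> ereal (avg (sym_homs n) (\<lambda>\<sigma>. rho {1..n} \<mu> \<sigma> h))"
    using eventually_gt_at_top[of 0]
  proof eventually_elim
    case (elim n)
    then show ?case using expected_rho_nonneg[OF assms, of n] by simp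
  qed
qed

lemma rho_lower_le_upper: "rho_lower \<mu> h \<le> rho_upper \<mu> h"
  unfolding rho_lower_eq rho_upper_eq by (rule Liminf_le_Limsup) simp

lemma h_flat_le_h_sharp:
  fixes \<mu> :: "('r::finite, 'a::finite) config measure"
  assumes "\<mu> \<in> config_probs"
  shows "h_flat \<mu> \<le> h_sharp \<mu>"
  unfolding h_flat_def h_sharp_def
proof (rule SUP_subset_mono)
  show "{h. 0 \<le> h \<and> h \<le> ln (real CARD('a)) \<and> rho_upper \<mu> h = 0} \<subseteq> {h. 0 \<le> h \<and> h \<le> ln (real CARD('a)) \<and> rho_lower \<mu> h = 0}"
  proof
    fix h assume "h \<in> {h. 0 \<le> h \<and> h \<le> ln (real CARD('a)) \<and> rho_upper \<mu> h = 0}"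
    then have h: "0 \<le> h" "h \<le> ln (real CARD('a))" "rho_upper \<mu> h = 0" by auto
    then have "rho_lower \<mu> h = 0"
      using rho_lower_nonneg[OF assms h(2)] rho_lower_le_upper[of \<mu> h] by (intro antisym) auto
    with h show "h \<in> {h. 0 \<le> h \<and> h \<le> ln (real CARD('a)) \<and> rho_lower \<mu> h = 0}" by blast
  qed
qed simp

lemma expected_microstates_ge_of_rho:
  fixes \<mu> :: "('r::finite, 'a::finite) config measure"
  assumes \<mu>: "\<mu> \<in> config_probs" and h: "h \<le> ln (real CARD('a))" and n: "n > 0" and \<epsilon>: "\<epsilon> > 0"
    and small: "avg (sym_homs n) (\<lambda>\<sigma>. rho {1..n} \<mu> \<sigma> h) < \<epsilon> / 2"
  shows "exp (n * h) / 2 \<le> expected_microstates \<mu> \<epsilon> n"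
proof -
  let ?H = "sym_homs n :: ('r free_word \<Rightarrow> nat \<Rightarrow> nat) set"
  let ?R = "\<lambda>\<sigma>. rho {1..n} \<mu> \<sigma> h" and ?X = "\<lambda>\<sigma>. real (card (microstates {1..n} \<sigma> \<mu> \<epsilon>))"
  let ?B = "{\<sigma> \<in> ?H. ?R \<sigma> < \<epsilon>}"
  note H = finite_hom_sym_group[of n, where 'r = 'r] hom_sym_group_nonempty[of n, where 'r = 'r]
  have c: "real (card ?H) > 0" using H by (simp add: card_gt_0_iff)
  have "card (?H - ?B) * \<epsilon> = (\<Sum>\<sigma>\<in>?H - ?B. \<epsilon>)" by simp
  also have "\<dots> \<le> (\<Sum>\<sigma>\<in>?H - ?B. ?R \<sigma>)" by (rule sum_mono) auto
  also have "\<dots> \<le> (\<Sum>\<sigma>\<in>?H. ?R \<sigma>)"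
    using H(1) rho_nonneg[OF \<mu> n h] by (intro sum_mono2) auto
  also have "\<dots> = card ?H * avg ?H ?R" using c by (simp add: avg_def)
  also have "\<dots> \<le> card ?H * (\<epsilon> / 2)" using small by (intro mult_left_mono) auto
  finally have "real (card (?H - ?B)) * \<epsilon> \<le> (card ?H / 2) * \<epsilon>" by simp
  then have "real (card (?H - ?B)) \<le> card ?H / 2" using \<epsilon> by (simp only: mult_le_cancel_right_pos)
  moreover have "real (card (?H - ?B)) = card ?H - real (card ?B)"
  proof -
    have "card ?B \<le> card ?H" using H(1) by (intro card_mono) auto
    moreover have "card (?H - ?B) = card ?H - card ?B" using H(1) by (intro card_Diff_subset) auto
    ultimately show ?thesis by (simp only: of_nat_diff)
  qed
  ultimately have B: "card ?H / 2 \<le> real (card ?B)" by linarith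
  have "card ?H * (exp (n * h) / 2) = (card ?H / 2) * exp (n * h)" by simp
  also have "\<dots> \<le> card ?B * exp (n * h)" using B by (intro mult_right_mono) auto
  also have "\<dots> = (\<Sum>\<sigma>\<in>?B. exp (n * h))" by simp
  also have "\<dots> \<le> (\<Sum>\<sigma>\<in>?B. ?X \<sigma>)" using rho_lessD[OF \<mu> n h] by (intro sum_mono) auto
  also have "\<dots> \<le> (\<Sum>\<sigma>\<in>?H. ?X \<sigma>)" using H(1) by (intro sum_mono2) auto
  finally show ?thesis
    unfolding expected_microstates_def expectation_avg avg_def using c by (simp add: field_simps)
qed

lemma h_sharp_le_f_invariant:
  fixes \<mu> :: "('r::finite, 'a::finite) config measure"
  assumes \<mu>: "\<mu> \<in> config_probs"
  shows "h_sharp \<mu> \<le> f_invariant \<mu>"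
  unfolding h_sharp_def
proof (rule SUP_least, rule ereal_le_epsilon2)
  fix h \<delta> :: real
  assume "h \<in> {h. 0 \<le> h \<and> h \<le> ln (real CARD('a)) \<and> rho_lower \<mu> h = 0}" and \<delta>: "\<delta> > 0"
  then have h: "h \<le> ln (real CARD('a))" "rho_lower \<mu> h = 0" by auto
  have "ereal (h - \<delta>) \<le> f_invariant \<mu>"
  proof (rule f_invariant_ge)
    fix \<epsilon> :: real assume \<epsilon>: "\<epsilon> > 0"
    let ?a = "\<lambda>n. avg (sym_homs n) (\<lambda>\<sigma>. rho {1..n} \<mu> \<sigma> h)"
    have "\<exists>\<^sub>F n in sequentially. ?a n < \<epsilon> / 2"
    proof (rule ccontr)
      assume "\<not> (\<exists>\<^sub>F n in sequentially. ?a n < \<epsilon> / 2)"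
      then have "\<forall>\<^sub>F n in sequentially. ereal (\<epsilon> / 2) \<le> ereal (?a n)"
        by (simp add: not_frequently not_less)
      then have "ereal (\<epsilon> / 2) \<le> rho_lower \<mu> h" unfolding rho_lower_eq by (rule Liminf_bounded)
      then show False using h(2) \<epsilon> by simp
    qed
    moreover have "\<forall>\<^sub>F n in sequentially. ln 2 + 0 * ln (1 + real n) \<le> real n * \<delta>"
      by (rule eventually_log_le_linear[OF \<delta>])
    moreover have "\<forall>\<^sub>F n in sequentially. n > (0 :: nat)" by (rule eventually_gt_at_top)
    ultimately have "\<exists>\<^sub>F n in sequentially. ?a n < \<epsilon> / 2 \<and> (ln 2 + 0 * ln (1 + real n) \<le> real n * \<delta> \<and> n > 0)"
      by (intro frequently_eventually_frequently eventually_conj)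
    then show "\<exists>\<^sub>F n in sequentially. exp (n * (h - \<delta>)) \<le> expected_microstates \<mu> \<epsilon> n"
    proof (rule frequently_elim1)
      fix n assume n: "?a n < \<epsilon> / 2 \<and> (ln 2 + 0 * ln (1 + real n) \<le> real n * \<delta> \<and> n > 0)"
      then have "n * (h - \<delta>) \<le> n * h - ln 2" by (simp add: algebra_simps)
      then have "exp (n * (h - \<delta>)) \<le> exp (n * h - ln 2)" by simp
      also have "\<dots> = exp (n * h) / 2" by (simp add: exp_diff)
      also have "\<dots> \<le> expected_microstates \<mu> \<epsilon> n"
        using n by (intro expected_microstates_ge_of_rho[OF \<mu> h(1) _ \<epsilon>]) auto
      finally show "exp (n * (h - \<delta>)) \<le> expected_microstates \<mu> \<epsilon> n" .
    qed
  qed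
  then have "ereal (h - \<delta>) + ereal \<delta> \<le> f_invariant \<mu> + ereal \<delta>" by (rule add_right_mono)
  then show "ereal h \<le> f_invariant \<mu> + ereal \<delta>" by simp
qed

lemma f_invariant_le_ln_card:
  fixes \<mu> :: "('r::finite, 'a::finite) config measure"
  shows "f_invariant \<mu> \<le> ereal (ln (real CARD('a)))"
proof (rule f_invariant_le[of 1])
  show "\<forall>\<^sub>F n in sequentially. expected_microstates \<mu> 1 n \<le> exp (n * ln (real CARD('a)))"
  proof (rule always_eventually, rule allI)
    fix n :: nat
    have fin: "finite ({1..n} \<rightarrow>\<^sub>E (UNIV :: 'a set))" by (intro finite_PiE) auto
    have "card (microstates {1..n} \<sigma> \<mu> 1) \<le> card ({1..n} \<rightarrow>\<^sub>E (UNIV :: 'a set))" for \<sigma>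
      by (rule card_mono[OF fin]) (auto simp: microstates_def)
    then have le: "real (card (microstates {1..n} \<sigma> \<mu> 1)) \<le> real CARD('a) ^ n" for \<sigma>
      by (simp add: card_PiE flip: of_nat_power)
    have "expected_microstates \<mu> 1 n \<le> avg (sym_homs n :: ('r free_word \<Rightarrow> nat \<Rightarrow> nat) set) (\<lambda>_. real CARD('a) ^ n)"
      unfolding expected_microstates_def expectation_avg by (rule avg_mono) (rule le)
    also have "\<dots> = real CARD('a) ^ n"
      by (rule avg_const[OF finite_hom_sym_group hom_sym_group_nonempty])
    also have "\<dots> = exp (n * ln (real CARD('a)))" by (subst exp_of_nat_mult) simp
    finally show "expected_microstates \<mu> 1 n \<le> exp (n * ln (real CARD('a)))" .
  qed
qed simp

lemma f_invariant_le_h_flat: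
  fixes \<mu> :: "('r::finite, 'a::finite) config measure" and \<phi> :: real
  assumes \<mu>: "\<mu> \<in> invariant_probs" and f: "f_invariant \<mu> = ereal \<phi>"
    and joinings: "\<And>\<xi>. \<xi> \<in> self_joinings \<mu> \<Longrightarrow> f_invariant \<xi> \<le> ereal (2 * \<phi>)"
  shows "f_invariant \<mu> \<le> h_flat \<mu>"
proof -
  have \<phi>: "0 \<le> \<phi>" "\<phi> \<le> ln (real CARD('a))"
    using f_invariant_nonneg[OF \<mu> f joinings] f_invariant_le_ln_card[of \<mu>] f by auto
  have good: "ereal h \<le> h_flat \<mu>" if h: "0 \<le> h" "h = 0 \<or> h < \<phi>" for h
  proof -
    have hA: "h \<le> ln (real CARD('a))" using h \<phi> by auto
    have "rho_upper \<mu> h \<le> 0"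
    proof (rule ereal_le_epsilon2)
      fix \<eta> :: real assume \<eta>: "\<eta> > 0"
      have "rho_upper \<mu> h \<le> ereal \<eta>"
        unfolding rho_upper_eq
        by (rule Limsup_bounded) (use expected_rho_eventually_le[OF \<mu> f joinings hA h(2) \<eta>] in simp)
      then show "rho_upper \<mu> h \<le> 0 + ereal \<eta>" by simp
    qed
    moreover have "0 \<le> rho_upper \<mu> h"
      using rho_lower_nonneg[OF invariant_probsD[OF \<mu>] hA] rho_lower_le_upper[of \<mu> h] by (rule order_trans)
    ultimately have "rho_upper \<mu> h = 0" by (rule antisym)
    then show ?thesis unfolding h_flat_def using h(1) hA by (intro SUP_upper) auto
  qed
  show ?thesis
  proof (rule ccontr)
    assume "\<not> f_invariant \<mu> \<le> h_flat \<mu>"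
    then have lt: "h_flat \<mu> < ereal \<phi>" by (simp add: f)
    obtain c where c: "h_flat \<mu> < ereal c" "ereal c < ereal \<phi>"
      using ereal_dense2[OF lt] by blast
    have "ereal (max c 0) \<le> h_flat \<mu>"
      using c(2) \<phi>(1) by (intro good) auto
    then show False using c(1) by (metis ereal_less_eq(3) less_le_trans max.cobounded1 not_le order_trans)
  qed
qed

theorem corollary2p7:
  fixes \<mu> :: "('r::finite, 'a::finite) config measure"
  assumes "\<mu> \<in> invariant_probs"
    and "\<forall>\<xi>\<in>self_joinings \<mu>. f_invariant \<xi> \<le> f_invariant (product_self_joining \<mu>)"
  shows "f_invariant \<mu> = h_flat \<mu> \<and> h_flat \<mu> = h_sharp \<mu>"
proof -
  note cp = invariant_probsD[OF assms(1)]
  have up: "h_flat \<mu> \<le> h_sharp \<mu>" "h_sharp \<mu> \<le> f_invariant \<mu>"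
    by (rule h_flat_le_h_sharp[OF cp], rule h_sharp_le_f_invariant[OF cp])
  have "f_invariant \<mu> \<le> h_flat \<mu>"
  proof (cases "f_invariant \<mu>")
    case (real \<phi>)
    have "f_invariant \<xi> \<le> ereal (2 * \<phi>)" if "\<xi> \<in> self_joinings \<mu>" for \<xi>
      using assms(2) that f_invariant_product_le[OF assms(1) real] by (blast intro: order_trans)
    then show ?thesis by (rule f_invariant_le_h_flat[OF assms(1) real])
  next
    case PInf
    then show ?thesis using f_invariant_le_ln_card[of \<mu>] by simp
  next
    case MInf
    then show ?thesis by simp
  qed
  with up show ?thesis by (metis antisym order_trans)
qed

end
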